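(* Let $S\in\mathcal{S}_{n,k}$ be a Steiner bundle on $\mathbf{P}^n$. If $W(S)$ contains at least $n+k+1$ hyperplanes, then for every subset $\mathcal{H}\subset W(S)$ consisting of $n+k+1$ hyperplanes one has $S\simeq\Omega(\log\mathcal{H})$; in particular $S$ is logarithmic.
   Context: $V$ is a complex vector space of dimension $n+1$, and $\mathbf{P}^n=\mathbf{P}(V)$ with $H^0(\mathcal{O}(1))=V$; hyperplanes are points of $\mathbf{P}(V^* )$. A Steiner bundle over $\mathbf{P}^n$ is a vector bundle $S$ whose dual $S^*$ appears in an exact sequence $0\to S^*\to W\otimes\mathcal{O}\to I\otimes\mathcal{O}(1)\to 0$ with $W,I$ complex vector spaces of dimension $n+k$ and $k$; $\mathcal{S}_{n,k}$ denotes the family of such bundles. The closed points of $W(S)\subset\mathbf{P}(V^* )$ are the unstable hyperplanes of $S$, i.e. the hyperplanes $H$ with $h^0(S^*_{|H})\neq0$. For a union $\mathcal{H}$ of hyperplanes with normal crossing (any $m\le n+1$ of them have linearly independent equations), $\Omega(\log\mathcal{H})$ is the bundle of meromorphic $1$-forms with at most logarithmic poles along $\mathcal{H}$; bundles of this form are called logarithmic.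
   Formalization: For k ≤ 1 the isomorphism S ≃ Ω(log H) is claimed only for subsets H with normal crossing, since then W(S) also contains subsets without normal crossing (n ≥ 2), for which Ω(log H) is undefined; for k ≥ 2 normal crossing is proved. *)

theory Defs
  imports "Jordan_Normal_Form.Matrix" "HOL-Library.Extended_Nat"
begin

text \<open>
  Everything is algebraic over the complex numbers, and points are closed points.
  Choosing a basis of \<open>V\<close>, points of \<open>\<bold>P\<^sup>n = \<bold>P(V)\<close> are given by homogeneous coordinate
  vectors \<open>x \<noteq> 0\<close> of length \<open>n + 1\<close>, and elements of \<open>V = H\<^sup>0(\<O>(1))\<close> are linear forms
  \<open>x \<mapsto> a \<bullet> x\<close>.  A subset of \<open>\<bold>P\<^sup>n\<close> is represented by the set of all homogeneous coordinate
  vectors of its points (its punctured cone); functions on it, and sections of \<open>\<O>(d)\<close>, are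
  functions on that cone.
\<close>

section \<open>Projective space, regular functions\<close>

definition proj_space :: "nat \<Rightarrow> complex vec set" where
  "proj_space n = carrier_vec (n + 1) - {0\<^sub>v (n + 1)}"

inductive_set poly_fun :: "nat \<Rightarrow> (complex vec \<Rightarrow> complex) set" for n :: nat where
  const: "(\<lambda>x. c) \<in> poly_fun n"
| coord: "i \<le> n \<Longrightarrow> (\<lambda>x. x $ i) \<in> poly_fun n"
| add: "p \<in> poly_fun n \<Longrightarrow> q \<in> poly_fun n \<Longrightarrow> (\<lambda>x. p x + q x) \<in> poly_fun n"
| mult: "p \<in> poly_fun n \<Longrightarrow> q \<in> poly_fun n \<Longrightarrow> (\<lambda>x. p x * q x) \<in> poly_fun n"

definition form :: "nat \<Rightarrow> nat \<Rightarrow> (complex vec \<Rightarrow> complex) \<Rightarrow> bool" where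
  "form n d p \<longleftrightarrow> p \<in> poly_fun n \<and>
     (\<forall>c. \<forall>x\<in>carrier_vec (n + 1). p (c \<cdot>\<^sub>v x) = c ^ d * p x)"

definition zariski_open :: "nat \<Rightarrow> complex vec set \<Rightarrow> bool" where
  "zariski_open n U \<longleftrightarrow>
     (\<exists>F. (\<forall>p\<in>F. \<exists>d. form n d p) \<and> U = {x \<in> proj_space n. \<exists>p\<in>F. p x \<noteq> 0})"

text \<open>
  Sections of \<open>\<O>(d)\<close> over a locally closed \<open>A \<subseteq> \<bold>P\<^sup>n\<close> with its reduced structure: functions
  that are locally quotients of forms whose degrees differ by \<open>d\<close>.  For \<open>d = 0\<close> these are the
  regular functions on \<open>A\<close>.  Only the values on \<open>A\<close> matter.
\<close>

definition regular_on ::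
    "nat \<Rightarrow> int \<Rightarrow> complex vec set \<Rightarrow> (complex vec \<Rightarrow> complex) \<Rightarrow> bool" where
  "regular_on n d A f \<longleftrightarrow>
     (\<forall>x\<in>A. \<exists>U p q a b. zariski_open n U \<and> x \<in> U \<and> form n a p \<and> form n b q \<and>
        int a - int b = d \<and> (\<forall>y\<in>U \<inter> A. q y \<noteq> 0 \<and> f y = p y / q y))"

definition regular_mat ::
    "nat \<Rightarrow> complex vec set \<Rightarrow> nat \<Rightarrow> nat \<Rightarrow> (complex vec \<Rightarrow> complex mat) \<Rightarrow> bool" where
  "regular_mat n A r s M \<longleftrightarrow>
     (\<forall>x\<in>A. M x \<in> carrier_mat r s) \<and>
     (\<forall>i<r. \<forall>j<s. regular_on n 0 A (\<lambda>x. M x $$ (i, j)))"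

section \<open>Vector bundles\<close>

text \<open>
  An algebraic vector bundle is given by an open cover and transition matrices
  \<open>g\<^sub>i\<^sub>j\<close>, with the convention \<open>u\<^sub>i = g\<^sub>i\<^sub>j u\<^sub>j\<close> for the coordinates of a point of the
  total space.
\<close>

record 'j vbundle =
  brank :: nat
  idx :: "'j set"
  chart :: "'j \<Rightarrow> complex vec set"
  transition :: "'j \<Rightarrow> 'j \<Rightarrow> complex vec \<Rightarrow> complex mat"

definition vector_bundle :: "nat \<Rightarrow> 'j vbundle \<Rightarrow> bool" where
  "vector_bundle n E \<longleftrightarrow>
     (\<forall>i\<in>idx E. zariski_open n (chart E i)) \<and>
     (\<Union>i\<in>idx E. chart E i) = proj_space n \<and>
     (\<forall>i\<in>idx E. \<forall>j\<in>idx E.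
        regular_mat n (chart E i \<inter> chart E j) (brank E) (brank E) (transition E i j)) \<and>
     (\<forall>i\<in>idx E. \<forall>x\<in>chart E i. transition E i i x = 1\<^sub>m (brank E)) \<and>
     (\<forall>i\<in>idx E. \<forall>j\<in>idx E. \<forall>l\<in>idx E. \<forall>x\<in>chart E i \<inter> chart E j \<inter> chart E l.
        transition E i j x * transition E j l x = transition E i l x)"

text \<open>The dual cocycle is the inverse transpose; here \<open>g\<^sub>i\<^sub>j\<close> has inverse \<open>g\<^sub>j\<^sub>i\<close>.\<close>

definition dual_bundle :: "'j vbundle \<Rightarrow> 'j vbundle" where
  "dual_bundle E =
     \<lparr>brank = brank E, idx = idx E, chart = chart E,
      transition = (\<lambda>i j x. transpose_mat (transition E j i x))\<rparr>"

text \<open>\<open>\<complex>\<^sup>r \<otimes> \<O>\<close>\<close>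

definition trivial_bundle :: "nat \<Rightarrow> nat \<Rightarrow> unit vbundle" where
  "trivial_bundle n r =
     \<lparr>brank = r, idx = UNIV, chart = (\<lambda>_. proj_space n), transition = (\<lambda>_ _ _. 1\<^sub>m r)\<rparr>"

text \<open>
  \<open>\<complex>\<^sup>r \<otimes> \<O>(1)\<close> on the standard affine cover: a linear form \<open>F\<close>, as a section of \<open>\<O>(1)\<close>, has
  the coordinate \<open>F / x\<^sub>i\<close> over \<open>{x\<^sub>i \<noteq> 0}\<close>.
\<close>

definition O1_bundle :: "nat \<Rightarrow> nat \<Rightarrow> nat vbundle" where
  "O1_bundle n r =
     \<lparr>brank = r, idx = {..n}, chart = (\<lambda>i. {x \<in> proj_space n. x $ i \<noteq> 0}),
      transition = (\<lambda>i j x. (x $ j / x $ i) \<cdot>\<^sub>m 1\<^sub>m r)\<rparr>"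

text \<open>\<open>\<phi> a i\<close> is the matrix of the morphism from the \<open>i\<close>-th chart of \<open>E\<close> to the \<open>a\<close>-th of \<open>F\<close>.\<close>

definition bundle_morphism ::
    "nat \<Rightarrow> 'i vbundle \<Rightarrow> 'a vbundle \<Rightarrow> ('a \<Rightarrow> 'i \<Rightarrow> complex vec \<Rightarrow> complex mat) \<Rightarrow> bool" where
  "bundle_morphism n E F \<phi> \<longleftrightarrow>
     (\<forall>i\<in>idx E. \<forall>a\<in>idx F.
        regular_mat n (chart E i \<inter> chart F a) (brank F) (brank E) (\<phi> a i)) \<and>
     (\<forall>i\<in>idx E. \<forall>j\<in>idx E. \<forall>a\<in>idx F. \<forall>b\<in>idx F.
        \<forall>x\<in>chart E i \<inter> chart E j \<inter> chart F a \<inter> chart F b.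
          \<phi> a i x * transition E i j x = transition F a b x * \<phi> b j x)"

text \<open>
  Exactness of \<open>0 \<rightarrow> E \<rightarrow> F \<rightarrow> G \<rightarrow> 0\<close> for vector bundles is exactness on every fibre.
\<close>

definition short_exact ::
    "nat \<Rightarrow> 'i vbundle \<Rightarrow> 'a vbundle \<Rightarrow> 'c vbundle \<Rightarrow>
     ('a \<Rightarrow> 'i \<Rightarrow> complex vec \<Rightarrow> complex mat) \<Rightarrow>
     ('c \<Rightarrow> 'a \<Rightarrow> complex vec \<Rightarrow> complex mat) \<Rightarrow> bool" where
  "short_exact n E F G \<phi> \<psi> \<longleftrightarrow>
     bundle_morphism n E F \<phi> \<and> bundle_morphism n F G \<psi> \<and>
     (\<forall>i\<in>idx E. \<forall>a\<in>idx F. \<forall>c\<in>idx G. \<forall>x\<in>chart E i \<inter> chart F a \<inter> chart G c.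
        inj_on (\<lambda>u. \<phi> a i x *\<^sub>v u) (carrier_vec (brank E)) \<and>
        (\<lambda>u. \<phi> a i x *\<^sub>v u) ` carrier_vec (brank E) =
          {v \<in> carrier_vec (brank F). \<psi> c a x *\<^sub>v v = 0\<^sub>v (brank G)} \<and>
        (\<lambda>v. \<psi> c a x *\<^sub>v v) ` carrier_vec (brank F) = carrier_vec (brank G))"

text \<open>Steiner bundles: membership in \<open>\<S>\<^sub>n\<^sub>,\<^sub>k\<close>, with bases of \<open>W\<close> and \<open>I\<close> chosen.\<close>

definition steiner :: "nat \<Rightarrow> nat \<Rightarrow> 'j vbundle \<Rightarrow> bool" where
  "steiner n k S \<longleftrightarrow> vector_bundle n S \<and>
     (\<exists>\<phi> \<psi>. short_exact n (dual_bundle S) (trivial_bundle n (n + k)) (O1_bundle n k) \<phi> \<psi>)"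

section \<open>Sections and unstable hyperplanes\<close>

text \<open>
  Sections over a locally closed \<open>A\<close> of the restriction of \<open>E\<close> to \<open>A\<close>.  They are
  normalised to vanish where they are not defined, so that equal sections are equal functions.
\<close>

definition bundle_sections ::
    "nat \<Rightarrow> 'j vbundle \<Rightarrow> complex vec set \<Rightarrow> ('j \<Rightarrow> complex vec \<Rightarrow> complex vec) set" where
  "bundle_sections n E A =
     {s. (\<forall>i x. \<not> (i \<in> idx E \<and> x \<in> A \<inter> chart E i) \<longrightarrow> s i x = 0\<^sub>v (brank E)) \<and>
         (\<forall>i\<in>idx E. (\<forall>x\<in>A \<inter> chart E i. s i x \<in> carrier_vec (brank E)) \<and>
            (\<forall>m<brank E. regular_on n 0 (A \<inter> chart E i) (\<lambda>x. s i x $ m))) \<and>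
         (\<forall>i\<in>idx E. \<forall>j\<in>idx E. \<forall>x\<in>A \<inter> chart E i \<inter> chart E j.
            s i x = transition E i j x *\<^sub>v s j x)}"

text \<open>
  \<open>h\<^sup>0(E\<^sub>|\<^sub>A)\<close>: the dimension of the space of sections, as the least size of a generating
  family (\<open>\<infinity>\<close> if there is no finite one).
\<close>

definition h0 :: "nat \<Rightarrow> 'j vbundle \<Rightarrow> complex vec set \<Rightarrow> enat" where
  "h0 n E A = Inf {enat d |d. \<exists>b. (\<forall>l<d. b l \<in> bundle_sections n E A) \<and>
     (\<forall>s\<in>bundle_sections n E A. \<exists>c. \<forall>i\<in>idx E. \<forall>x\<in>A \<inter> chart E i. \<forall>m<brank E.
        s i x $ m = (\<Sum>l<d. c l * (b l i x $ m)))}"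

definition hyperplane_eq :: "nat \<Rightarrow> complex vec \<Rightarrow> complex vec set \<Rightarrow> bool" where
  "hyperplane_eq n a H \<longleftrightarrow>
     a \<in> carrier_vec (n + 1) \<and> a \<noteq> 0\<^sub>v (n + 1) \<and> H = {x \<in> proj_space n. a \<bullet> x = 0}"

definition hyperplane :: "nat \<Rightarrow> complex vec set \<Rightarrow> bool" where
  "hyperplane n H \<longleftrightarrow> (\<exists>a. hyperplane_eq n a H)"

text \<open>The closed points of \<open>W(S)\<close>.\<close>

definition unstable_hyperplanes :: "nat \<Rightarrow> 'j vbundle \<Rightarrow> complex vec set set" where
  "unstable_hyperplanes n S = {H. hyperplane n H \<and> h0 n (dual_bundle S) H \<noteq> 0}"

definition normal_crossing :: "nat \<Rightarrow> complex vec set set \<Rightarrow> bool" where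
  "normal_crossing n \<H> \<longleftrightarrow> finite \<H> \<and> (\<forall>H\<in>\<H>. hyperplane n H) \<and>
     (\<forall>\<T>\<subseteq>\<H>. \<forall>a. card \<T> \<le> n + 1 \<and> (\<forall>H\<in>\<T>. hyperplane_eq n (a H) H) \<longrightarrow>
        (\<forall>c. (\<forall>i\<le>n. (\<Sum>H\<in>\<T>. c H * (a H $ i)) = 0) \<longrightarrow> (\<forall>H\<in>\<T>. c H = 0)))"

section \<open>Logarithmic bundles\<close>

text \<open>
  A 1-form on an open \<open>U \<subseteq> \<bold>P\<^sup>n\<close> is written as its pull-back \<open>\<Sum> \<eta>\<^sub>i dx\<^sub>i\<close> to the cone over \<open>U\<close>:
  the \<open>\<eta>\<^sub>i\<close> are homogeneous of degree \<open>-1\<close>, and the contraction \<open>\<Sum> \<eta>\<^sub>i x\<^sub>i\<close> with the Euler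
  field vanishes.
\<close>

definition one_forms :: "nat \<Rightarrow> complex vec set \<Rightarrow> (complex vec \<Rightarrow> complex vec) set" where
  "one_forms n U =
     {\<eta>. (\<forall>x. x \<notin> U \<longrightarrow> \<eta> x = 0\<^sub>v (n + 1)) \<and>
          (\<forall>x\<in>U. \<eta> x \<in> carrier_vec (n + 1) \<and> \<eta> x \<bullet> x = 0) \<and>
          (\<forall>i\<le>n. regular_on n (-1) U (\<lambda>x. \<eta> x $ i))}"

text \<open>The 1-form \<open>d log (a / b)\<close>, for linear forms \<open>a\<close> and \<open>b\<close>.\<close>

definition dlog :: "complex vec \<Rightarrow> complex vec \<Rightarrow> complex vec \<Rightarrow> complex vec" where
  "dlog a b x = (1 / (a \<bullet> x)) \<cdot>\<^sub>v a - (1 / (b \<bullet> x)) \<cdot>\<^sub>v b"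

text \<open>
  Forms on \<open>U\<close> with at most logarithmic poles along \<open>\<H>\<close>: regular forms off \<open>\<H>\<close> which near
  every point \<open>p\<close> of \<open>U\<close> are combinations, with regular coefficients, of regular forms and of
  the \<open>d log\<close> of local equations of the members of \<open>\<H>\<close> through \<open>p\<close>.  The local equation of
  the hyperplane \<open>a = 0\<close> is \<open>a / b\<close> with \<open>b\<close> a linear form that does not vanish near \<open>p\<close>.
\<close>

definition log_forms ::
    "nat \<Rightarrow> complex vec set set \<Rightarrow> complex vec set \<Rightarrow> (complex vec \<Rightarrow> complex vec) set" where
  "log_forms n \<H> U =
     {\<omega> \<in> one_forms n (U - \<Union>\<H>).
        \<forall>p\<in>U. \<exists>U' b a f \<eta>. zariski_open n U' \<and> p \<in> U' \<and> U' \<subseteq> U \<and>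
          b \<in> carrier_vec (n + 1) \<and> (\<forall>x\<in>U'. b \<bullet> x \<noteq> 0) \<and>
          (\<forall>H\<in>\<H>. p \<in> H \<longrightarrow> hyperplane_eq n (a H) H \<and> regular_on n 0 U' (f H)) \<and>
          \<eta> \<in> one_forms n U' \<and>
          (\<forall>x\<in>U' - \<Union>\<H>. \<forall>i\<le>n.
             \<omega> x $ i = \<eta> x $ i + (\<Sum>H\<in>{H \<in> \<H>. p \<in> H}. f H x * (dlog (a H) b x $ i)))}"

text \<open>
  Sheaves of \<open>\<O>\<close>-modules on \<open>\<bold>P\<^sup>n\<close>, given by their sections over open sets, the addition, the
  multiplication by regular functions and the restriction to a smaller open set.
\<close>

record 's omodule =
  sections_over :: "complex vec set \<Rightarrow> 's set"
  oplus :: "'s \<Rightarrow> 's \<Rightarrow> 's"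
  omult :: "(complex vec \<Rightarrow> complex) \<Rightarrow> 's \<Rightarrow> 's"
  ores :: "complex vec set \<Rightarrow> 's \<Rightarrow> 's"

definition omodule_iso :: "nat \<Rightarrow> 's omodule \<Rightarrow> 't omodule \<Rightarrow> bool" where
  "omodule_iso n F G \<longleftrightarrow> (\<exists>\<Phi>.
     (\<forall>U. zariski_open n U \<longrightarrow>
        bij_betw (\<Phi> U) (sections_over F U) (sections_over G U) \<and>
        (\<forall>s\<in>sections_over F U. \<forall>t\<in>sections_over F U.
           \<Phi> U (oplus F s t) = oplus G (\<Phi> U s) (\<Phi> U t)) \<and>
        (\<forall>f. \<forall>s\<in>sections_over F U. regular_on n 0 U f \<longrightarrow>
           \<Phi> U (omult F f s) = omult G f (\<Phi> U s)) \<and>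
        (\<forall>U'. zariski_open n U' \<and> U' \<subseteq> U \<longrightarrow>
           (\<forall>s\<in>sections_over F U. \<Phi> U' (ores F U' s) = ores G U' (\<Phi> U s)))))"

definition bundle_sheaf ::
    "nat \<Rightarrow> 'j vbundle \<Rightarrow> ('j \<Rightarrow> complex vec \<Rightarrow> complex vec) omodule" where
  "bundle_sheaf n E =
     \<lparr>sections_over = bundle_sections n E,
      oplus = (\<lambda>s t i x. s i x + t i x),
      omult = (\<lambda>f s i x. f x \<cdot>\<^sub>v s i x),
      ores = (\<lambda>U s i x. if x \<in> U then s i x else 0\<^sub>v (brank E))\<rparr>"

definition Omega_log ::
    "nat \<Rightarrow> complex vec set set \<Rightarrow> (complex vec \<Rightarrow> complex vec) omodule" where
  "Omega_log n \<H> =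
     \<lparr>sections_over = log_forms n \<H>,
      oplus = (\<lambda>\<omega> \<eta> x. \<omega> x + \<eta> x),
      omult = (\<lambda>f \<omega> x. f x \<cdot>\<^sub>v \<omega> x),
      ores = (\<lambda>U \<omega> x. if x \<in> U then \<omega> x else 0\<^sub>v (n + 1))\<rparr>"

definition logarithmic :: "nat \<Rightarrow> 'j vbundle \<Rightarrow> bool" where
  "logarithmic n S \<longleftrightarrow>
     (\<exists>\<H>. normal_crossing n \<H> \<and> omodule_iso n (bundle_sheaf n S) (Omega_log n \<H>))"

end

theory Submission
  imports Defs "HOL-Library.Function_Algebras" "HOL-Library.FuncSet" "HOL-Computational_Algebra.Fundamental_Theorem_Algebra" "Jordan_Normal_Form.Determinant"
begin

text \<open>
  The morphism onto \<open>I \<otimes> \<O>(1)\<close> is a tensor, and a section of the dual bundle over the hyperplane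
  \<open>a = 0\<close> is a vector \<open>w\<close> of \<open>W\<close> that the tensor contracts to a rank one matrix \<open>a \<otimes> i\<close>.  By Hopf's
  lemma on nonsingular bilinear maps, the number of independent vectors \<open>w\<^sub>j\<close> of this kind is at
  most the number of linear conditions on \<open>(x, y)\<close> that make every \<open>a\<^sub>j(x) i\<^sub>j(y)\<close> vanish.  For
  \<open>k \<ge> 2\<close> this forces normal crossing.  For \<open>n + k + 1\<close> hyperplanes with normal crossing it
  shows that the \<open>w\<^sub>j\<close> satisfy one single relation and that all its coefficients are non-zero; rescale
  it to \<open>\<Sum> w\<^sub>j = 0\<close>.  Then \<open>\<xi> \<mapsto> \<Sum> \<xi>(w\<^sub>j) d log a\<^sub>j\<close> maps \<open>W\<^sup>* \<otimes> \<O>\<close> to the logarithmic forms.  Off the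
  hyperplanes its kernel is the image of \<open>I\<^sup>* \<otimes> \<O>(-1)\<close>, the kernel of \<open>W\<^sup>* \<otimes> \<O> \<rightarrow> S\<close>; both maps have
  local lifts everywhere, and regular functions that agree off the hyperplanes are equal.
\<close>

section \<open>Linear systems\<close>

text \<open>\<open>W\<close> has dimension \<open>n + k\<close>, exactly one more than the
  \<open>(n + 1) + k - 2\<close> equations that Hopf's lemma can always solve with \<open>x\<close>
  and \<open>y\<close> non-zero, so the tensor of a Steiner bundle is as tight as possible and every
  count is decided by a single dimension. Contracted with the tensor, a relation between the
  \<open>w_j\<close> becomes for each \<open>y\<close> a relation
  \<open>\<Sum> c_j i_j(y) a_j = 0\<close> between the equations, and normal crossing limits those.

  The normalisation \<open>\<Sum> w_j = 0\<close> does two jobs. It makes the residues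
  \<open>\<xi>(w_j)\<close> sum to zero, which is what a form on the cone needs to descend to
  projective space; contracted with the tensor it becomes \<open>\<Sum> i_j(y) a_j = 0\<close>,
  which puts the image of \<open>B\<close> into the kernel. As it is the only relation, the residues
  are otherwise arbitrary.

  For \<open>k \<le> 1\<close> and \<open>n > 0\<close> every hyperplane is unstable:
  \<open>S\<close> is trivial for \<open>k = 0\<close> and the tangent bundle twisted by
  \<open>-1\<close> for \<open>k = 1\<close>. A subset of \<open>W(S)\<close> can then fail to have
  normal crossing, so this is assumed there, and that \<open>S\<close> is logarithmic comes from an
  explicit arrangement.\<close>

lemma kernel_parametrization:
  fixes M :: "'e \<Rightarrow> 'i \<Rightarrow> complex"
  assumes "finite E" "finite I"
  shows "\<exists>I'\<subseteq>I. \<exists>T. card I \<le> card I' + card E \<and> (\<forall>z. \<forall>i\<in>I'. (\<Sum>j\<in>I'. T i j * z j) = z i) \<and>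
    (\<forall>z. \<forall>e\<in>E. (\<Sum>i\<in>I. M e i * (\<Sum>j\<in>I'. T i j * z j)) = 0)"
  using assms(1)
proof (induction E rule: finite_induct)
  case empty
  show ?case
    by (rule exI[of _ I], simp, rule exI[of _ "\<lambda>i j. if i = j then 1 else 0"])
       (use assms(2) in \<open>simp add: if_distrib[of "\<lambda>x. x * _"] cong: if_cong\<close>)
next
  case (insert e E)
  obtain I' T where *: "I' \<subseteq> I" "card I \<le> card I' + card E"
      "\<forall>z. \<forall>i\<in>I'. (\<Sum>j\<in>I'. T i j * z j) = z i"
      "\<forall>z. \<forall>e\<in>E. (\<Sum>i\<in>I. M e i * (\<Sum>j\<in>I'. T i j * z j)) = 0"
    using insert.IH by (elim exE conjE) (rule that, assumption+)
  note IT = *(1,2) *(3,4)[rule_format]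
  have fI': "finite I'" using IT(1) assms(2) finite_subset by blast
  define c where "c j = (\<Sum>i\<in>I. M e i * T i j)" for j
  have c: "(\<Sum>i\<in>I. M e i * (\<Sum>j\<in>I'. T i j * z j)) = (\<Sum>j\<in>I'. c j * z j)" for z
    unfolding c_def sum_distrib_left sum_distrib_right
    by (subst sum.swap) (simp add: mult.assoc)
  show ?case
  proof (cases "\<forall>j\<in>I'. c j = 0")
    case True
    show ?thesis
      by (rule exI[of _ I'], rule conjI[OF IT(1)], rule exI[of _ T])
         (use IT(2) *(3) IT(4) c True insert in \<open>simp; fail\<close>)
  next
    case False
    then obtain q where q: "q \<in> I'" "c q \<noteq> 0" by auto
    define I'' where "I'' = I' - {q}"
    have fI'': "finite I''" using fI' by (simp add: I''_def)
    \<comment> \<open>On the old parameters the new equation is the functional \<open>c\<close>. It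
      is solved for the parameter \<open>q\<close>: \<open>ex\<close> restores the eliminated
      coordinate and \<open>T'\<close> is \<open>T\<close> after \<open>ex\<close>.\<close>
    define T' where "T' i j = T i j - T i q * c j / c q" for i j
    define ex where "ex z j = (if j = q then - (\<Sum>j\<in>I''. c j * z j) / c q else z j)" for z j
    have T'ex: "(\<Sum>j\<in>I''. T' i j * z j) = (\<Sum>j\<in>I'. T i j * ex z j)" for z i
    proof -
      have "(\<Sum>j\<in>I'. T i j * ex z j) = T i q * ex z q + (\<Sum>j\<in>I''. T i j * ex z j)"
        unfolding I''_def by (rule sum.remove[OF fI' q(1)])
      also have "(\<Sum>j\<in>I''. T i j * ex z j) = (\<Sum>j\<in>I''. T i j * z j)"
        by (rule sum.cong) (auto simp: ex_def I''_def)
      finally show ?thesis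
        by (simp add: T'_def ex_def left_diff_distrib sum_subtractf sum_distrib_left sum_divide_distrib mult.assoc)
    qed
    have cex: "(\<Sum>j\<in>I'. c j * ex z j) = 0" for z
    proof -
      have "(\<Sum>j\<in>I'. c j * ex z j) = c q * ex z q + (\<Sum>j\<in>I''. c j * ex z j)"
        unfolding I''_def by (rule sum.remove[OF fI' q(1)])
      also have "(\<Sum>j\<in>I''. c j * ex z j) = (\<Sum>j\<in>I''. c j * z j)"
        by (rule sum.cong) (auto simp: ex_def I''_def)
      finally show ?thesis using q(2) by (simp add: ex_def)
    qed
    have "card I' = Suc (card I'')"
      unfolding I''_def using q(1) fI' by (metis card.remove)
    then have s1: "card I \<le> card I'' + card (insert e E)" using IT(2) insert by simp
    have s2: "(\<Sum>j\<in>I''. T' i j * z j) = z i" if "i \<in> I''" for z i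
      using that IT(3)[of i "ex z"] by (simp add: T'ex) (auto simp: ex_def I''_def)
    have s3: "(\<Sum>i\<in>I. M e' i * (\<Sum>j\<in>I''. T' i j * z j)) = 0" if "e' \<in> insert e E" for z e'
      using that IT(4)[of e' "ex z"] c[of "ex z"] cex[of z] by (auto simp: T'ex)
    have s4: "I'' \<subseteq> I" using IT(1) by (auto simp: I''_def)
    show ?thesis
      by (rule exI[of _ I''], rule conjI[OF s4], rule exI[of _ T'], intro conjI allI ballI s1 s2 s3)
  qed
qed

text \<open>At least one parameter stays free. Giving all parameters the value 1 makes a solution
  whose coordinate at a parameter index is 1.\<close>

lemma underdetermined_system:
  fixes M :: "'e \<Rightarrow> 'i \<Rightarrow> complex"
  assumes "finite E" "finite I" "card E < card I"
  shows "\<exists>x. (\<exists>i\<in>I. x i \<noteq> 0) \<and> (\<forall>e\<in>E. (\<Sum>i\<in>I. M e i * x i) = 0)"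
proof -
  obtain I' T where *: "I' \<subseteq> I" "card I \<le> card I' + card E"
      "\<forall>z. \<forall>i\<in>I'. (\<Sum>j\<in>I'. T i j * z j) = z i"
      "\<forall>z. \<forall>e\<in>E. (\<Sum>i\<in>I. M e i * (\<Sum>j\<in>I'. T i j * z j)) = 0"
    using kernel_parametrization[OF assms(1,2), of M] by (elim exE conjE) (rule that, assumption+)
  note IT = *(1,2) *(3,4)[rule_format]
  have "I' \<noteq> {}" using assms IT(2) by auto
  then obtain i where "i \<in> I'" by auto
  define x where "x i = (\<Sum>j\<in>I'. T i j * 1)" for i
  have "x i = 1" unfolding x_def by (rule IT(3)[OF \<open>i \<in> I'\<close>])
  moreover have "\<forall>e\<in>E. (\<Sum>i\<in>I. M e i * x i) = 0" unfolding x_def using IT(4)[of _ "\<lambda>_. 1"] by blast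
  ultimately show ?thesis using \<open>i \<in> I'\<close> IT(1)
    by (intro exI[of _ x] conjI bexI[of _ i]) (simp_all only: one_neq_zero not_False_eq_True subsetD)
qed

text \<open>Injectivity gives surjectivity by homogenising: the right-hand side is attached to an
  extra unknown \<open>None\<close>, and injectivity forbids a non-trivial solution in which that
  unknown is zero.\<close>

lemma square_system_solvable:
  fixes M :: "'e \<Rightarrow> 'i \<Rightarrow> complex"
  assumes fin: "finite E" "finite I" and card: "card E \<le> card I"
    and inj: "\<And>u. (\<And>e. e \<in> E \<Longrightarrow> (\<Sum>i\<in>I. M e i * u i) = 0) \<Longrightarrow> \<forall>i\<in>I. u i = 0"
  shows "\<exists>u. \<forall>e\<in>E. (\<Sum>i\<in>I. M e i * u i) = v e"
proof -
  define I0 where "I0 = insert None (Some ` I)"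
  have "card I0 = Suc (card I)"
    unfolding I0_def using fin by (simp add: card_image)
  then obtain x where x: "\<exists>i\<in>I0. x i \<noteq> 0"
    "\<And>e. e \<in> E \<Longrightarrow> (\<Sum>i\<in>I0. (case i of None \<Rightarrow> - v e | Some i \<Rightarrow> M e i) * x i) = 0"
    using underdetermined_system[of E I0 "\<lambda>e i. case i of None \<Rightarrow> - v e | Some i \<Rightarrow> M e i"] fin card
    by (auto simp: I0_def)
  have eq: "(\<Sum>i\<in>I. M e i * x (Some i)) = v e * x None" if "e \<in> E" for e
    using x(2)[OF that] fin by (simp add: I0_def sum.reindex image_iff)
  have "x None \<noteq> 0"
  proof
    assume "x None = 0"
    then have "\<forall>i\<in>I. x (Some i) = 0" using inj[of "\<lambda>i. x (Some i)"] eq by simp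
    with x(1) \<open>x None = 0\<close> show False by (auto simp: I0_def)
  qed
  then show ?thesis
    by (intro exI[of _ "\<lambda>i. x (Some i) / x None"]) (simp add: eq sum_divide_distrib[symmetric])
qed

lemma independent_family_complement:
  fixes w :: "'j \<Rightarrow> 'l \<Rightarrow> complex"
  assumes fin: "finite J" "finite L"
    and indep: "\<And>c. (\<And>l. l \<in> L \<Longrightarrow> (\<Sum>j\<in>J. c j * w j l) = 0) \<Longrightarrow> \<forall>j\<in>J. c j = 0"
  shows "\<exists>L0\<subseteq>L. card L0 + card J \<le> card L \<and>
    (\<forall>\<xi>. (\<forall>j\<in>J. (\<Sum>l\<in>L. w j l * \<xi> l) = 0) \<and> (\<forall>l\<in>L0. \<xi> l = 0) \<longrightarrow> (\<forall>l\<in>L. \<xi> l = 0))"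
proof -
  define P where "P L0 \<longleftrightarrow> L0 \<subseteq> L \<and>
    (\<forall>\<xi>. (\<forall>j\<in>J. (\<Sum>l\<in>L. w j l * \<xi> l) = 0) \<and> (\<forall>l\<in>L0. \<xi> l = 0) \<longrightarrow> (\<forall>l\<in>L. \<xi> l = 0))" for L0
  have "P L" by (auto simp: P_def)
  then obtain L0 where L0: "P L0" and min: "\<And>L1. P L1 \<Longrightarrow> card L0 \<le> card L1"
    using arg_min_nat_lemma[of P L card] by metis
  have fL0: "finite L0" and sub: "L0 \<subseteq> L" using L0 fin finite_subset by (auto simp: P_def)
  have "card L0 + card J \<le> card L"
  proof (rule ccontr)
    assume "\<not> ?thesis"
    then have "card L < card (J <+> L0)" using fin fL0 by (simp add: card_Plus)
    then obtain x where x: "\<exists>i\<in>J <+> L0. x i \<noteq> 0"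
      "\<And>l. l \<in> L \<Longrightarrow> (\<Sum>i\<in>J <+> L0. (case i of Inl j \<Rightarrow> w j l | Inr l' \<Rightarrow> if l = l' then 1 else 0) * x i) = 0"
      using underdetermined_system[of L "J <+> L0" "\<lambda>l i. case i of Inl j \<Rightarrow> w j l | Inr l' \<Rightarrow> if l = l' then 1 else 0"]
        fin fL0 by auto
    have eq: "(\<Sum>j\<in>J. x (Inl j) * w j l) + (if l \<in> L0 then x (Inr l) else 0) = 0" if "l \<in> L" for l
      using x(2)[OF that] fin fL0
      by (simp add: sum.Plus if_distrib[of "\<lambda>x. x * _"] if_distrib[of "\<lambda>x. _ * x"] mult.commute cong: if_cong)
    have "\<exists>l\<in>L0. x (Inr l) \<noteq> 0"
    proof (rule ccontr)
      assume *: "\<not> ?thesis"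
      have "(\<Sum>j\<in>J. x (Inl j) * w j l) = 0" if "l \<in> L" for l
        using eq[OF that] * by (cases "l \<in> L0") simp_all
      then have "\<forall>j\<in>J. x (Inl j) = 0" by (rule indep)
      with x(1) * show False by auto
    qed
    then obtain q where q: "q \<in> L0" "x (Inr q) \<noteq> 0" by blast
    have "P (L0 - {q})"
      unfolding P_def
    proof (intro conjI allI impI)
      show "L0 - {q} \<subseteq> L" using sub by auto
      fix \<xi> assume \<xi>: "(\<forall>j\<in>J. (\<Sum>l\<in>L. w j l * \<xi> l) = 0) \<and> (\<forall>l\<in>L0 - {q}. \<xi> l = 0)"
      have "0 = (\<Sum>l\<in>L. ((\<Sum>j\<in>J. x (Inl j) * w j l) + (if l \<in> L0 then x (Inr l) else 0)) * \<xi> l)"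
        using eq by simp
      also have "\<dots> = (\<Sum>l\<in>L. (\<Sum>j\<in>J. x (Inl j) * w j l * \<xi> l)) + (\<Sum>l\<in>L. if l \<in> L0 then x (Inr l) * \<xi> l else 0)"
        by (simp add: distrib_right sum.distrib sum_distrib_right if_distrib[of "\<lambda>x. x * _"] cong: if_cong)
      also have "(\<Sum>l\<in>L. (\<Sum>j\<in>J. x (Inl j) * w j l * \<xi> l)) = (\<Sum>j\<in>J. x (Inl j) * (\<Sum>l\<in>L. w j l * \<xi> l))"
        by (subst sum.swap) (simp add: sum_distrib_left mult.assoc)
      also have "\<dots> = 0" using \<xi> by simp
      also have "(\<Sum>l\<in>L. if l \<in> L0 then x (Inr l) * \<xi> l else 0) = (\<Sum>l\<in>L0. x (Inr l) * \<xi> l)"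
        using fin sub by (simp add: sum.inter_restrict[symmetric] Int_absorb1)
      also have "\<dots> = x (Inr q) * \<xi> q + (\<Sum>l\<in>L0 - {q}. x (Inr l) * \<xi> l)"
        by (rule sum.remove[OF fL0 q(1)])
      also have "(\<Sum>l\<in>L0 - {q}. x (Inr l) * \<xi> l) = 0" using \<xi> by (intro sum.neutral) auto
      finally have "\<xi> q = 0" using q by simp
      then have "\<forall>l\<in>L0. \<xi> l = 0" using \<xi> by auto
      then show "\<forall>l\<in>L. \<xi> l = 0" using L0 \<xi> unfolding P_def by blast
    qed
    moreover have "card (L0 - {q}) < card L0" using q fL0 by (meson card_Diff1_less)
    ultimately show False using min by fastforce
  qed
  then show ?thesis using L0 unfolding P_def by blast
qed

section \<open>Zeros of bilinear forms\<close>

text \<open>\<open>\<iota>\<close> embeds the scalars as ring elements, so that \<open>'r\<close>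
  can be a ring of complex-valued functions. Degree is tracked only by the number of generators in a
  product.\<close>

locale graded_algebra =
  fixes \<iota> :: "complex \<Rightarrow> 'r::comm_ring_1" and g :: "'b \<Rightarrow> 'r" and G :: "'b set"
  assumes finite_G: "finite G"
    and \<iota>_1 [simp]: "\<iota> 1 = 1"
    and \<iota>_add: "\<iota> (a + b) = \<iota> a + \<iota> b"
    and \<iota>_mult: "\<iota> (a * b) = \<iota> a * \<iota> b"
begin

sublocale fs: vector_space "\<lambda>c f. \<iota> c * f"
  by unfold_locales (simp_all add: \<iota>_add \<iota>_mult algebra_simps)

lemma scale_mult_left: "(\<iota> c * f) * h = \<iota> c * (f * h)"
  and scale_mult_right: "f * (\<iota> c * h) = \<iota> c * (f * h)"
  by (auto simp: algebra_simps)

lemma span_mult: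
  assumes "f \<in> fs.span A" "h \<in> fs.span B"
    and "\<And>a b. a \<in> A \<Longrightarrow> b \<in> B \<Longrightarrow> a * b \<in> V" and V: "fs.subspace V"
  shows "f * h \<in> V"
  using assms(1)
proof (induction rule: fs.span_induct_alt)
  case base
  show ?case using fs.subspace_0[OF V] by (metis mult_zero_left)
next
  case (step c a f)
  have "a * h \<in> V" using assms(2)
  proof (induction rule: fs.span_induct_alt)
    case base
    show ?case using fs.subspace_0[OF V] by (metis mult_zero_right)
  next
    case (step c b h)
    then show ?case using V assms(3)[OF \<open>a \<in> A\<close>, of b]
      by (simp add: distrib_left scale_mult_right fs.subspace_add fs.subspace_scale)
  qed
  then show ?case using step V by (simp add: distrib_right scale_mult_left fs.subspace_add fs.subspace_scale)
qed

lemma span_le: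
  assumes "f \<in> fs.span A" "A \<subseteq> V" "fs.subspace V"
  shows "f \<in> V"
  using assms fs.span_minimal by blast

section \<open>Graded pieces and ideals generated in degree one\<close>

primrec mons :: "nat \<Rightarrow> 'r set" where
  "mons 0 = {1}"
| "mons (Suc d) = {g i * h |i h. i \<in> G \<and> h \<in> mons d}"

definition R :: "nat \<Rightarrow> 'r set" where
  "R d = fs.span (mons d)"

text \<open>The degree \<open>d\<close> part of the ideal generated by \<open>L\<close>, for
  \<open>L\<close> inside \<open>R 1\<close>.\<close>

primrec I :: "'r set \<Rightarrow> nat \<Rightarrow> 'r set" where
  "I L 0 = {0}"
| "I L (Suc d) = fs.span {f * h |f h. f \<in> L \<and> h \<in> mons d}"

text \<open>In the language of the Nullstellensatz: the linear forms \<open>L\<close> have a common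
  projective zero. By \<open>R_sub_I_mono\<close> a single degree swallowed by the ideal drags along
  all later ones, so each degree is required to resist.\<close>

definition good :: "'r set \<Rightarrow> bool" where
  "good L \<longleftrightarrow> L \<subseteq> R 1 \<and> (\<forall>d. \<not> R d \<subseteq> I L d)"

lemma finite_mons: "finite (mons d)"
proof (induction d)
  case (Suc d)
  have "mons (Suc d) = (\<lambda>(i, h). g i * h) ` (G \<times> mons d)" by auto
  then show ?case using Suc finite_G by simp
qed simp

lemma mons_add: "f \<in> mons a \<Longrightarrow> h \<in> mons b \<Longrightarrow> f * h \<in> mons (a + b)"
proof (induction a arbitrary: f)
  case (Suc a)
  then obtain i f' where "f = g i * f'" "i \<in> G" "f' \<in> mons a" by auto
  then show ?case using Suc.IH[of f'] Suc.prems by (fastforce simp: mult.assoc)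
qed simp

lemma mons_1: "mons 1 = g ` G"
  by auto

lemma subspace_R: "fs.subspace (R d)"
  by (simp add: R_def)

lemma subspace_I: "fs.subspace (I L d)"
  by (cases d) auto

lemma mons_R: "f \<in> mons d \<Longrightarrow> f \<in> R d"
  by (simp add: R_def fs.span_base)

lemma R_mult: "f \<in> R a \<Longrightarrow> h \<in> R b \<Longrightarrow> f * h \<in> R (a + b)"
  using span_mult[of f "mons a" h "mons b" "R (a + b)"] mons_add subspace_R mons_R
  unfolding R_def by blast

lemma R_power: "f \<in> R 1 \<Longrightarrow> f ^ d \<in> R d"
proof (induction d)
  case 0
  then show ?case using mons_R[of 1 0] by simp
next
  case (Suc d)
  then show ?case using R_mult[of f 1 "f ^ d" d] by simp
qed

lemma R_Suc_induct:
  assumes "f \<in> R (Suc d)" and V: "fs.subspace V"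
    and "\<And>i h. i \<in> G \<Longrightarrow> h \<in> R d \<Longrightarrow> g i * h \<in> V"
  shows "f \<in> V"
  using assms(1) unfolding R_def
  by (rule span_le[OF _ _ V]) (use assms(3) mons_R in auto)

lemma I_base:
  assumes "f \<in> L" "h \<in> R d"
  shows "f * h \<in> I L (Suc d)"
proof (rule span_mult[OF _ _ _ subspace_I])
  show "f \<in> fs.span {f}" "h \<in> fs.span (mons d)" using assms by (auto simp: R_def fs.span_base)
  fix a b assume "a \<in> {f}" "b \<in> mons d"
  then show "a * b \<in> I L (Suc d)" using assms(1) by (auto intro: fs.span_base)
qed

lemma I_mult: "f \<in> I L a \<Longrightarrow> h \<in> R b \<Longrightarrow> f * h \<in> I L (a + b)"
proof (cases a)
  case 0
  then show "f \<in> I L a \<Longrightarrow> ?thesis" using subspace_I[of L b] by (simp add: fs.subspace_0)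
next
  case (Suc d)
  assume fh: "f \<in> I L a" "h \<in> R b"
  have "f * h \<in> I L (Suc (d + b))"
  proof (rule span_mult[OF _ _ _ subspace_I])
    show "f \<in> fs.span {f * h |f h. f \<in> L \<and> h \<in> mons d}" using fh Suc by simp
    show "h \<in> fs.span (R b)" using fh by (simp add: fs.span_base)
    fix x y assume "x \<in> {f * h |f h. f \<in> L \<and> h \<in> mons d}" "y \<in> R b"
    then show "x * y \<in> I L (Suc (d + b))"
      using I_base[of _ L _ "d + b"] R_mult[of _ d y b] mons_R by (auto simp: mult.assoc simp del: I.simps)
  qed
  then show ?thesis using Suc by (simp del: I.simps)
qed

lemma I_mult': "f \<in> R a \<Longrightarrow> h \<in> I L b \<Longrightarrow> f * h \<in> I L (a + b)"
  using I_mult[of h L b f a] by (simp add: ac_simps)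

lemma I_1: "I L 1 = fs.span L"
proof -
  have "{f * h |f h. f \<in> L \<and> h \<in> mons 0} = L" by auto
  then show ?thesis by simp
qed

lemma R_sub_I_mono:
  assumes "R d \<subseteq> I L d" "d \<le> e"
  shows "R e \<subseteq> I L e"
  using assms(2)
proof (induction e rule: dec_induct)
  case (step e)
  show ?case
  proof
    fix f assume "f \<in> R (Suc e)"
    then show "f \<in> I L (Suc e)"
    proof (rule R_Suc_induct[OF _ subspace_I])
      fix i h assume "i \<in> G" "h \<in> R e"
      then show "g i * h \<in> I L (Suc e)"
        using I_mult'[of "g i" 1 h L e] step mons_R[of "g i" 1] by (auto simp: mons_1 simp del: I.simps)
    qed
  qed
qed (use assms in auto)

text \<open>Separates the multiples of the new generator, so that membership in the larger ideal
  reads as divisibility by \<open>l\<close> modulo the smaller one.\<close>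

lemma I_insert:
  assumes "f \<in> I (insert l L) (Suc d)"
  shows "\<exists>h\<in>R d. f - l * h \<in> I L (Suc d)"
proof -
  let ?V = "{f. \<exists>h\<in>R d. f - l * h \<in> I L (Suc d)}"
  have "fs.subspace ?V"
  proof (rule fs.subspaceI)
    show "0 \<in> ?V" using subspace_R[of d] subspace_I[of L "Suc d"]
      by (auto intro!: bexI[of _ 0] simp: fs.subspace_0 simp del: I.simps)
    fix x y assume "x \<in> ?V" "y \<in> ?V"
    then obtain h h' where h: "h \<in> R d" "x - l * h \<in> I L (Suc d)" "h' \<in> R d" "y - l * h' \<in> I L (Suc d)" by blast
    have "(x - l * h) + (y - l * h') \<in> I L (Suc d)" using h subspace_I fs.subspace_add by blast
    moreover have "(x - l * h) + (y - l * h') = x + y - l * (h + h')" by (simp add: algebra_simps)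
    moreover have "h + h' \<in> R d" using h subspace_R fs.subspace_add by blast
    ultimately show "x + y \<in> ?V" by (auto simp del: I.simps)
  next
    fix c x assume "x \<in> ?V"
    then obtain h where h: "h \<in> R d" "x - l * h \<in> I L (Suc d)" by blast
    have "\<iota> c * (x - l * h) \<in> I L (Suc d)" using h subspace_I fs.subspace_scale by blast
    moreover have "\<iota> c * (x - l * h) = \<iota> c * x - l * (\<iota> c * h)" by (simp add: algebra_simps)
    moreover have "\<iota> c * h \<in> R d" using h subspace_R fs.subspace_scale by blast
    ultimately have "\<exists>h\<in>R d. \<iota> c * x - l * h \<in> I L (Suc d)" by (intro bexI[of _ "\<iota> c * h"]) (simp_all only:)
    then show "\<iota> c * x \<in> ?V" by blast
  qed
  moreover have "{f * h |f h. f \<in> insert l L \<and> h \<in> mons d} \<subseteq> ?V"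
  proof clarify
    fix f h assume fh: "f \<in> insert l L" "h \<in> mons d"
    show "\<exists>h'\<in>R d. f * h - l * h' \<in> I L (Suc d)"
    proof (cases "f = l")
      case True
      then show ?thesis using mons_R[OF fh(2)] subspace_I[of L "Suc d"]
        by (intro bexI[of _ h]) (auto simp: fs.subspace_0 simp del: I.simps)
    next
      case False
      then show ?thesis using fh mons_R[OF fh(2)] I_base[of f L h d] subspace_R[of d]
        by (intro bexI[of _ 0]) (auto simp: fs.subspace_0 simp del: I.simps)
    qed
  qed
  ultimately show ?thesis using span_le[of f "{f * h |f h. f \<in> insert l L \<and> h \<in> mons d}" ?V] assms by auto
qed

text \<open>Multiplication by \<open>u\<close>, of degree \<open>m\<close>, is surjective on the
  quotient by the ideal of \<open>L\<close> in high degrees. By \<open>eventually_onto_mult\<close>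
  the property passes to products.\<close>

definition eventually_onto :: "'r set \<Rightarrow> 'r \<Rightarrow> nat \<Rightarrow> nat \<Rightarrow> bool" where
  "eventually_onto L u m e \<longleftrightarrow> (\<forall>d\<ge>e. \<forall>h\<in>R (d + m). \<exists>h'\<in>R d. h - u * h' \<in> I L (d + m))"

lemma eventually_onto_1: "eventually_onto L 1 0 0"
  unfolding eventually_onto_def
  by (intro allI impI ballI, rule bexI) (use subspace_I fs.subspace_0 in auto)

lemma I_diff: "x \<in> I L d \<Longrightarrow> y \<in> I L d \<Longrightarrow> x - y \<in> I L d"
  using subspace_I fs.subspace_diff by blast

lemma I_add: "x \<in> I L d \<Longrightarrow> y \<in> I L d \<Longrightarrow> x + y \<in> I L d"
  using subspace_I fs.subspace_add by blast

lemma I_sum: "(\<And>a. a \<in> A \<Longrightarrow> f a \<in> I L d) \<Longrightarrow> sum f A \<in> I L d"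
  using subspace_I fs.subspace_sum by blast

lemma I_scale: "x \<in> I L d \<Longrightarrow> \<iota> c * x \<in> I L d"
  using subspace_I fs.subspace_scale by blast

lemma R_sum: "(\<And>a. a \<in> A \<Longrightarrow> f a \<in> R d) \<Longrightarrow> sum f A \<in> R d"
  using subspace_R fs.subspace_sum by blast

lemma R_scale: "x \<in> R d \<Longrightarrow> \<iota> c * x \<in> R d"
  using subspace_R fs.subspace_scale by blast

lemma eventually_onto_mult:
  assumes "eventually_onto L u a e" "eventually_onto L v b e'" "u \<in> R a"
  shows "eventually_onto L (u * v) (a + b) (max e e')"
  unfolding eventually_onto_def
proof (intro allI impI ballI)
  fix d h assume d: "max e e' \<le> d" and h: "h \<in> R (d + (a + b))"
  then obtain h1 where h1: "h1 \<in> R (d + b)" "h - u * h1 \<in> I L (d + b + a)"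
    using assms(1)[unfolded eventually_onto_def, rule_format, of "d + b" h] by (auto simp: ac_simps)
  then obtain h2 where h2: "h2 \<in> R d" "h1 - v * h2 \<in> I L (d + b)"
    using assms(2)[unfolded eventually_onto_def, rule_format, of d h1] d by auto
  have "u * (h1 - v * h2) \<in> I L (d + b + a)"
    using I_mult'[OF assms(3) h2(2)] by (simp add: ac_simps)
  then have "(h - u * h1) + u * (h1 - v * h2) \<in> I L (d + b + a)" using h1 I_add by blast
  moreover have "(h - u * h1) + u * (h1 - v * h2) = h - u * v * h2" by (simp add: algebra_simps)
  ultimately have "h - u * v * h2 \<in> I L (d + b + a)" by simp
  then show "\<exists>h'\<in>R d. h - u * v * h' \<in> I L (d + (a + b))"
    using h2(1) by (metis add.assoc add.commute)
qed

lemma \<iota>_0 [simp]: "\<iota> 0 = 0"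
  using \<iota>_add[of 0 0] by simp

lemma \<iota>_uminus: "\<iota> (- a) = - \<iota> a"
  using \<iota>_add[of a "- a"] by (simp add: eq_neg_iff_add_eq_0 add.commute)

lemma \<iota>_diff: "\<iota> (a - b) = \<iota> a - \<iota> b"
  using \<iota>_add[of a "- b"] by (simp add: \<iota>_uminus)

lemma \<iota>_sum: "\<iota> (sum f A) = (\<Sum>a\<in>A. \<iota> (f a))"
  by (induction A rule: infinite_finite_induct) (auto simp: \<iota>_add)

text \<open>The binary form of degree \<open>m\<close> with dehomogenisation \<open>p\<close>,
  evaluated at \<open>(l, l0)\<close>. A degree of \<open>p\<close> below \<open>m\<close> is a zero
  at infinity and shows up as a factor \<open>l0\<close>.\<close>

definition hom_poly :: "'r \<Rightarrow> 'r \<Rightarrow> nat \<Rightarrow> complex poly \<Rightarrow> 'r" where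
  "hom_poly l l0 m p = (\<Sum>j\<le>m. \<iota> (coeff p j) * l ^ j * l0 ^ (m - j))"

lemma hom_poly_Suc:
  assumes "degree p \<le> m"
  shows "hom_poly l l0 (Suc m) p = l0 * hom_poly l l0 m p"
proof -
  have "coeff p (Suc m) = 0" using assms by (simp add: coeff_eq_0)
  then show ?thesis
    by (simp add: hom_poly_def sum_distrib_left Suc_diff_le algebra_simps)
qed

lemma hom_poly_linear_factor:
  assumes "degree q \<le> m"
  shows "hom_poly l l0 (Suc m) ([:- \<beta>, 1:] * q) = (l - \<iota> \<beta> * l0) * hom_poly l l0 m q"
proof -
  have "hom_poly l l0 (Suc m) ([:- \<beta>, 1:] * q)
      = hom_poly l l0 (Suc m) (pCons 0 q) - \<iota> \<beta> * hom_poly l l0 (Suc m) q"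
    unfolding hom_poly_def sum_distrib_left sum_subtractf[symmetric]
    by (intro sum.cong refl) (simp add: \<iota>_add \<iota>_diff \<iota>_uminus \<iota>_mult algebra_simps)
  also have "hom_poly l l0 (Suc m) (pCons 0 q) = l * hom_poly l l0 m q"
    unfolding hom_poly_def by (subst sum.atMost_Suc_shift) (simp add: sum_distrib_left algebra_simps)
  finally show ?thesis using hom_poly_Suc[OF assms] by (simp add: algebra_simps)
qed

lemma hom_poly_R:
  assumes "l \<in> R 1" "l0 \<in> R 1"
  shows "hom_poly l l0 m p \<in> R m"
  unfolding hom_poly_def
proof (rule R_sum)
  fix j assume "j \<in> {..m}"
  then have "l ^ j * l0 ^ (m - j) \<in> R m"
    using R_mult[OF R_power[OF assms(1), of j] R_power[OF assms(2), of "m - j"]] by simp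
  then show "\<iota> (coeff p j) * l ^ j * l0 ^ (m - j) \<in> R m"
    using R_scale by (simp add: mult.assoc)
qed

text \<open>Over the complex numbers the binary form is, up to a non-zero constant, a product of
  members of the pencil: a root \<open>\<beta>\<close> splits off
  \<open>l - \<iota> \<beta> * l0\<close>, a missing degree splits off \<open>l0\<close>.
  Surjections compose.\<close>

lemma eventually_onto_hom_poly:
  assumes "l \<in> R 1" "l0 \<in> R 1" "\<exists>e. eventually_onto L l0 1 e"
    and "\<And>\<beta>. \<exists>e. eventually_onto L (l - \<iota> \<beta> * l0) 1 e"
    and "p \<noteq> 0" "degree p \<le> m"
  shows "\<exists>e. eventually_onto L (hom_poly l l0 m p) m e"
  using assms(5,6)
proof (induction m arbitrary: p)
  case 0
  then obtain c where c: "p = [:c:]" "c \<noteq> 0" by (metis degree_eq_zeroE le_zero_eq pCons_0_0)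
  have "eventually_onto L (\<iota> c) 0 0"
    unfolding eventually_onto_def
  proof (intro allI impI ballI)
    fix d h assume "h \<in> R (d + 0)"
    then show "\<exists>h'\<in>R d. h - \<iota> c * h' \<in> I L (d + 0)"
      using c(2) fs.subspace_0[OF subspace_I[of L d]]
      by (intro bexI[of _ "\<iota> (1 / c) * h"]) (auto simp: mult.assoc[symmetric] \<iota>_mult[symmetric] R_scale)
  qed
  then show ?case using c by (auto simp: hom_poly_def)
next
  case (Suc m)
  show ?case
  proof (cases "degree p \<le> m")
    case True
    then show ?thesis
      using Suc.IH[OF Suc.prems(1) True] assms(2,3) eventually_onto_mult[of L l0 1 _ "hom_poly l l0 m p" m]
      by (auto simp: hom_poly_Suc)
  next
    case False
    then have "degree p = Suc m" using Suc.prems by simp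
    moreover from this obtain \<beta> where "poly p \<beta> = 0"
      using fundamental_theorem_of_algebra[of p] by (auto simp: constant_degree)
    then obtain q where q: "p = [:- \<beta>, 1:] * q" by (auto simp: poly_eq_0_iff_dvd elim: dvdE)
    moreover have "q \<noteq> 0" using q Suc.prems by auto
    ultimately have dq: "degree q \<le> m" using degree_mult_eq[of "[:- \<beta>, 1:]" q] by auto
    have "l - \<iota> \<beta> * l0 \<in> R 1" using assms(1,2) R_scale fs.subspace_diff[OF subspace_R] by blast
    then show ?thesis
      using Suc.IH[OF \<open>q \<noteq> 0\<close> dq] assms(4)[of \<beta>] eventually_onto_mult[of L "l - \<iota> \<beta> * l0" 1 _ "hom_poly l l0 m q" m]
      unfolding q hom_poly_linear_factor[OF dq] by auto
  qed
qed

lemma R_1: "R 1 = fs.span (g ` G)"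
  by (simp only: R_def mons_1)

text \<open>Spans of good sets lie in \<open>R 1\<close>, so their dimensions are bounded by the
  number of generators and a largest one exists; adjoining an element outside the span would exceed
  it.\<close>

lemma good_maximal:
  assumes "good L0"
  obtains L where "good L" "L0 \<subseteq> L" "\<And>l. l \<in> R 1 \<Longrightarrow> l \<notin> fs.span L \<Longrightarrow> \<not> good (insert l L)"
proof -
  have bound: "fs.dim L \<le> card (g ` G)" if "good L" for L
    using that fs.dim_le_card[of L "g ` G"] finite_imageI[OF finite_G]
    unfolding good_def R_1 by blast
  obtain L where L: "good L" "L0 \<subseteq> L" and max: "\<And>L'. good L' \<Longrightarrow> L0 \<subseteq> L' \<Longrightarrow> fs.dim L' \<le> fs.dim L"
    using ex_has_greatest_nat[of "\<lambda>L. good L \<and> L0 \<subseteq> L" L0 fs.dim "card (g ` G)"] assms bound by fastforce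
  have "\<not> good (insert l L)" if l: "l \<in> R 1" "l \<notin> fs.span L" for l
  proof
    assume "good (insert l L)"
    then have le: "fs.dim (insert l L) \<le> fs.dim L" using max L by blast
    obtain B where B: "B \<subseteq> L" "fs.independent B" "L \<subseteq> fs.span B" "card B = fs.dim L"
      using fs.basis_exists by blast
    have span: "fs.span B = fs.span L" using B by (metis fs.span_mono fs.span_span subset_antisym)
    have "finite B"
      using fs.independent_span_bound[of "g ` G" B] B L finite_G unfolding good_def R_1 by blast
    have "fs.independent (insert l B)" using l span B fs.independent_insertI by auto
    moreover have "fs.span (insert l B) = fs.span (insert l L)"
    proof (rule subset_antisym)
      show "fs.span (insert l B) \<subseteq> fs.span (insert l L)" using B(1) by (intro fs.span_mono) auto
      have "fs.span B \<subseteq> fs.span (insert l B)" by (intro fs.span_mono) auto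
      then have "insert l L \<subseteq> fs.span (insert l B)" using B(3) fs.span_base[of l "insert l B"] by auto
      then show "fs.span (insert l L) \<subseteq> fs.span (insert l B)" by (rule fs.span_minimal) simp
    qed
    ultimately have "fs.dim (insert l L) = card (insert l B)" using fs.dim_eq_card by metis
    also have "\<dots> = Suc (card B)"
      using \<open>finite B\<close> l(2) span fs.span_base by (metis card_insert_disjoint)
    finally show False using le B by simp
  qed
  then show ?thesis using that L by blast
qed

text \<open>If adjoining \<open>l\<close> destroys goodness, some degree lies in the enlarged ideal,
  hence all later ones do, and modulo the ideal of \<open>L\<close> only multiples of
  \<open>l\<close> remain.\<close>

lemma not_good_eventually_onto:
  assumes "good L" "l \<in> R 1" "\<not> good (insert l L)"
  shows "\<exists>e. eventually_onto L l 1 e"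
proof -
  have "insert l L \<subseteq> R 1" using assms by (auto simp: good_def)
  then obtain d where d: "R d \<subseteq> I (insert l L) d" using assms(3) by (auto simp: good_def)
  have "eventually_onto L l 1 d"
    unfolding eventually_onto_def
  proof (intro allI impI ballI)
    fix e h assume "d \<le> e" "h \<in> R (e + 1)"
    then have "h \<in> I (insert l L) (Suc e)" using R_sub_I_mono[OF d, of "Suc e"] by auto
    then show "\<exists>h'\<in>R e. h - l * h' \<in> I L (e + 1)" using I_insert by simp
  qed
  then show ?thesis ..
qed

lemma eventually_onto_power:
  assumes "eventually_onto L l 1 e" "l \<in> R 1"
  shows "eventually_onto L (l ^ m) m e"
proof (induction m)
  case 0
  then show ?case using eventually_onto_1 by (simp add: eventually_onto_def)
next
  case (Suc m)
  then show ?case using eventually_onto_mult[OF assms(1) Suc assms(2)] by simp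
qed

text \<open>
  A pencil spanned by \<open>l\<close> and \<open>l0\<close> acts on the finite-dimensional quotient of \<open>R e\<close> by the
  ideal, so some binary form in \<open>l\<close> and \<open>l0\<close> annihilates it; if every member of the pencil were
  eventually onto, the quotient would vanish.
\<close>

lemma annihilating_form:
  assumes "eventually_onto L l0 1 e" "l \<in> R 1" "l0 \<in> R 1"
  shows "\<exists>m p. p \<noteq> 0 \<and> degree p \<le> m \<and> (\<forall>d\<ge>e. \<forall>h\<in>R d. hom_poly l l0 m p * h \<in> I L (d + m))"
proof -
  define B where "B = mons e"
  \<comment> \<open>\<open>B\<close> spans degree \<open>e\<close>. As \<open>l0\<close> is
    eventually onto, degree \<open>e + m\<close> is spanned modulo the ideal by
    \<open>l0 ^ m * B\<close>, so each of the \<open>m + 1\<close> multiplications by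
    \<open>l ^ j * l0 ^ (m - j)\<close> is given by a \<open>B \<times> B\<close> matrix
    \<open>u j\<close>; with only \<open>m\<close> entries per matrix these are linearly
    dependent.\<close>
  define m where "m = card (B \<times> B)"
  have fB: "finite B" using finite_mons by (simp add: B_def)
  have onto: "\<exists>u. h - l0 ^ m * (\<Sum>s\<in>B. \<iota> (u s) * s) \<in> I L (e + m)" if h: "h \<in> R (e + m)" for h
  proof -
    obtain h' where h': "h' \<in> R e" "h - l0 ^ m * h' \<in> I L (e + m)"
      using eventually_onto_power[OF assms(1,3), of m] h by (auto simp: eventually_onto_def)
    obtain u where "h' = (\<Sum>s\<in>B. \<iota> (u s) * s)"
      using h'(1) fs.span_finite[OF fB] unfolding R_def B_def by auto
    then show ?thesis using h' by blast
  qed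
  have "l ^ j * l0 ^ (m - j) * b \<in> R (e + m)" if "j \<le> m" "b \<in> B" for j b
  proof -
    have "l ^ j * l0 ^ (m - j) \<in> R m"
      using R_mult[OF R_power[OF assms(2), of j] R_power[OF assms(3), of "m - j"]] that by simp
    then show ?thesis
      using R_mult[of _ m b e] that mons_R[of b e] by (auto simp: B_def add.commute)
  qed
  then have "\<forall>j b. \<exists>u. j \<le> m \<longrightarrow> b \<in> B \<longrightarrow>
      l ^ j * l0 ^ (m - j) * b - l0 ^ m * (\<Sum>s\<in>B. \<iota> (u s) * s) \<in> I L (e + m)"
    using onto by blast
  then have "\<exists>u. \<forall>j b. j \<le> m \<longrightarrow> b \<in> B \<longrightarrow>
      l ^ j * l0 ^ (m - j) * b - l0 ^ m * (\<Sum>s\<in>B. \<iota> (u j b s) * s) \<in> I L (e + m)"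
    by (simp only: choice_iff)
  then obtain u where u: "\<forall>j b. j \<le> m \<longrightarrow> b \<in> B \<longrightarrow>
      l ^ j * l0 ^ (m - j) * b - l0 ^ m * (\<Sum>s\<in>B. \<iota> (u j b s) * s) \<in> I L (e + m)" ..
  have "card (B \<times> B) < card {..m}" by (simp add: m_def)
  from underdetermined_system[OF _ _ this, of "\<lambda>(b, s) j. u j b s"] fB
  obtain c where c: "\<exists>j\<le>m. c j \<noteq> 0" "\<And>b s. b \<in> B \<Longrightarrow> s \<in> B \<Longrightarrow> (\<Sum>j\<le>m. u j b s * c j) = 0"
    by auto
  define p where "p = (\<Sum>j\<le>m. monom (c j) j)"
  have cp: "coeff p j = (if j \<le> m then c j else 0)" for j
    by (simp add: p_def coeff_sum)
  have "p \<noteq> 0" using c(1) cp by (metis coeff_0)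
  moreover have "degree p \<le> m" using cp by (simp add: degree_le)
  moreover have base: "hom_poly l l0 m p * b \<in> I L (e + m)" if b: "b \<in> B" for b
  proof -
    have "(\<Sum>j\<le>m. \<iota> (c j) * (l ^ j * l0 ^ (m - j) * b - l0 ^ m * (\<Sum>s\<in>B. \<iota> (u j b s) * s))) \<in> I L (e + m)"
      by (intro I_sum I_scale) (use u b in simp)
    also have "(\<Sum>j\<le>m. \<iota> (c j) * (l ^ j * l0 ^ (m - j) * b - l0 ^ m * (\<Sum>s\<in>B. \<iota> (u j b s) * s)))
        = hom_poly l l0 m p * b - l0 ^ m * (\<Sum>j\<le>m. \<Sum>s\<in>B. \<iota> (u j b s * c j) * s)"
      by (simp add: right_diff_distrib sum_subtractf hom_poly_def cp sum_distrib_left sum_distrib_right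
          \<iota>_mult algebra_simps)
    also have "(\<Sum>j\<le>m. \<Sum>s\<in>B. \<iota> (u j b s * c j) * s) = (\<Sum>s\<in>B. \<iota> (\<Sum>j\<le>m. u j b s * c j) * s)"
      by (subst sum.swap) (simp add: sum_distrib_right \<iota>_sum)
    also have "\<dots> = 0" using c(2)[OF b] by simp
    finally show ?thesis by simp
  qed
  moreover have "hom_poly l l0 m p * h \<in> I L (d + m)" if d: "d \<ge> e" and h: "h \<in> R d" for d h
  proof -
    have P: "hom_poly l l0 m p \<in> R m" using hom_poly_R assms by blast
    have Re: "hom_poly l l0 m p * h' \<in> I L (e + m)" if "h' \<in> R e" for h'
      by (rule span_mult[of _ "{hom_poly l l0 m p}" h' B])
        (use that base subspace_I in \<open>auto simp: R_def B_def intro: fs.span_base\<close>)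
    \<comment> \<open>Degrees above \<open>e\<close> are reduced to \<open>e\<close> by peeling off
      a power of \<open>l0\<close> modulo the ideal.\<close>
    define r where "r = d - e"
    have dr: "d = e + r" using d by (simp add: r_def)
    obtain h' where h': "h' \<in> R e" "h - l0 ^ r * h' \<in> I L (e + r)"
      using eventually_onto_power[OF assms(1,3), of r] h by (auto simp: eventually_onto_def dr)
    have "hom_poly l l0 m p * (h - l0 ^ r * h') \<in> I L (d + m)"
      using I_mult'[OF P h'(2)] by (simp add: dr ac_simps)
    moreover have "l0 ^ r * (hom_poly l l0 m p * h') \<in> I L (d + m)"
      using I_mult'[OF R_power[OF assms(3), of r] Re[OF h'(1)]] by (simp add: dr ac_simps)
    ultimately have "hom_poly l l0 m p * (h - l0 ^ r * h') + l0 ^ r * (hom_poly l l0 m p * h') \<in> I L (d + m)"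
      by (rule I_add)
    then show ?thesis by (simp add: algebra_simps)
  qed
  ultimately show ?thesis by blast
qed

text \<open>A maximal good set behaves like the ideal of a point: its span has codimension one in
  \<open>R 1\<close>. Otherwise the annihilating form of the pencil, a product of members that are
  eventually onto, would be both zero and onto in high degrees.\<close>

lemma pencil_meets_ideal:
  assumes good: "good L" and max: "\<And>l. l \<in> R 1 \<Longrightarrow> l \<notin> fs.span L \<Longrightarrow> \<not> good (insert l L)"
    and l0: "l0 \<in> R 1" "l0 \<notin> fs.span L" and l: "l \<in> R 1"
  shows "\<exists>\<beta>. l - \<iota> \<beta> * l0 \<in> fs.span L"
proof (rule ccontr)
  assume no: "\<not> ?thesis"
  obtain e0 where e0: "eventually_onto L l0 1 e0"
    using not_good_eventually_onto[OF good l0(1)] max l0 by blast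
  have "\<exists>e. eventually_onto L (l - \<iota> \<beta> * l0) 1 e" for \<beta>
  proof -
    have "l - \<iota> \<beta> * l0 \<in> R 1" using l0 l R_scale fs.subspace_diff[OF subspace_R] by blast
    then show ?thesis using not_good_eventually_onto[OF good] max no by blast
  qed
  moreover obtain m p where mp: "p \<noteq> 0" "degree p \<le> m"
    and ann: "\<And>d h. d \<ge> e0 \<Longrightarrow> h \<in> R d \<Longrightarrow> hom_poly l l0 m p * h \<in> I L (d + m)"
    using annihilating_form[OF e0 l l0(1)] by blast
  ultimately obtain e where e: "eventually_onto L (hom_poly l l0 m p) m e"
    using eventually_onto_hom_poly[OF l l0(1) _ _ mp] e0 by blast
  have "R (max e e0 + m) \<subseteq> I L (max e e0 + m)"
  proof
    fix h assume "h \<in> R (max e e0 + m)"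
    then obtain h' where h': "h' \<in> R (max e e0)" "h - hom_poly l l0 m p * h' \<in> I L (max e e0 + m)"
      using e unfolding eventually_onto_def by (meson max.cobounded1)
    then have "(h - hom_poly l l0 m p * h') + hom_poly l l0 m p * h' \<in> I L (max e e0 + m)"
      by (intro I_add ann[OF _ h'(1)]) simp_all
    then show "h \<in> I L (max e e0 + m)" by simp
  qed
  then show False using good by (simp add: good_def)
qed

text \<open>A maximal good set is the ideal of a point and \<open>\<beta> i\<close> is the value of
  \<open>g i\<close> there, measured in units of \<open>l0\<close>. Evaluation is multiplicative, so
  quadratic relations between generators survive.\<close>

lemma character_exists:
  assumes "good L0"
  obtains \<beta> where "\<exists>i\<in>G. \<beta> i \<noteq> 0"
    and "\<And>c. (\<Sum>i\<in>G. \<iota> (c i) * g i) \<in> L0 \<Longrightarrow> (\<Sum>i\<in>G. c i * \<beta> i) = 0"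
    and "\<And>i j i' j'. i \<in> G \<Longrightarrow> j \<in> G \<Longrightarrow> i' \<in> G \<Longrightarrow> j' \<in> G \<Longrightarrow> g i * g j = g i' * g j' \<Longrightarrow> \<beta> i * \<beta> j = \<beta> i' * \<beta> j'"
proof -
  obtain L where L: "good L" "L0 \<subseteq> L"
    and max: "\<And>l. l \<in> R 1 \<Longrightarrow> l \<notin> fs.span L \<Longrightarrow> \<not> good (insert l L)"
    using good_maximal[OF assms] by blast
  have "\<not> R 1 \<subseteq> fs.span L" using L(1) I_1[of L] unfolding good_def by metis
  then obtain l0 where l0: "l0 \<in> R 1" "l0 \<notin> fs.span L" by blast
  have gR: "g i \<in> R 1" if "i \<in> G" for i using that unfolding R_1 by (simp add: fs.span_base)
  have "\<forall>i. \<exists>b. i \<in> G \<longrightarrow> g i - \<iota> b * l0 \<in> I L 1"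
    using pencil_meets_ideal[OF L(1) max l0] gR by (simp only: I_1) blast
  then obtain \<beta> where \<beta>: "\<And>i. i \<in> G \<Longrightarrow> g i - \<iota> (\<beta> i) * l0 \<in> I L 1" by metis
  have red: "\<exists>c. h - \<iota> c * l0 ^ d \<in> I L d" if "h \<in> R d" for h d
    using that
  proof (induction d arbitrary: h)
    case 0
    then obtain c where "h = \<iota> c * 1" by (auto simp: R_def fs.span_singleton)
    then show ?case using fs.subspace_0[OF subspace_I[of L 0]] by (intro exI[of _ c]) simp
  next
    case (Suc d)
    let ?V = "{h. \<exists>c. h - \<iota> c * l0 ^ Suc d \<in> I L (Suc d)}"
    have "fs.subspace ?V"
    proof (rule fs.subspaceI)
      show "0 \<in> ?V" using fs.subspace_0[OF subspace_I[of L "Suc d"]] by (auto intro!: exI[of _ 0] simp del: I.simps)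
    next
      fix x y assume "x \<in> ?V" "y \<in> ?V"
      then obtain a b where "x - \<iota> a * l0 ^ Suc d \<in> I L (Suc d)" "y - \<iota> b * l0 ^ Suc d \<in> I L (Suc d)" by blast
      from I_add[OF this] have "(x + y) - \<iota> (a + b) * l0 ^ Suc d \<in> I L (Suc d)"
        by (simp add: \<iota>_add algebra_simps del: I.simps)
      then show "x + y \<in> ?V" by blast
    next
      fix r x assume "x \<in> ?V"
      then obtain a where "x - \<iota> a * l0 ^ Suc d \<in> I L (Suc d)" by blast
      from I_scale[OF this, of r] have "\<iota> r * x - \<iota> (r * a) * l0 ^ Suc d \<in> I L (Suc d)"
        by (simp only: \<iota>_mult right_diff_distrib mult.assoc)
      then show "\<iota> r * x \<in> ?V" by blast
    qed
    moreover have "g i * h \<in> ?V" if i: "i \<in> G" and h: "h \<in> R d" for i h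
    proof -
      obtain c where c: "h - \<iota> c * l0 ^ d \<in> I L d" using Suc.IH[OF h] by blast
      have "g i * (h - \<iota> c * l0 ^ d) \<in> I L (Suc d)" using I_mult'[OF gR[OF i] c] by (simp del: I.simps)
      moreover have "(g i - \<iota> (\<beta> i) * l0) * (\<iota> c * l0 ^ d) \<in> I L (Suc d)"
        using I_mult[OF \<beta>[OF i] R_scale[OF R_power[OF l0(1), of d]]] by (simp del: I.simps)
      ultimately have "g i * (h - \<iota> c * l0 ^ d) + (g i - \<iota> (\<beta> i) * l0) * (\<iota> c * l0 ^ d) \<in> I L (Suc d)"
        by (rule I_add)
      then have "g i * h - \<iota> (\<beta> i * c) * l0 ^ Suc d \<in> I L (Suc d)"
        by (simp add: \<iota>_mult algebra_simps del: I.simps)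
      then show ?thesis by blast
    qed
    ultimately show ?case using R_Suc_induct[OF Suc.prems, of ?V] by blast
  qed
  have l0_not: "l0 ^ d \<notin> I L d" for d
  proof
    assume *: "l0 ^ d \<in> I L d"
    have "R d \<subseteq> I L d"
    proof
      fix h assume "h \<in> R d"
      then obtain c where "h - \<iota> c * l0 ^ d \<in> I L d" using red by blast
      from I_add[OF this I_scale[OF *, of c]] show "h \<in> I L d" by simp
    qed
    then show False using L(1) by (simp add: good_def)
  qed
  \<comment> \<open>By \<open>red\<close> and \<open>l0_not\<close> each degree of the quotient is
    spanned by a power of \<open>l0\<close> that is itself non-zero there, so scalars can be read
    off.\<close>
  have zero: "c = 0" if "\<iota> c * l0 ^ d \<in> I L d" for c d
  proof (rule ccontr)
    assume "c \<noteq> 0"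
    then have "\<iota> (1 / c) * (\<iota> c * l0 ^ d) = l0 ^ d" by (simp add: mult.assoc[symmetric] \<iota>_mult[symmetric])
    then show False using I_scale[OF that, of "1 / c"] l0_not by simp
  qed
  have lin: "(\<Sum>i\<in>G. \<iota> (c i) * g i) - \<iota> (\<Sum>i\<in>G. c i * \<beta> i) * l0 \<in> I L 1" for c
  proof -
    have "(\<Sum>i\<in>G. \<iota> (c i) * (g i - \<iota> (\<beta> i) * l0)) \<in> I L 1" by (intro I_sum I_scale \<beta>)
    then show ?thesis
      by (simp only: right_diff_distrib sum_subtractf \<iota>_sum \<iota>_mult sum_distrib_right mult.assoc)
  qed
  show ?thesis
  proof (rule that)
    obtain u where u: "l0 = (\<Sum>i\<in>G. \<iota> (u i) * g i)"
    proof -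
      have "l0 \<in> {\<Sum>v\<in>g ` G. \<iota> (u v) * v |u. True}" using l0(1) finite_G unfolding R_1 by (auto simp: fs.span_finite)
      then obtain u where u: "l0 = (\<Sum>v\<in>g ` G. \<iota> (u v) * v)" by blast
      \<comment> \<open>\<open>g\<close> may repeat values: coefficients given on the image are
        moved to one index for each value.\<close>
      obtain S where S: "S \<subseteq> G" "inj_on g S" "g ` S = g ` G" by (metis subset_image_inj subset_refl)
      have "l0 = (\<Sum>i\<in>S. \<iota> (u (g i)) * g i)" using u unfolding S(3)[symmetric] by (simp add: sum.reindex[OF S(2)])
      also have "\<dots> = (\<Sum>i\<in>G. \<iota> (if i \<in> S then u (g i) else 0) * g i)"
        using S(1) finite_G by (intro sum.mono_neutral_cong_left) auto
      finally show ?thesis by (rule that)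
    qed
    show "\<exists>i\<in>G. \<beta> i \<noteq> 0"
    proof (rule ccontr)
      assume "\<not> ?thesis"
      then have "(\<Sum>i\<in>G. u i * \<beta> i) = 0" by (intro sum.neutral) auto
      then have "l0 \<in> I L 1" using lin[of u] u by simp
      then show False using l0_not[of 1] by simp
    qed
    show "(\<Sum>i\<in>G. c i * \<beta> i) = 0" if "(\<Sum>i\<in>G. \<iota> (c i) * g i) \<in> L0" for c
    proof -
      have "(\<Sum>i\<in>G. \<iota> (c i) * g i) \<in> I L 1" using that L(2) unfolding I_1 by (auto intro: fs.span_base)
      from I_diff[OF this lin[of c]] show ?thesis using zero[of _ 1] by simp
    qed
    show "\<beta> i * \<beta> j = \<beta> i' * \<beta> j'"
      if G: "i \<in> G" "j \<in> G" "i' \<in> G" "j' \<in> G" and eq: "g i * g j = g i' * g j'" for i j i' j'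
    proof -
      have prod: "g i * g j - \<iota> (\<beta> i * \<beta> j) * l0 ^ 2 \<in> I L 2" if "i \<in> G" "j \<in> G" for i j
      proof -
        have "g i * (g j - \<iota> (\<beta> j) * l0) \<in> I L (1 + 1)" using I_mult'[OF gR \<beta>] that by blast
        moreover have "(g i - \<iota> (\<beta> i) * l0) * (\<iota> (\<beta> j) * l0) \<in> I L (1 + 1)"
          using I_mult[OF \<beta> R_scale[OF l0(1)]] that by blast
        ultimately have "g i * (g j - \<iota> (\<beta> j) * l0) + (g i - \<iota> (\<beta> i) * l0) * (\<iota> (\<beta> j) * l0) \<in> I L (1 + 1)"
          by (rule I_add)
        moreover have "g i * (g j - \<iota> (\<beta> j) * l0) + (g i - \<iota> (\<beta> i) * l0) * (\<iota> (\<beta> j) * l0)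
            = g i * g j - \<iota> (\<beta> i * \<beta> j) * l0 ^ 2"
          by (simp add: \<iota>_mult power2_eq_square algebra_simps)
        ultimately show ?thesis by (simp add: numeral_2_eq_2 del: I.simps)
      qed
      from I_diff[OF prod[OF G(3,4)] prod[OF G(1,2)]]
      have "\<iota> (\<beta> i * \<beta> j - \<beta> i' * \<beta> j') * l0 ^ 2 \<in> I L 2"
        using eq by (simp add: \<iota>_diff algebra_simps)
      then show ?thesis using zero by fastforce
    qed
  qed
qed

end

section \<open>Growth of the Segre ring and Hopf's lemma\<close>

definition exponents :: "nat \<Rightarrow> nat \<Rightarrow> (nat \<Rightarrow> nat) set" where
  "exponents r m = {\<alpha> \<in> {..<r} \<rightarrow>\<^sub>E UNIV. sum \<alpha> {..<r} = m}"

text \<open>The last exponent is determined by the others, which range over \<open>{..m}\<close>.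
  For growth in \<open>m\<close> only the exponent \<open>r - 1\<close> counts.\<close>

lemma card_exponents:
  assumes "0 < r"
  shows "finite (exponents r m)" "card (exponents r m) \<le> (m + 1) ^ (r - 1)"
proof -
  let ?F = "\<lambda>\<alpha>. restrict \<alpha> {..<r - 1}"
  have r: "{..<r} = insert (r - 1) {..<r - 1}" using assms by auto
  have inj: "inj_on ?F (exponents r m)"
  proof (rule inj_onI)
    fix \<alpha> \<beta> assume \<alpha>: "\<alpha> \<in> exponents r m" and \<beta>: "\<beta> \<in> exponents r m" and eq: "?F \<alpha> = ?F \<beta>"
    have le: "\<alpha> i = \<beta> i" if "i < r - 1" for i using fun_cong[OF eq, of i] that by simp
    then have "sum \<alpha> {..<r - 1} = sum \<beta> {..<r - 1}" by (intro sum.cong) auto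
    moreover have "sum \<alpha> {..<r} = sum \<beta> {..<r}" using \<alpha> \<beta> by (simp add: exponents_def)
    ultimately have "\<alpha> (r - 1) = \<beta> (r - 1)" by (simp add: r)
    then have "\<alpha> i = \<beta> i" if "i < r" for i using le[of i] that by (cases "i = r - 1") auto
    then show "\<alpha> = \<beta>" using \<alpha> \<beta> by (intro PiE_ext[of \<alpha> "{..<r}" "\<lambda>_. UNIV" \<beta>]) (auto simp: exponents_def)
  qed
  have sub: "?F ` exponents r m \<subseteq> {..<r - 1} \<rightarrow>\<^sub>E {..m}"
  proof (rule image_subsetI)
    fix \<alpha> assume \<alpha>: "\<alpha> \<in> exponents r m"
    have "\<alpha> i \<le> m" if "i < r - 1" for i
      using member_le_sum[of i "{..<r}" \<alpha>] \<alpha> that by (auto simp: exponents_def)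
    then show "?F \<alpha> \<in> {..<r - 1} \<rightarrow>\<^sub>E {..m}" by auto
  qed
  have fin: "finite ({..<r - 1} \<rightarrow>\<^sub>E {..m})" by (intro finite_PiE) auto
  show "finite (exponents r m)" using inj_on_finite[OF inj sub fin] .
  show "card (exponents r m) \<le> (m + 1) ^ (r - 1)"
    using card_inj_on_le[OF inj sub fin] by (simp add: card_PiE)
qed

context graded_algebra
begin

lemma R_prod:
  assumes "finite A" "\<And>a. a \<in> A \<Longrightarrow> f a \<in> R 1"
  shows "prod f A \<in> R (card A)"
  using assms
proof (induction A rule: finite_induct)
  case empty
  then show ?case using mons_R[of 1 0] by simp
next
  case (insert a A)
  then show ?case using R_mult[of "f a" 1 "prod f A" "card A"] by simp
qed

text \<open>Using the ideal membership of degree \<open>e\<close> again and again shows that, from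
  that degree on, the ring is finite over the subalgebra generated by the \<open>f l\<close>: the
  monomials of degree \<open>e\<close> generate it as a module.\<close>

lemma R_span_power_products:
  assumes "R e \<subseteq> I (f ` {..<r}) e"
  shows "R (e + m) \<subseteq> fs.span ((\<lambda>(\<alpha>, b). (\<Prod>l<r. f l ^ \<alpha> l) * b) ` (exponents r m \<times> mons e))"
proof (induction m)
  case 0
  have "b \<in> (\<lambda>(\<alpha>, b). (\<Prod>l<r. f l ^ \<alpha> l) * b) ` (exponents r 0 \<times> mons e)" if "b \<in> mons e" for b
    by (rule image_eqI[of _ _ "(\<lambda>l\<in>{..<r}. 0, b)"]) (use that in \<open>auto simp: exponents_def\<close>)
  then show ?case unfolding R_def by (simp add: fs.span_mono subsetI)
next
  case (Suc m)
  let ?S = "\<lambda>m. (\<lambda>(\<alpha>, b). (\<Prod>l<r. f l ^ \<alpha> l) * b) ` (exponents r m \<times> mons e)"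
  have mult: "f l * s \<in> ?S (Suc m)" if l: "l < r" and s: "s \<in> ?S m" for l s
  proof -
    obtain \<alpha> b where \<alpha>: "\<alpha> \<in> exponents r m" "b \<in> mons e" "s = (\<Prod>l<r. f l ^ \<alpha> l) * b" using s by auto
    define \<beta> where "\<beta> = \<alpha>(l := Suc (\<alpha> l))"
    have "sum \<beta> {..<r} = Suc (sum \<alpha> {..<r})"
      using l sum.remove[of "{..<r}" l \<alpha>] sum.remove[of "{..<r}" l \<beta>] by (simp add: \<beta>_def)
    then have "\<beta> \<in> exponents r (Suc m)" using \<alpha>(1) l by (auto simp: exponents_def \<beta>_def PiE_def extensional_def)
    moreover have "f l * (\<Prod>l<r. f l ^ \<alpha> l) = (\<Prod>l<r. f l ^ \<beta> l)"
      using l prod.remove[of "{..<r}" l "\<lambda>l. f l ^ \<alpha> l"] prod.remove[of "{..<r}" l "\<lambda>l. f l ^ \<beta> l"]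
      by (simp add: \<beta>_def mult.assoc)
    ultimately show ?thesis using \<alpha>(2,3) by (intro image_eqI[of _ _ "(\<beta>, b)"]) (auto simp: mult.assoc[symmetric])
  qed
  have "R (e + Suc m) \<subseteq> I (f ` {..<r}) (Suc (e + m))"
    using R_sub_I_mono[OF assms, of "Suc (e + m)"] by (simp del: I.simps)
  also have "\<dots> \<subseteq> fs.span (?S (Suc m))"
  proof -
    have "f l * h \<in> fs.span (?S (Suc m))" if "l < r" "h \<in> mons (e + m)" for l h
    proof (rule span_mult[of _ "{f l}" h "?S m"])
      show "h \<in> fs.span (?S m)" using Suc mons_R[OF that(2)] by blast
      show "f l \<in> fs.span {f l}" by (simp add: fs.span_base)
      show "a * b \<in> fs.span (?S (Suc m))" if "a \<in> {f l}" "b \<in> ?S m" for a b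
        using that mult[OF \<open>l < r\<close> that(2)] by (simp only: singleton_iff fs.span_base)
    qed simp
    then have "{x * h |x h. x \<in> f ` {..<r} \<and> h \<in> mons (e + m)} \<subseteq> fs.span (?S (Suc m))" by blast
    then show ?thesis unfolding I.simps by (rule fs.span_minimal) (rule fs.subspace_span)
  qed
  finally show ?case .
qed

end

text \<open>The Segre coordinates \<open>x_i y_j\<close>, as functions on pairs. Working with
  functions builds in the relations \<open>x_i y_j * x_i' y_j' = x_i y_j' * x_i' y_j\<close>, from
  which \<open>x\<close> and \<open>y\<close> are recovered in the end.\<close>

definition bilin_gen :: "nat \<times> nat \<Rightarrow> (nat \<Rightarrow> complex) \<times> (nat \<Rightarrow> complex) \<Rightarrow> complex" where
  "bilin_gen ij P = fst P (fst ij) * snd P (snd ij)"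

lemma graded_algebra_bilin: "graded_algebra (\<lambda>c _. c) ({..<p::nat} \<times> {..<q::nat})"
  by (intro graded_algebra.intro) (simp_all add: fun_eq_iff)

lemma prod_fun_apply: "(prod f A) x = (\<Prod>a\<in>A. f a x)"
  by (induction A rule: infinite_finite_induct) auto

text \<open>
  The Segre ring has enough functions of degree \<open>N (D - 1)\<close> to separate the \<open>D ^ N\<close> points of a
  grid, where \<open>N = p + q - 2\<close>; a ring that is finite over \<open>r \<le> N\<close> elements grows too slowly for that.
\<close>

lemma bilinear_forms_good:
  fixes p q r :: nat
  defines "G \<equiv> {..<p} \<times> {..<q}"
  assumes pq: "0 < p" "0 < q" and r: "0 < r" "r + 2 \<le> p + q"
    and f: "\<And>l. l < r \<Longrightarrow> f l \<in> graded_algebra.R (\<lambda>c _. c) bilin_gen G 1"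
  shows "graded_algebra.good (\<lambda>c _. c) bilin_gen G (f ` {..<r})"
proof -
  interpret graded_algebra "\<lambda>c _. c" bilin_gen G unfolding G_def by (rule graded_algebra_bilin)
  define N where "N = p + q - 2"
  have N: "0 < N" "r \<le> N" using r by (auto simp: N_def)
  have "\<not> R e \<subseteq> I (f ` {..<r}) e" for e
  proof
    assume e: "R e \<subseteq> I (f ` {..<r}) e"
    define C where "C = card (mons e)"
    \<comment> \<open>\<open>D\<close> exceeds \<open>C * N ^ (N - 1)\<close>, so the at most
      \<open>(N * D) ^ (N - 1) * C\<close> power products are fewer than the \<open>D ^ N\<close>
      grid points. The summand \<open>e\<close> makes the degree \<open>N * (D - 1)\<close> at least
      \<open>e\<close>.\<close>
    define D where "D = Suc (C * N ^ (N - 1) + e)"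
    define m where "m = N * (D - 1) - e"
    have em: "e + m = N * (D - 1)"
    proof -
      have "1 * e \<le> N * (D - 1)" using N by (intro mult_mono) (auto simp: D_def)
      then show ?thesis by (simp add: m_def)
    qed
    define S where "S = (\<lambda>(\<alpha>, b). (\<Prod>l<r. f l ^ \<alpha> l) * b) ` (exponents r m \<times> mons e)"
    have fS: "finite S" unfolding S_def using card_exponents[OF r(1)] finite_mons by auto
    define Gr where "Gr = {..<N} \<rightarrow>\<^sub>E {..<D}"
    have fGr: "finite Gr" unfolding Gr_def by (intro finite_PiE) auto
    have "card S \<le> card (exponents r m \<times> mons e)"
      unfolding S_def by (rule card_image_le) (simp add: card_exponents[OF r(1)] finite_mons)
    also have "\<dots> = card (exponents r m) * C" by (simp add: C_def card_cartesian_product)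
    also have "\<dots> \<le> (m + 1) ^ (r - 1) * C" using card_exponents[OF r(1)] by simp
    also have "\<dots> \<le> (N * D) ^ (r - 1) * C"
    proof -
      have "m + 1 \<le> N * (D - 1) + 1" using em by simp
      also have "\<dots> \<le> N * (D - 1) + N" using N by simp
      also have "\<dots> = N * D" by (simp add: D_def)
      finally show ?thesis by (intro mult_right_mono power_mono) auto
    qed
    also have "\<dots> \<le> (N * D) ^ (N - 1) * C"
      using N by (intro mult_right_mono power_increasing) (auto simp: D_def)
    also have "\<dots> = D ^ (N - 1) * (C * N ^ (N - 1))" by (simp add: power_mult_distrib)
    also have "\<dots> < D ^ (N - 1) * D" by (intro mult_strict_left_mono) (auto simp: D_def)
    also have "\<dots> = D ^ N" using N by (metis power_minus_mult)
    also have "\<dots> = card Gr" by (simp add: Gr_def card_PiE)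
    finally have card: "card S < card Gr" .
    \<comment> \<open>Grid points in the affine chart \<open>x_0 = y_0 = 1\<close>; the other
      \<open>(p - 1) + (q - 1) = N\<close> coordinates run through
      \<open>0, ..., D - 1\<close>.\<close>
    define pt where "pt \<gamma> = ((\<lambda>i. if i = 0 then 1 else of_nat (\<gamma> (i - 1)) :: complex),
        (\<lambda>j. if j = 0 then 1 else of_nat (\<gamma> (p - 1 + (j - 1))) :: complex))" for \<gamma> :: "nat \<Rightarrow> nat"
    \<comment> \<open>A non-trivial combination of evaluations at grid points that kills
      \<open>S\<close>, hence everything of degree \<open>e + m\<close>.\<close>
    obtain c where c: "\<exists>\<gamma>\<in>Gr. c \<gamma> \<noteq> 0" "\<forall>s\<in>S. (\<Sum>\<gamma>\<in>Gr. s (pt \<gamma>) * c \<gamma>) = 0"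
      using underdetermined_system[OF fS fGr card, of "\<lambda>s \<gamma>. s (pt \<gamma>)"] by blast
    have ann: "(\<Sum>\<gamma>\<in>Gr. h (pt \<gamma>) * c \<gamma>) = 0" if "h \<in> R (e + m)" for h
    proof -
      have "h \<in> fs.span S" using R_span_power_products[OF e] that unfolding S_def by blast
      then show ?thesis
      proof (induction rule: fs.span_induct_alt)
        case (step a s h)
        then show ?case using c(2)
          by (simp add: distrib_right sum.distrib mult.assoc sum_distrib_left[symmetric])
      qed simp
    qed
    obtain \<gamma>0 where \<gamma>0: "\<gamma>0 \<in> Gr" "c \<gamma>0 \<noteq> 0" using c(1) by blast
    define ix where "ix t = (if t < p - 1 then (t + 1, 0) else (0, t - (p - 1) + 1))" for t
    have ix: "ix t \<in> G" "bilin_gen (ix t) (pt \<gamma>) = of_nat (\<gamma> t)" if "t < N" for t \<gamma>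
      using that pq unfolding ix_def G_def bilin_gen_def pt_def N_def by (auto split: if_splits)
    have i0: "(0, 0) \<in> G" "bilin_gen (0, 0) (pt \<gamma>) = 1" for \<gamma>
      using pq by (auto simp: G_def bilin_gen_def pt_def)
    \<comment> \<open>The product of \<open>X\<close> over \<open>A\<close> is a Lagrange function:
      of degree \<open>N * (D - 1) = e + m\<close> and zero on the grid except at
      \<open>\<gamma>0\<close>. The generator at \<open>(0, 0)\<close> is 1 on the grid and makes
      the constants homogeneous.\<close>
    define X where "X = (\<lambda>(t, a). bilin_gen (ix t) - (\<lambda>_. of_nat a) * bilin_gen (0, 0))"
    define A where "A = (SIGMA t:{..<N}. {..<D} - {\<gamma>0 t})"
    have fA: "finite A" by (auto simp: A_def)
    have "card A = N * (D - 1)"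
    proof -
      have "card ({..<D} - {\<gamma>0 t}) = D - 1" if "t < N" for t
        using \<gamma>0(1) that by (subst card_Diff_singleton) (auto simp: Gr_def)
      then show ?thesis by (simp add: A_def)
    qed
    have gR: "bilin_gen i \<in> R 1" if "i \<in> G" for i
      using that unfolding R_1 by (simp add: fs.span_base)
    have "prod X A \<in> R (card A)"
    proof (rule R_prod[OF fA])
      fix ta assume "ta \<in> A"
      then show "X ta \<in> R 1"
        using gR[OF ix(1)] R_scale[OF gR[OF i0(1)]] fs.subspace_diff[OF subspace_R]
        by (auto simp: X_def A_def simp del: One_nat_def)
    qed
    then have sum0: "(\<Sum>\<gamma>\<in>Gr. (prod X A) (pt \<gamma>) * c \<gamma>) = 0"
      using ann[of "prod X A"] em \<open>card A = N * (D - 1)\<close> by simp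
    have val: "(prod X A) (pt \<gamma>) = (\<Prod>(t, a)\<in>A. of_nat (\<gamma> t) - of_nat a)" for \<gamma>
      unfolding prod_fun_apply by (rule prod.cong) (auto simp: X_def A_def ix i0)
    have "(prod X A) (pt \<gamma>) = 0" if "\<gamma> \<in> Gr" "\<gamma> \<noteq> \<gamma>0" for \<gamma>
    proof -
      have "\<exists>t<N. \<gamma> t \<noteq> \<gamma>0 t"
      proof (rule ccontr)
        assume "\<not> ?thesis"
        then have eq: "\<gamma> t = \<gamma>0 t" if "t \<in> {..<N}" for t using that by auto
        have "\<gamma> = \<gamma>0" by (rule PiE_ext[OF _ _ eq]) (use that(1) \<gamma>0(1) in \<open>simp_all only: Gr_def\<close>)
        then show False using that(2) by simp
      qed
      then obtain t where t: "t < N" "\<gamma> t \<noteq> \<gamma>0 t" by blast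
      have "(t, \<gamma> t) \<in> A" using t that by (auto simp: A_def Gr_def)
      then show ?thesis unfolding val by (intro prod_zero[OF fA]) (auto intro!: bexI[of _ "(t, \<gamma> t)"])
    qed
    then have "(\<Sum>\<gamma>\<in>Gr. (prod X A) (pt \<gamma>) * c \<gamma>) = (prod X A) (pt \<gamma>0) * c \<gamma>0"
      using fGr \<gamma>0(1) by (subst sum.remove[of _ \<gamma>0]) (auto intro!: sum.neutral)
    moreover have "(prod X A) (pt \<gamma>0) \<noteq> 0"
      unfolding val using fA by (auto simp: prod_zero_iff A_def)
    ultimately show False using sum0 \<gamma>0(2) by simp
  qed
  moreover have "f ` {..<r} \<subseteq> R 1" using f by auto
  ultimately show ?thesis by (simp add: good_def)
qed

text \<open>Hopf's lemma on nonsingular bilinear maps.\<close>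

theorem bilinear_system_zero:
  fixes b :: "nat \<Rightarrow> nat \<Rightarrow> nat \<Rightarrow> complex"
  assumes pq: "0 < p" "0 < q" and r: "r + 2 \<le> p + q"
  shows "\<exists>x y. (\<exists>i<p. x i \<noteq> 0) \<and> (\<exists>j<q. y j \<noteq> 0) \<and>
    (\<forall>l<r. (\<Sum>i<p. \<Sum>j<q. b l i j * x i * y j) = 0)"
proof (cases "r = 0")
  case True
  then show ?thesis using pq by (intro exI[of _ "\<lambda>_. 1"]) auto
next
  case False
  define G where "G = {..<p} \<times> {..<q}"
  interpret graded_algebra "\<lambda>c _. c" bilin_gen G unfolding G_def by (rule graded_algebra_bilin)
  define f where "f l = (\<Sum>i\<in>G. (\<lambda>_. b l (fst i) (snd i)) * bilin_gen i)" for l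
  have "f l \<in> R 1" for l
    unfolding f_def by (intro R_sum R_scale) (simp only: R_1 fs.span_base image_eqI)
  then have "good (f ` {..<r})"
    unfolding G_def using bilinear_forms_good[OF pq _ r, of f] False by (simp add: G_def)
  then obtain \<beta> where \<beta>: "\<exists>i\<in>G. \<beta> i \<noteq> 0"
    and zero: "\<And>c. (\<Sum>i\<in>G. (\<lambda>_. c i) * bilin_gen i) \<in> f ` {..<r} \<Longrightarrow> (\<Sum>i\<in>G. c i * \<beta> i) = 0"
    and rel: "\<And>i j i' j'. i \<in> G \<Longrightarrow> j \<in> G \<Longrightarrow> i' \<in> G \<Longrightarrow> j' \<in> G \<Longrightarrow>
      bilin_gen i * bilin_gen j = bilin_gen i' * bilin_gen j' \<Longrightarrow> \<beta> i * \<beta> j = \<beta> i' * \<beta> j'"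
    by (rule character_exists) (rule that, assumption+)
  obtain i0 j0 where ij: "i0 < p" "j0 < q" "\<beta> (i0, j0) \<noteq> 0" using \<beta> by (auto simp: G_def)
  \<comment> \<open>The quadratic relations say that the matrix \<open>\<beta>\<close> has rank one;
    it is factored by the column and the row through a non-zero entry.\<close>
  define x y where "x i = \<beta> (i, j0)" and "y j = \<beta> (i0, j) / \<beta> (i0, j0)" for i j
  have xy: "x i * y j = \<beta> (i, j)" if "i < p" "j < q" for i j
  proof -
    have "\<beta> (i, j0) * \<beta> (i0, j) = \<beta> (i, j) * \<beta> (i0, j0)"
      using that ij by (intro rel) (auto simp: G_def bilin_gen_def fun_eq_iff)
    then show ?thesis using ij by (simp add: x_def y_def)
  qed
  have "(\<Sum>i<p. \<Sum>j<q. b l i j * x i * y j) = 0" if "l < r" for l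
  proof -
    have "(\<Sum>i<p. \<Sum>j<q. b l i j * x i * y j) = (\<Sum>i<p. \<Sum>j<q. b l i j * \<beta> (i, j))"
      by (intro sum.cong refl) (simp add: xy mult.assoc)
    also have "\<dots> = (\<Sum>i\<in>G. b l (fst i) (snd i) * \<beta> i)"
      by (simp add: G_def sum.cartesian_product case_prod_unfold)
    also have "\<dots> = 0" using that by (intro zero) (auto simp: f_def)
    finally show ?thesis .
  qed
  moreover have "\<exists>i<p. x i \<noteq> 0" "\<exists>j<q. y j \<noteq> 0" using ij by (auto simp: x_def y_def)
  ultimately show ?thesis by blast
qed

text \<open>Conditions on \<open>x\<close> alone or on \<open>y\<close> alone are solved first, by
  \<open>kernel_parametrization\<close>; at least \<open>p - card E\<close> and
  \<open>q - card F\<close> parameters remain, and the bilinear forms are pulled back to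
  them.\<close>

lemma bilinear_system_zero_constrained:
  fixes b :: "'l \<Rightarrow> nat \<Rightarrow> nat \<Rightarrow> complex"
    and u :: "'e \<Rightarrow> nat \<Rightarrow> complex" and v :: "'f \<Rightarrow> nat \<Rightarrow> complex"
  assumes fin: "finite E" "finite F" "finite L" and less: "card E < p" "card F < q"
    and card: "card E + card F + card L + 2 \<le> p + q"
  shows "\<exists>x y. (\<exists>i<p. x i \<noteq> 0) \<and> (\<exists>j<q. y j \<noteq> 0) \<and>
    (\<forall>e\<in>E. (\<Sum>i<p. u e i * x i) = 0) \<and> (\<forall>f\<in>F. (\<Sum>j<q. v f j * y j) = 0) \<and>
    (\<forall>l\<in>L. (\<Sum>i<p. \<Sum>j<q. b l i j * x i * y j) = 0)"
proof -
  obtain I1 S where I1: "I1 \<subseteq> {..<p}" "card {..<p} \<le> card I1 + card E"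
    "\<forall>z. \<forall>i\<in>I1. (\<Sum>j\<in>I1. S i j * z j) = z i"
    "\<forall>z. \<forall>e\<in>E. (\<Sum>i<p. u e i * (\<Sum>j\<in>I1. S i j * z j)) = 0"
    using kernel_parametrization[OF fin(1) finite_lessThan, of p u] by (elim exE conjE) (rule that, assumption+)
  obtain I2 T where I2: "I2 \<subseteq> {..<q}" "card {..<q} \<le> card I2 + card F"
    "\<forall>z. \<forall>i\<in>I2. (\<Sum>j\<in>I2. T i j * z j) = z i"
    "\<forall>z. \<forall>e\<in>F. (\<Sum>i<q. v e i * (\<Sum>j\<in>I2. T i j * z j)) = 0"
    using kernel_parametrization[OF fin(2) finite_lessThan, of q v] by (elim exE conjE) (rule that, assumption+)
  have fI: "finite I1" "finite I2" using I1(1) I2(1) finite_subset by blast+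
  obtain h1 where h1: "bij_betw h1 {..<card I1} I1"
    using ex_bij_betw_nat_finite[OF fI(1)] by (auto simp: atLeast0LessThan)
  obtain h2 where h2: "bij_betw h2 {..<card I2} I2"
    using ex_bij_betw_nat_finite[OF fI(2)] by (auto simp: atLeast0LessThan)
  obtain h3 where h3: "bij_betw h3 {..<card L} L"
    using ex_bij_betw_nat_finite[OF fin(3)] by (auto simp: atLeast0LessThan)
  define b' where "b' l i' j' = (\<Sum>i<p. \<Sum>j<q. b (h3 l) i j * S i (h1 i') * T j (h2 j'))" for l i' j'
  obtain x' y' where xy: "\<exists>i<card I1. x' i \<noteq> 0" "\<exists>j<card I2. y' j \<noteq> 0"
    "\<forall>l<card L. (\<Sum>i<card I1. \<Sum>j<card I2. b' l i j * x' i * y' j) = 0"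
    using bilinear_system_zero[of "card I1" "card I2" "card L" b'] less card I1(2) I2(2) by auto
  define zx where "zx i = x' (the_inv_into {..<card I1} h1 i)" for i
  define zy where "zy j = y' (the_inv_into {..<card I2} h2 j)" for j
  define x where "x i = (\<Sum>i'\<in>I1. S i i' * zx i')" for i
  define y where "y j = (\<Sum>j'\<in>I2. T j j' * zy j')" for j
  have zx: "zx (h1 i) = x' i" if "i < card I1" for i
    using that h1 by (simp add: zx_def the_inv_into_f_f bij_betw_def)
  have zy: "zy (h2 j) = y' j" if "j < card I2" for j
    using that h2 by (simp add: zy_def the_inv_into_f_f bij_betw_def)
  have x: "x i = (\<Sum>i'<card I1. S i (h1 i') * x' i')" for i
    unfolding x_def sum.reindex_bij_betw[OF h1, symmetric] by (intro sum.cong refl) (simp add: zx)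
  have y: "y j = (\<Sum>j'<card I2. T j (h2 j') * y' j')" for j
    unfolding y_def sum.reindex_bij_betw[OF h2, symmetric] by (intro sum.cong refl) (simp add: zy)
  have "\<exists>i<p. x i \<noteq> 0"
  proof -
    obtain i where i: "i < card I1" "x' i \<noteq> 0" using xy(1) by blast
    then have "h1 i \<in> I1" using h1 by (auto simp: bij_betw_def)
    moreover from this have "x (h1 i) = x' i" using I1(3) i zx by (simp add: x_def)
    ultimately show ?thesis using i I1(1) by (intro exI[of _ "h1 i"]) auto
  qed
  moreover have "\<exists>j<q. y j \<noteq> 0"
  proof -
    obtain j where j: "j < card I2" "y' j \<noteq> 0" using xy(2) by blast
    then have "h2 j \<in> I2" using h2 by (auto simp: bij_betw_def)
    moreover from this have "y (h2 j) = y' j" using I2(3) j zy by (simp add: y_def)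
    ultimately show ?thesis using j I2(1) by (intro exI[of _ "h2 j"]) auto
  qed
  moreover have "\<forall>e\<in>E. (\<Sum>i<p. u e i * x i) = 0" using I1(4) by (simp only: x_def) simp
  moreover have "\<forall>f\<in>F. (\<Sum>j<q. v f j * y j) = 0" using I2(4) by (simp only: y_def) simp
  moreover have "(\<Sum>i<p. \<Sum>j<q. b l i j * x i * y j) = 0" if "l \<in> L" for l
  proof -
    have "l \<in> h3 ` {..<card L}" using h3 that by (simp add: bij_betw_def)
    then obtain m where m: "m < card L" "l = h3 m" by blast
    have "(\<Sum>i<p. \<Sum>j<q. b l i j * x i * y j)
        = (\<Sum>i<p. \<Sum>j<q. \<Sum>i'<card I1. \<Sum>j'<card I2. b l i j * S i (h1 i') * T j (h2 j') * x' i' * y' j')"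
      unfolding x y by (intro sum.cong refl) (simp add: sum_distrib_left sum_distrib_right algebra_simps)
    also have "\<dots> = (\<Sum>i<p. \<Sum>i'<card I1. \<Sum>j<q. \<Sum>j'<card I2. b l i j * S i (h1 i') * T j (h2 j') * x' i' * y' j')"
      by (rule sum.cong[OF refl], rule sum.swap)
    also have "\<dots> = (\<Sum>i'<card I1. \<Sum>i<p. \<Sum>j<q. \<Sum>j'<card I2. b l i j * S i (h1 i') * T j (h2 j') * x' i' * y' j')"
      by (rule sum.swap)
    also have "\<dots> = (\<Sum>i'<card I1. \<Sum>i<p. \<Sum>j'<card I2. \<Sum>j<q. b l i j * S i (h1 i') * T j (h2 j') * x' i' * y' j')"
      by (rule sum.cong[OF refl], rule sum.cong[OF refl], rule sum.swap)
    also have "\<dots> = (\<Sum>i'<card I1. \<Sum>j'<card I2. \<Sum>i<p. \<Sum>j<q. b l i j * S i (h1 i') * T j (h2 j') * x' i' * y' j')"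
      by (rule sum.cong[OF refl], rule sum.swap)
    also have "\<dots> = (\<Sum>i'<card I1. \<Sum>j'<card I2. b' m i' j' * x' i' * y' j')"
      unfolding b'_def m(2) by (intro sum.cong refl) (simp add: sum_distrib_right)
    also have "\<dots> = 0" using xy(3) m(1) by blast
    finally show ?thesis .
  qed
  ultimately show ?thesis by blast
qed

section \<open>Unstable hyperplanes of a nonsingular tensor\<close>

definition dot :: "nat \<Rightarrow> (nat \<Rightarrow> complex) \<Rightarrow> (nat \<Rightarrow> complex) \<Rightarrow> complex" where
  "dot m a x = (\<Sum>i<m. a i * x i)"

lemma dot_sum_left: "dot m (\<lambda>i. \<Sum>j\<in>J. c j * a j i) x = (\<Sum>j\<in>J. c j * dot m (a j) x)"
  unfolding dot_def sum_distrib_left sum_distrib_right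
  by (subst sum.swap) (simp add: mult.assoc)

lemma dot_zero_left: "(\<And>i. i < m \<Longrightarrow> a i = 0) \<Longrightarrow> dot m a x = 0"
  by (simp add: dot_def)

definition indep_on :: "nat \<Rightarrow> 'j set \<Rightarrow> ('j \<Rightarrow> nat \<Rightarrow> complex) \<Rightarrow> bool" where
  "indep_on m J v \<longleftrightarrow> (\<forall>c. (\<forall>i<m. (\<Sum>j\<in>J. c j * v j i) = 0) \<longrightarrow> (\<forall>j\<in>J. c j = 0))"

lemma indep_onD:
  assumes "indep_on m J v" "\<And>i. i < m \<Longrightarrow> (\<Sum>j\<in>J. c j * v j i) = 0" "j \<in> J"
  shows "c j = 0"
  using assms(1)[unfolded indep_on_def, THEN spec, of c] assms(2,3) by simp

text \<open>A circuit of the family. A vanishing coefficient would give a relation on a proper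
  subset, which is independent by minimality.\<close>

lemma minimal_dependent_subset:
  assumes "finite J" "\<not> indep_on m J v"
  obtains J' c where "J' \<subseteq> J" "J' \<noteq> {}" "\<And>j. j \<in> J' \<Longrightarrow> c j \<noteq> 0"
    "\<And>i. i < m \<Longrightarrow> (\<Sum>j\<in>J'. c j * v j i) = 0" "\<And>j. j \<in> J' \<Longrightarrow> indep_on m (J' - {j}) v"
proof -
  define P where "P J' \<longleftrightarrow> J' \<subseteq> J \<and> \<not> indep_on m J' v" for J'
  have "P J" using assms by (simp add: P_def)
  then obtain J' where J': "P J'" and min: "\<And>J''. P J'' \<Longrightarrow> card J' \<le> card J''"
    using arg_min_nat_lemma[of P J card] by blast
  have fin: "finite J'" using J' assms finite_subset by (auto simp: P_def)
  have indep: "indep_on m (J' - {j}) v" if "j \<in> J'" for j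
  proof (rule ccontr)
    assume "\<not> ?thesis"
    then have "P (J' - {j})" using J' by (auto simp: P_def)
    then show False using min[of "J' - {j}"] that fin card_Diff1_less[of J' j] by simp
  qed
  obtain c where c: "\<forall>i<m. (\<Sum>j\<in>J'. c j * v j i) = 0" "\<not> (\<forall>j\<in>J'. c j = 0)"
    using J' unfolding P_def indep_on_def by blast
  have "c j \<noteq> 0" if j: "j \<in> J'" for j
  proof
    assume "c j = 0"
    then have "\<forall>i<m. (\<Sum>j\<in>J' - {j}. c j * v j i) = 0"
      using c(1) sum.remove[OF fin j, of "\<lambda>j. c j * v j i" for i] by simp
    then have "\<forall>j\<in>J' - {j}. c j = 0" using indep_onD[OF indep[OF j], of c] by simp
    then show False using c(2) \<open>c j = 0\<close> by blast
  qed
  moreover have "J' \<noteq> {}" using c(2) by blast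
  ultimately show ?thesis using that[of J' c] J' c(1) indep by (simp add: P_def)
qed

text \<open>Dual form of surjectivity of \<open>W \<otimes> O \<rightarrow> I \<otimes> O(1)\<close>
  on fibres: for \<open>x \<noteq> 0\<close> the transposed map from the dual of \<open>I\<close> to
  the dual of \<open>W\<close> is injective.\<close>

locale nonsingular_tensor =
  fixes n k :: nat and T :: "nat \<Rightarrow> nat \<Rightarrow> nat \<Rightarrow> complex"
  assumes nonsingular: "\<exists>t<n + 1. x t \<noteq> 0 \<Longrightarrow> \<exists>r<k. y r \<noteq> 0 \<Longrightarrow>
    \<exists>l<n + k. (\<Sum>t<n + 1. \<Sum>r<k. T t r l * x t * y r) \<noteq> 0"
begin

definition B :: "(nat \<Rightarrow> complex) \<Rightarrow> (nat \<Rightarrow> complex) \<Rightarrow> nat \<Rightarrow> complex" where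
  "B x y l = (\<Sum>t<n + 1. \<Sum>r<k. T t r l * x t * y r)"

text \<open>
  For the tensor of a Steiner bundle, such a \<open>w\<close> is a section of the dual bundle over the
  hyperplane \<open>a = 0\<close>.
\<close>

definition contracts :: "(nat \<Rightarrow> complex) \<Rightarrow> (nat \<Rightarrow> complex) \<Rightarrow> (nat \<Rightarrow> complex) \<Rightarrow> bool" where
  "contracts w a i \<longleftrightarrow> (\<forall>t<n + 1. \<forall>r<k. (\<Sum>l<n + k. T t r l * w l) = a t * i r)"

lemma contracts_B:
  assumes "contracts w a i"
  shows "dot (n + k) w (B x y) = dot (n + 1) a x * dot k i y"
proof -
  have "dot (n + k) w (B x y) = (\<Sum>l<n + k. \<Sum>t<n + 1. \<Sum>r<k. T t r l * w l * x t * y r)"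
    unfolding dot_def B_def by (simp add: sum_distrib_left algebra_simps)
  also have "\<dots> = (\<Sum>t<n + 1. \<Sum>l<n + k. \<Sum>r<k. T t r l * w l * x t * y r)" by (rule sum.swap)
  also have "\<dots> = (\<Sum>t<n + 1. \<Sum>r<k. \<Sum>l<n + k. T t r l * w l * x t * y r)"
    by (intro sum.cong refl sum.swap)
  also have "\<dots> = (\<Sum>t<n + 1. \<Sum>r<k. (\<Sum>l<n + k. T t r l * w l) * x t * y r)"
    by (simp add: sum_distrib_right)
  also have "\<dots> = (\<Sum>t<n + 1. \<Sum>r<k. (a t * x t) * (i r * y r))"
    using assms unfolding contracts_def by (intro sum.cong refl) simp
  also have "\<dots> = dot (n + 1) a x * dot k i y"
    unfolding dot_def by (simp only: sum_product)
  finally show ?thesis .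
qed

text \<open>The counting principle of this section. The conditions \<open>E\<close> and
  \<open>F\<close> make \<open>B x y\<close> orthogonal to every \<open>w j\<close>, since one
  factor of \<open>dot (n + 1) (a j) x * dot k (i j) y\<close> vanishes; at most
  \<open>n + k - card J\<close> further coordinate conditions then make it zero. With
  \<open>card J > card E + card F\<close> these are at most \<open>(n + 1) + k - 2\<close>
  conditions, so Hopf's lemma contradicts nonsingularity.\<close>

lemma card_indep_le:
  fixes w :: "'j \<Rightarrow> nat \<Rightarrow> complex" and u :: "'e \<Rightarrow> nat \<Rightarrow> complex" and v :: "'f \<Rightarrow> nat \<Rightarrow> complex"
  assumes fin: "finite J" "finite E" "finite F" and less: "card E \<le> n" "card F < k"
    and w: "\<And>j. j \<in> J \<Longrightarrow> contracts (w j) (a j) (i j)" "indep_on (n + k) J w"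
    and J: "J = J1 \<union> J2"
    and E: "\<And>x j. (\<And>e. e \<in> E \<Longrightarrow> dot (n + 1) (u e) x = 0) \<Longrightarrow> j \<in> J1 \<Longrightarrow> dot (n + 1) (a j) x = 0"
    and F: "\<And>y j. (\<And>f. f \<in> F \<Longrightarrow> dot k (v f) y = 0) \<Longrightarrow> j \<in> J2 \<Longrightarrow> dot k (i j) y = 0"
  shows "card J \<le> card E + card F"
proof (rule ccontr)
  assume less': "\<not> ?thesis"
  obtain L where L: "L \<subseteq> {..<n + k}" "card L + card J \<le> card {..<n + k}"
    "\<forall>\<xi>. (\<forall>j\<in>J. (\<Sum>l<n + k. w j l * \<xi> l) = 0) \<and> (\<forall>l\<in>L. \<xi> l = 0) \<longrightarrow> (\<forall>l\<in>{..<n + k}. \<xi> l = 0)"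
    using independent_family_complement[OF fin(1), of "{..<n + k}" w] w(2) by (auto simp: indep_on_def)
  have fL: "finite L" using L(1) finite_subset by blast
  obtain x y where xy: "\<exists>t<n + 1. x t \<noteq> 0" "\<exists>r<k. y r \<noteq> 0"
    "\<forall>e\<in>E. (\<Sum>t<n + 1. u e t * x t) = 0" "\<forall>f\<in>F. (\<Sum>r<k. v f r * y r) = 0"
    "\<forall>l\<in>L. (\<Sum>t<n + 1. \<Sum>r<k. T t r l * x t * y r) = 0"
    using bilinear_system_zero_constrained[OF fin(2,3) fL, of "n + 1" k u v "\<lambda>l t r. T t r l"] less L(2) less'
    by auto
  have "dot (n + k) (w j) (B x y) = 0" if "j \<in> J" for j
    using contracts_B[OF w(1)[OF that]] E[of x j] F[of y j] xy(3,4) that J by (auto simp: dot_def)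
  moreover have "\<forall>l\<in>L. B x y l = 0" using xy(5) by (simp add: B_def)
  ultimately have "\<forall>l<n + k. B x y l = 0" using L(3) by (auto simp: dot_def)
  then show False using nonsingular[OF xy(1,2)] by (auto simp: B_def)
qed

text \<open>A zero factor would make \<open>w\<close> orthogonal to all \<open>B x y\<close> without
  any condition, and \<open>card_indep_le\<close> with empty \<open>E\<close> and \<open>F\<close>
  would bound one vector by zero.\<close>

lemma contracts_nonzero:
  assumes "0 < k" "contracts w a i" "\<exists>l<n + k. w l \<noteq> 0"
  shows "\<exists>t<n + 1. a t \<noteq> 0" "\<exists>r<k. i r \<noteq> 0"
proof -
  have ind: "indep_on (n + k) {()} (\<lambda>_. w)" using assms(3) by (auto simp: indep_on_def)
  show "\<exists>t<n + 1. a t \<noteq> 0"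
  proof (rule ccontr)
    assume "\<not> ?thesis"
    then have "dot (n + 1) a x = 0" for x by (intro dot_zero_left) auto
    then show False
      using card_indep_le[of "{()}" "{} :: unit set" "{} :: unit set" "\<lambda>_. w" "\<lambda>_. a" "\<lambda>_. i" "{()}" "{}"]
        assms(1,2) ind by auto
  qed
  show "\<exists>r<k. i r \<noteq> 0"
  proof (rule ccontr)
    assume "\<not> ?thesis"
    then have "dot k i y = 0" for y by (intro dot_zero_left) auto
    then show False
      using card_indep_le[of "{()}" "{} :: unit set" "{} :: unit set" "\<lambda>_. w" "\<lambda>_. a" "\<lambda>_. i" "{}" "{()}"]
        assms(1,2) ind by auto
  qed
qed

text \<open>The relation between the \<open>w j\<close> is contracted with the tensor.\<close>

lemma contracts_relation:
  assumes "\<And>j. j \<in> J \<Longrightarrow> contracts (w j) (a j) (i j)"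
    and "\<And>l. l < n + k \<Longrightarrow> (\<Sum>j\<in>J. c j * w j l) = 0" and "t < n + 1" "r < k"
  shows "(\<Sum>j\<in>J. (c j * i j r) * a j t) = 0"
proof -
  have "(\<Sum>j\<in>J. (c j * i j r) * a j t) = (\<Sum>j\<in>J. c j * (\<Sum>l<n + k. T t r l * w j l))"
    using assms(1,3,4) by (intro sum.cong refl) (simp add: contracts_def)
  also have "\<dots> = (\<Sum>l<n + k. T t r l * (\<Sum>j\<in>J. c j * w j l))"
    unfolding sum_distrib_left by (subst sum.swap) (simp add: algebra_simps)
  also have "\<dots> = 0" using assms(2) by simp
  finally show ?thesis .
qed

text \<open>A circuit \<open>J'\<close> of equations is used twice. All but one of them imply the
  last, so \<open>card_indep_le\<close> makes the \<open>w j\<close> dependent; contracting this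
  relation and comparing with the circuit shows that all \<open>i j\<close> are proportional to one
  vector \<open>\<mu>\<close>. Now a single condition on \<open>y\<close>, allowed since
  \<open>k \<ge> 2\<close>, serves two indices, yet two of the \<open>w j\<close> are independent
  because their equations are.\<close>

lemma normal_crossing_of_pairwise:
  assumes k: "2 \<le> k" and fin: "finite J" and card: "card J \<le> n + 1"
    and w: "\<And>j. j \<in> J \<Longrightarrow> contracts (w j) (a j) (i j)" "\<And>j. j \<in> J \<Longrightarrow> \<exists>l<n + k. w j l \<noteq> 0"
    and pair: "\<And>j j' c d. j \<in> J \<Longrightarrow> j' \<in> J \<Longrightarrow> j \<noteq> j' \<Longrightarrow>
      (\<And>t. t < n + 1 \<Longrightarrow> c * a j t + d * a j' t = 0) \<Longrightarrow> c = 0 \<and> d = 0"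
  shows "indep_on (n + 1) J a"
proof (rule ccontr)
  assume "\<not> ?thesis"
  then obtain J' e where J': "J' \<subseteq> J" "J' \<noteq> {}" and e: "\<And>j. j \<in> J' \<Longrightarrow> e j \<noteq> 0"
    "\<And>t. t < n + 1 \<Longrightarrow> (\<Sum>j\<in>J'. e j * a j t) = 0"
    and ind: "\<And>j. j \<in> J' \<Longrightarrow> indep_on (n + 1) (J' - {j}) a"
    by (rule minimal_dependent_subset[OF fin]) (rule that, assumption+)
  have fJ': "finite J'" using J'(1) fin finite_subset by blast
  obtain j0 where j0: "j0 \<in> J'" using J'(2) by blast
  note nz = contracts_nonzero[OF _ w]
  have "J' \<noteq> {j0}"
  proof
    assume "J' = {j0}"
    then have "a j0 t = 0" if "t < n + 1" for t using e(1)[OF j0] e(2)[OF that] by simp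
    then show False using nz(1)[of j0] k j0 J'(1) by auto
  qed
  then obtain j1 where j1: "j1 \<in> J'" "j1 \<noteq> j0" using j0 by blast
  have "\<not> indep_on (n + k) J' w"
  proof
    assume indw: "indep_on (n + k) J' w"
    have "card J' \<le> card (J' - {j0}) + card ({} :: unit set)"
    proof (rule card_indep_le[of J' "J' - {j0}" "{} :: unit set" w a i J' "{}" a "\<lambda>_ _. 0"])
      show "card (J' - {j0}) \<le> n"
        using card card_mono[OF fin J'(1)] card_Diff_singleton[OF j0] by simp
      fix x j assume x: "\<And>e. e \<in> J' - {j0} \<Longrightarrow> dot (n + 1) (a e) x = 0" and j: "j \<in> J'"
      have "0 = dot (n + 1) (\<lambda>t. \<Sum>j\<in>J'. e j * a j t) x"
        by (rule dot_zero_left[symmetric]) (use e(2) in auto)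
      also have "\<dots> = e j0 * dot (n + 1) (a j0) x"
        unfolding dot_sum_left using x by (subst sum.remove[OF fJ' j0]) (auto intro!: sum.neutral)
      finally show "dot (n + 1) (a j) x = 0" using x j e(1)[OF j0] by (cases "j = j0") auto
    qed (use fJ' k w(1) J'(1) indw in auto)
    then show False using card_Diff1_less[OF fJ' j0] by simp
  qed
  then obtain c where c: "\<And>l. l < n + k \<Longrightarrow> (\<Sum>j\<in>J'. c j * w j l) = 0" "\<exists>j\<in>J'. c j \<noteq> 0"
    unfolding indep_on_def by blast
  \<comment> \<open>Relations supported on a circuit are multiples of \<open>e\<close>; the factor
    is read off at \<open>j0\<close>.\<close>
  define \<mu> where "\<mu> r = c j0 * i j0 r / e j0" for r
  have proportional: "c j * i j r = \<mu> r * e j" if j: "j \<in> J'" and r: "r < k" for j r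
  proof -
    define d where "d j = c j * i j r - \<mu> r * e j" for j
    have "d j0 = 0" using e(1)[OF j0] by (simp add: d_def \<mu>_def)
    have "(\<Sum>j\<in>J' - {j0}. d j * a j t) = 0" if t: "t < n + 1" for t
    proof -
      have "(\<Sum>j\<in>J'. d j * a j t) = (\<Sum>j\<in>J'. (c j * i j r) * a j t) - \<mu> r * (\<Sum>j\<in>J'. e j * a j t)"
        by (simp add: d_def left_diff_distrib sum_subtractf sum_distrib_left mult.assoc)
      also have "\<dots> = 0" using contracts_relation[of J' w a i c t r] w(1) J'(1) c(1) t r e(2) by auto
      finally show ?thesis using sum.remove[OF fJ' j0, of "\<lambda>j. d j * a j t"] \<open>d j0 = 0\<close> by simp
    qed
    then have "\<forall>j\<in>J' - {j0}. d j = 0" using indep_onD[OF ind[OF j0], of d] by blast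
    then have "d j = 0" using j \<open>d j0 = 0\<close> by blast
    then show ?thesis by (simp add: d_def)
  qed
  have c_nz: "c j \<noteq> 0" if "j \<in> J'" for j
  proof -
    obtain j2 where j2: "j2 \<in> J'" "c j2 \<noteq> 0" using c(2) by blast
    obtain r where r: "r < k" "i j2 r \<noteq> 0" using nz(2)[of j2] j2(1) J'(1) k by auto
    have "\<mu> r \<noteq> 0" using proportional[OF j2(1) r(1)] j2(2) r(2) by auto
    then show ?thesis using proportional[OF that r(1)] e(1)[OF that] by auto
  qed
  have "indep_on (n + k) {j0, j1} w"
    unfolding indep_on_def
  proof (intro allI impI)
    fix d assume d: "\<forall>l<n + k. (\<Sum>j\<in>{j0, j1}. d j * w j l) = 0"
    have rel: "d j0 * i j0 r = 0 \<and> d j1 * i j1 r = 0" if r: "r < k" for r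
    proof (rule pair)
      show "j0 \<in> J" "j1 \<in> J" "j0 \<noteq> j1" using j0 j1 J'(1) by auto
      fix t assume "t < n + 1"
      then show "d j0 * i j0 r * a j0 t + d j1 * i j1 r * a j1 t = 0"
        using contracts_relation[of "{j0, j1}" w a i d t r] w(1) j0 j1 J'(1) d r by auto
    qed
    have "d j0 = 0" using nz(2)[of j0] j0 J'(1) k rel by fastforce
    moreover have "d j1 = 0" using nz(2)[of j1] j1 J'(1) k rel by fastforce
    ultimately show "\<forall>j\<in>{j0, j1}. d j = 0" by simp
  qed
  then have "card {j0, j1} \<le> card ({} :: unit set) + card {()}"
  proof (rule card_indep_le[of "{j0, j1}" "{} :: unit set" "{()}" w a i "{}" "{j0, j1}" "\<lambda>_ _. 0" "\<lambda>_. \<mu>", rotated 6])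
    fix y j assume y: "\<And>f. f \<in> {()} \<Longrightarrow> dot k \<mu> y = 0" and j: "j \<in> {j0, j1}"
    have "c j * dot k (i j) y = e j * dot k \<mu> y"
      unfolding dot_def sum_distrib_left using proportional[of j] j j0 j1
      by (intro sum.cong refl) (auto simp: mult.assoc[symmetric] mult.commute[of "e _"])
    then show "dot k (i j) y = 0" using y c_nz[of j] j j0 j1 by auto
  qed (use k w(1) j0 j1 J'(1) in auto)
  then show False using j1 by simp
qed

text \<open>There are more than \<open>n + k\<close> vectors, so they contain a circuit
  \<open>J'\<close>. If it is not all of \<open>J\<close>, it still has more than
  \<open>n + 1\<close> members, as otherwise normal crossing would kill the contracted relation.
  Choose \<open>n + 1\<close> of them: the \<open>card J' - (n + 1) < k\<close> conditions that
  \<open>i j\<close> vanish on \<open>y\<close> at the others imply the same at these, and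
  \<open>card_indep_le\<close> gives \<open>card J' - 1 \<le> card J' - (n + 1)\<close>, impossible
  for \<open>n > 0\<close>.\<close>

lemma full_relation:
  assumes n: "0 < n" and k: "0 < k" and fin: "finite J" and card: "card J = n + k + 1"
    and w: "\<And>j. j \<in> J \<Longrightarrow> contracts (w j) (a j) (i j)" "\<And>j. j \<in> J \<Longrightarrow> \<exists>l<n + k. w j l \<noteq> 0"
    and nc: "\<And>J'. J' \<subseteq> J \<Longrightarrow> card J' \<le> n + 1 \<Longrightarrow> indep_on (n + 1) J' a"
  obtains c where "\<And>j. j \<in> J \<Longrightarrow> c j \<noteq> 0" "\<And>l. l < n + k \<Longrightarrow> (\<Sum>j\<in>J. c j * w j l) = 0"
    "\<And>\<xi>. (\<And>j. j \<in> J \<Longrightarrow> dot (n + k) (w j) \<xi> = 0) \<Longrightarrow> \<forall>l<n + k. \<xi> l = 0"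
proof -
  note nz = contracts_nonzero[OF _ w]
  have "card {..<n + k} < card J" using card by simp
  from underdetermined_system[OF _ fin this, of "\<lambda>l j. w j l"]
  have "\<not> indep_on (n + k) J w" by (auto simp: indep_on_def mult.commute)
  then obtain J' c where J': "J' \<subseteq> J" "J' \<noteq> {}" and c: "\<And>j. j \<in> J' \<Longrightarrow> c j \<noteq> 0"
    "\<And>l. l < n + k \<Longrightarrow> (\<Sum>j\<in>J'. c j * w j l) = 0"
    and ind: "\<And>j. j \<in> J' \<Longrightarrow> indep_on (n + k) (J' - {j}) w"
    by (rule minimal_dependent_subset[OF fin]) (rule that, assumption+)
  have fJ': "finite J'" using J'(1) fin finite_subset by blast
  obtain j0 where j0: "j0 \<in> J'" using J'(2) by blast
  have rel: "(\<Sum>j\<in>J'. (c j * i j r) * a j t) = 0" if "t < n + 1" "r < k" for t r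
    using contracts_relation[of J' w a i c t r] w(1) J'(1) c(2) that by auto
  have "J' = J"
  proof (rule ccontr)
    assume "J' \<noteq> J"
    then have cJ': "card J' < n + k + 1" using J'(1) card psubset_card_mono[OF fin, of J'] by auto
    have "n + 1 < card J'"
    proof (rule ccontr)
      assume "\<not> ?thesis"
      then have indJ': "indep_on (n + 1) J' a" using nc[OF J'(1)] by simp
      obtain r where r: "r < k" "i j0 r \<noteq> 0" using nz(2)[of j0] j0 J'(1) k by auto
      have "c j0 * i j0 r = 0"
        using indep_onD[OF indJ' rel[OF _ r(1)] j0] by simp
      then show False using c(1)[OF j0] r by simp
    qed
    then obtain J0 where J0: "J0 \<subseteq> J'" "card J0 = n + 1" by (meson less_imp_le obtain_subset_with_card_n)
    have fJ0: "finite J0" using J0 fJ' finite_subset by blast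
    have cD: "card (J' - J0) = card J' - (n + 1)" using J0 fJ' fJ0 by (simp add: card_Diff_subset)
    have "card (J' - {j0}) \<le> card ({} :: unit set) + card (J' - J0)"
    proof (rule card_indep_le[of "J' - {j0}" "{} :: unit set" "J' - J0" w a i "{}" "J' - {j0}" "\<lambda>_ _. 0" i])
      show "card (J' - J0) < k" using cD cJ' \<open>n + 1 < card J'\<close> by simp
      fix y j assume y: "\<And>f. f \<in> J' - J0 \<Longrightarrow> dot k (i f) y = 0" and j: "j \<in> J' - {j0}"
      have "(\<Sum>j\<in>J0. (c j * dot k (i j) y) * a j t) = 0" if t: "t < n + 1" for t
      proof -
        have "0 = dot k (\<lambda>r. \<Sum>j\<in>J'. (c j * a j t) * i j r) y"
          by (rule dot_zero_left[symmetric]) (use rel[OF t] in \<open>simp add: algebra_simps\<close>)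
        also have "\<dots> = (\<Sum>j\<in>J'. c j * a j t * dot k (i j) y)" by (rule dot_sum_left)
        also have "\<dots> = (\<Sum>j\<in>J0. c j * a j t * dot k (i j) y)"
          using J0(1) fJ' y by (intro sum.mono_neutral_right) auto
        finally show ?thesis by (simp add: algebra_simps)
      qed
      then have "\<forall>j\<in>J0. c j * dot k (i j) y = 0"
        using indep_onD[OF nc[of J0], of "\<lambda>j. c j * dot k (i j) y"] J0 J'(1) by simp
      then show "dot k (i j) y = 0" using y j c(1) J0(1) by (cases "j \<in> J0") auto
    qed (use fJ' k w(1) J'(1) ind j0 in auto)
    then show False using cD card_Diff_singleton[OF j0] n \<open>n + 1 < card J'\<close> by simp
  qed
  have "\<forall>l<n + k. \<xi> l = 0" if \<xi>: "\<And>j. j \<in> J \<Longrightarrow> dot (n + k) (w j) \<xi> = 0" for \<xi>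
  proof -
    have indJ: "indep_on (n + k) (J - {j0}) w" using ind[OF j0] \<open>J' = J\<close> by simp
    obtain L where L: "L \<subseteq> {..<n + k}" "card L + card (J - {j0}) \<le> card {..<n + k}"
      "\<forall>\<xi>. (\<forall>j\<in>J - {j0}. (\<Sum>l<n + k. w j l * \<xi> l) = 0) \<and> (\<forall>l\<in>L. \<xi> l = 0) \<longrightarrow> (\<forall>l\<in>{..<n + k}. \<xi> l = 0)"
      using independent_family_complement[of "J - {j0}" "{..<n + k}" w] indJ fin by (auto simp: indep_on_def)
    \<comment> \<open>Without one member the circuit consists of \<open>n + k\<close> independent
      vectors, so no coordinate condition remains.\<close>
    have "L = {}" using L(1,2) card j0 \<open>J' = J\<close> card_Diff_singleton[of j0 J] finite_subset[OF L(1)] by simp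
    then show ?thesis using L(3) \<xi> by (auto simp: dot_def)
  qed
  then show ?thesis using that[of c] c \<open>J' = J\<close> by blast
qed

end

section \<open>Forms and regular functions\<close>

lemma proj_space_iff: "x \<in> proj_space n \<longleftrightarrow> x \<in> carrier_vec (n + 1) \<and> x \<noteq> 0\<^sub>v (n + 1)"
  by (simp add: proj_space_def)

lemma proj_space_scale: "x \<in> proj_space n \<Longrightarrow> c \<noteq> 0 \<Longrightarrow> c \<cdot>\<^sub>v x \<in> proj_space n"
proof -
  assume x: "x \<in> proj_space n" and c: "c \<noteq> 0"
  have "x = (1 / c) \<cdot>\<^sub>v (c \<cdot>\<^sub>v x)" using c by (simp add: smult_smult_assoc)
  then show ?thesis using x by (auto simp: proj_space_iff)
qed

lemma proj_space_coord:
  assumes "x \<in> proj_space n"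
  obtains i where "i \<le> n" "x $ i \<noteq> 0"
proof -
  have "\<exists>i\<le>n. x $ i \<noteq> 0"
  proof (rule ccontr)
    assume "\<not> ?thesis"
    then have "x = 0\<^sub>v (n + 1)" using assms by (intro eq_vecI) (auto simp: proj_space_iff)
    then show False using assms by (simp add: proj_space_iff)
  qed
  then show thesis using that by blast
qed

lemma form_const: "form n 0 (\<lambda>_. c)"
  by (simp add: form_def poly_fun.const)

lemma form_mult: "form n a p \<Longrightarrow> form n b q \<Longrightarrow> form n (a + b) (\<lambda>x. p x * q x)"
  by (auto simp: form_def power_add intro: poly_fun.mult)

lemma form_add: "form n a p \<Longrightarrow> form n a q \<Longrightarrow> form n a (\<lambda>x. p x + q x)"
  by (auto simp: form_def distrib_left intro: poly_fun.add)

lemma form_coord: "i \<le> n \<Longrightarrow> form n 1 (\<lambda>x. x $ i)"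
  by (auto simp: form_def intro: poly_fun.coord)

lemma form_zero: "form n a (\<lambda>_. 0)"
  by (simp add: form_def poly_fun.const)

lemma form_scale: "form n a p \<Longrightarrow> form n a (\<lambda>x. c * p x)"
  using form_mult[OF form_const] by fastforce

lemma form_sum: "(\<And>j. j \<in> J \<Longrightarrow> form n a (p j)) \<Longrightarrow> form n a (\<lambda>x. \<Sum>j\<in>J. p j x)"
  by (induction J rule: infinite_finite_induct) (auto intro: form_zero form_add)

lemma form_prod: "(\<And>j. j \<in> J \<Longrightarrow> form n 1 (p j)) \<Longrightarrow> form n (card J) (\<lambda>x. \<Prod>j\<in>J. p j x)"
proof (induction J rule: infinite_finite_induct)
  case (insert j J)
  then show ?case using form_mult[of n 1 "p j" "card J"] by simp
qed (auto intro: form_const)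

definition linform :: "nat \<Rightarrow> (nat \<Rightarrow> complex) \<Rightarrow> complex vec \<Rightarrow> complex" where
  "linform n a x = (\<Sum>i<n + 1. a i * x $ i)"

lemma form_linform: "form n 1 (linform n a)"
  unfolding linform_def by (intro form_sum form_scale form_coord) auto

section \<open>Zariski open sets\<close>

lemma zariski_open_sub: "zariski_open n U \<Longrightarrow> U \<subseteq> proj_space n"
  by (auto simp: zariski_open_def)

lemma zariski_open_nonzero: "form n d p \<Longrightarrow> zariski_open n {x \<in> proj_space n. p x \<noteq> 0}"
  unfolding zariski_open_def by (rule exI[of _ "{p}"]) auto

lemma zariski_open_proj_space: "zariski_open n (proj_space n)"
  using zariski_open_nonzero[OF form_const[of n 1]] by simp

lemma zariski_open_Int:
  assumes "zariski_open n U" "zariski_open n V"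
  shows "zariski_open n (U \<inter> V)"
proof -
  obtain F G where F: "\<forall>p\<in>F. \<exists>d. form n d p" "U = {x \<in> proj_space n. \<exists>p\<in>F. p x \<noteq> 0}"
    and G: "\<forall>p\<in>G. \<exists>d. form n d p" "V = {x \<in> proj_space n. \<exists>p\<in>G. p x \<noteq> 0}"
    using assms unfolding zariski_open_def by blast
  show ?thesis unfolding zariski_open_def
  proof (intro exI[of _ "(\<lambda>(p, q) x. p x * q x) ` (F \<times> G)"] conjI)
    show "\<forall>p\<in>(\<lambda>(p, q) x. p x * q x) ` (F \<times> G). \<exists>d. form n d p"
      using F(1) G(1) form_mult by fastforce
    show "U \<inter> V = {x \<in> proj_space n. \<exists>p\<in>(\<lambda>(p, q) x. p x * q x) ` (F \<times> G). p x \<noteq> 0}"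
      unfolding F(2) G(2) by auto
  qed
qed

lemma zariski_open_INT:
  assumes "finite J" "\<And>j. j \<in> J \<Longrightarrow> zariski_open n (U j)"
  shows "zariski_open n (proj_space n \<inter> (\<Inter>j\<in>J. U j))"
  using assms
proof (induction J rule: finite_induct)
  case empty
  then show ?case by (simp add: zariski_open_proj_space)
next
  case (insert j J)
  have "proj_space n \<inter> (\<Inter>j\<in>insert j J. U j) = U j \<inter> (proj_space n \<inter> (\<Inter>j\<in>J. U j))" by auto
  then show ?case using insert zariski_open_Int by simp
qed

lemma zariski_open_point:
  assumes "zariski_open n U" "x \<in> U"
  obtains h d where "form n d h" "h x \<noteq> 0" "\<And>y. y \<in> proj_space n \<Longrightarrow> h y \<noteq> 0 \<Longrightarrow> y \<in> U"
  using assms unfolding zariski_open_def by blast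

lemma zariski_open_scale:
  assumes "zariski_open n U" "x \<in> U" "c \<noteq> 0"
  shows "c \<cdot>\<^sub>v x \<in> U"
proof -
  obtain h d where h: "form n d h" "h x \<noteq> 0" "\<And>y. y \<in> proj_space n \<Longrightarrow> h y \<noteq> 0 \<Longrightarrow> y \<in> U"
    using zariski_open_point[OF assms(1,2)] by blast
  have x: "x \<in> proj_space n" using assms zariski_open_sub by blast
  then have "h (c \<cdot>\<^sub>v x) = c ^ d * h x" using h(1) by (simp add: form_def proj_space_iff)
  then show ?thesis using h(2,3) proj_space_scale[OF x assms(3)] assms(3) by simp
qed

section \<open>Regular functions\<close>

lemma regular_on_cong:
  assumes "regular_on n d A f" "\<And>x. x \<in> A \<Longrightarrow> f x = g x"
  shows "regular_on n d A g"
  using assms unfolding regular_on_def by (metis IntD2)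

definition quotient_near :: "nat \<Rightarrow> int \<Rightarrow> complex vec set \<Rightarrow> (complex vec \<Rightarrow> complex) \<Rightarrow> complex vec \<Rightarrow> bool" where
  "quotient_near n d A f x \<longleftrightarrow> (\<exists>U p q a b. zariski_open n U \<and> x \<in> U \<and> form n a p \<and> form n b q \<and>
     int a - int b = d \<and> (\<forall>y\<in>U \<inter> A. q y \<noteq> 0 \<and> f y = p y / q y))"

lemma regular_onI:
  assumes "\<And>x. x \<in> A \<Longrightarrow> quotient_near n d A f x"
  shows "regular_on n d A f"
  using assms unfolding regular_on_def quotient_near_def by blast

lemma regular_quotientI:
  assumes "zariski_open n U" "x \<in> U" "form n a p" "form n b q" "int a - int b = d"
    and "\<And>y. y \<in> U \<Longrightarrow> y \<in> A \<Longrightarrow> q y \<noteq> 0 \<and> f y = p y / q y"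
  shows "quotient_near n d A f x"
  unfolding quotient_near_def
  by (rule exI[of _ U], rule exI[of _ p], rule exI[of _ q], rule exI[of _ a], rule exI[of _ b])
    (use assms in simp)

lemma regular_on_form:
  assumes "form n a p" "A \<subseteq> proj_space n"
  shows "regular_on n (int a) A p"
proof (rule regular_onI)
  fix x assume "x \<in> A"
  then show "quotient_near n (int a) A p x"
    using assms form_const[of n 1] zariski_open_proj_space[of n]
    by (intro regular_quotientI[of n "proj_space n" x a p 0 "\<lambda>_. 1"]) auto
qed

lemma regular_on_const: "A \<subseteq> proj_space n \<Longrightarrow> regular_on n 0 A (\<lambda>_. c)"
  using regular_on_form[OF form_const] by fastforce

lemma regular_on_linform: "A \<subseteq> proj_space n \<Longrightarrow> regular_on n 1 A (linform n a)"
  using regular_on_form[OF form_linform] by fastforce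

lemma regular_on_coord: "A \<subseteq> proj_space n \<Longrightarrow> i \<le> n \<Longrightarrow> regular_on n 1 A (\<lambda>x. x $ i)"
  using regular_on_form[OF form_coord] by fastforce

lemma regular_onE:
  assumes "regular_on n d A f" "x \<in> A"
  obtains U p q a b where "zariski_open n U" "x \<in> U" "form n a p" "form n b q" "int a - int b = d"
    "\<And>y. y \<in> U \<Longrightarrow> y \<in> A \<Longrightarrow> q y \<noteq> 0" "\<And>y. y \<in> U \<Longrightarrow> y \<in> A \<Longrightarrow> f y = p y / q y"
  using assms unfolding regular_on_def by (metis IntI)

lemma regular_on_subset:
  assumes "regular_on n d A f" "A' \<subseteq> A"
  shows "regular_on n d A' f"
proof (rule regular_onI)
  fix x assume "x \<in> A'"
  then have "x \<in> A" using assms by blast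
  then obtain U p q a b where 1: "zariski_open n U" "x \<in> U" "form n a p" "form n b q" "int a - int b = d"
    "\<And>y. y \<in> U \<Longrightarrow> y \<in> A \<Longrightarrow> q y \<noteq> 0" "\<And>y. y \<in> U \<Longrightarrow> y \<in> A \<Longrightarrow> f y = p y / q y"
    using regular_onE[OF assms(1)] by metis
  show "quotient_near n d A' f x"
    by (rule regular_quotientI[OF 1(1-5)]) (use 1(6,7) assms(2) in blast)
qed

lemma regular_on_mult:
  assumes "regular_on n d A f" "regular_on n e A g"
  shows "regular_on n (d + e) A (\<lambda>x. f x * g x)"
proof (rule regular_onI)
  fix x assume x: "x \<in> A"
  obtain U p q a b where 1: "zariski_open n U" "x \<in> U" "form n a p" "form n b q" "int a - int b = d"
    "\<And>y. y \<in> U \<Longrightarrow> y \<in> A \<Longrightarrow> q y \<noteq> 0" "\<And>y. y \<in> U \<Longrightarrow> y \<in> A \<Longrightarrow> f y = p y / q y"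
    using regular_onE[OF assms(1) x] by metis
  obtain U' p' q' a' b' where 2: "zariski_open n U'" "x \<in> U'" "form n a' p'" "form n b' q'" "int a' - int b' = e"
    "\<And>y. y \<in> U' \<Longrightarrow> y \<in> A \<Longrightarrow> q' y \<noteq> 0" "\<And>y. y \<in> U' \<Longrightarrow> y \<in> A \<Longrightarrow> g y = p' y / q' y"
    using regular_onE[OF assms(2) x] by metis
  show "quotient_near n (d + e) A (\<lambda>x. f x * g x) x"
    by (rule regular_quotientI[OF zariski_open_Int[OF 1(1) 2(1)] _ form_mult[OF 1(3) 2(3)] form_mult[OF 1(4) 2(4)]])
      (use 1 2 in auto)
qed

lemma regular_on_add:
  assumes "regular_on n d A f" "regular_on n d A g"
  shows "regular_on n d A (\<lambda>x. f x + g x)"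
proof (rule regular_onI)
  fix x assume x: "x \<in> A"
  obtain U p q a b where 1: "zariski_open n U" "x \<in> U" "form n a p" "form n b q" "int a - int b = d"
    "\<And>y. y \<in> U \<Longrightarrow> y \<in> A \<Longrightarrow> q y \<noteq> 0" "\<And>y. y \<in> U \<Longrightarrow> y \<in> A \<Longrightarrow> f y = p y / q y"
    using regular_onE[OF assms(1) x] by metis
  obtain U' p' q' a' b' where 2: "zariski_open n U'" "x \<in> U'" "form n a' p'" "form n b' q'" "int a' - int b' = d"
    "\<And>y. y \<in> U' \<Longrightarrow> y \<in> A \<Longrightarrow> q' y \<noteq> 0" "\<And>y. y \<in> U' \<Longrightarrow> y \<in> A \<Longrightarrow> g y = p' y / q' y"
    using regular_onE[OF assms(2) x] by metis
  have "a' + b = a + b'" using 1(5) 2(5) by linarith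
  then have F: "form n (a + b') (\<lambda>x. p x * q' x + p' x * q x)"
    using form_add[OF form_mult[OF 1(3) 2(4)], of "\<lambda>x. p' x * q x"] form_mult[OF 2(3) 1(4)] by simp
  show "quotient_near n d A (\<lambda>x. f x + g x) x"
    by (rule regular_quotientI[OF zariski_open_Int[OF 1(1) 2(1)] _ F form_mult[OF 1(4) 2(4)]])
      (use 1 2 in \<open>auto simp: add_frac_eq\<close>)
qed

lemma regular_on_inverse:
  assumes "regular_on n d A f" "\<And>x. x \<in> A \<Longrightarrow> f x \<noteq> 0"
  shows "regular_on n (- d) A (\<lambda>x. 1 / f x)"
proof (rule regular_onI)
  fix x assume x: "x \<in> A"
  obtain U p q a b where 1: "zariski_open n U" "x \<in> U" "form n a p" "form n b q" "int a - int b = d"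
    "\<And>y. y \<in> U \<Longrightarrow> y \<in> A \<Longrightarrow> q y \<noteq> 0" "\<And>y. y \<in> U \<Longrightarrow> y \<in> A \<Longrightarrow> f y = p y / q y"
    using regular_onE[OF assms(1) x] by metis
  have "p y \<noteq> 0" if "y \<in> U \<inter> A" for y using 1(7)[of y] assms(2)[of y] that by auto
  then show "quotient_near n (- d) A (\<lambda>x. 1 / f x) x"
    using 1 by (intro regular_quotientI[of n U x b q a p]) auto
qed

lemma regular_on_divide:
  assumes "regular_on n d A f" "regular_on n e A g" "\<And>x. x \<in> A \<Longrightarrow> g x \<noteq> 0"
  shows "regular_on n (d - e) A (\<lambda>x. f x / g x)"
  using regular_on_mult[OF assms(1) regular_on_inverse[OF assms(2,3)]] by simp

lemma regular_on_zero: "A \<subseteq> proj_space n \<Longrightarrow> regular_on n d A (\<lambda>_. 0)"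
proof (rule regular_onI)
  fix x assume "A \<subseteq> proj_space n" "x \<in> A"
  then have x: "x \<in> proj_space n" by auto
  obtain i where i: "i \<le> n" "x $ i \<noteq> 0" using proj_space_coord[OF x] .
  \<comment> \<open>For any \<open>d\<close>, also negative, zero is \<open>0 / x_i ^ b\<close> with
    the numerator counted as a form of degree \<open>a\<close>.\<close>
  obtain a b where ab: "int a - int b = d" by (rule int_diff_cases[of d]) auto
  have f: "form n b (\<lambda>x. (x $ i) ^ b)" using form_prod[of "{..<b}" n "\<lambda>_ x. x $ i"] form_coord[of i n] i by simp
  have "zariski_open n {x \<in> proj_space n. x $ i \<noteq> 0}" using zariski_open_nonzero[OF form_coord[of i n]] i by simp
  then show "quotient_near n d A (\<lambda>_. 0) x"
    using f ab i x form_zero[of n a]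
    by (intro regular_quotientI[of n "{x \<in> proj_space n. x $ i \<noteq> 0}" x a "\<lambda>_. 0" b "\<lambda>x. (x $ i) ^ b"]) auto
qed

lemma regular_on_sum:
  assumes "A \<subseteq> proj_space n" "\<And>j. j \<in> J \<Longrightarrow> regular_on n d A (f j)"
  shows "regular_on n d A (\<lambda>x. \<Sum>j\<in>J. f j x)"
  using assms(2) by (induction J rule: infinite_finite_induct)
    (auto intro: regular_on_zero[OF assms(1)] regular_on_add)

lemma regular_on_mult0:
  "regular_on n 0 A f \<Longrightarrow> regular_on n d A g \<Longrightarrow> regular_on n d A (\<lambda>x. f x * g x)"
  using regular_on_mult[of n 0 A f d g] by simp

lemma regular_on_prod:
  assumes "A \<subseteq> proj_space n" "\<And>j. j \<in> J \<Longrightarrow> regular_on n 0 A (f j)"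
  shows "regular_on n 0 A (\<lambda>x. \<Prod>j\<in>J. f j x)"
  using assms(2) by (induction J rule: infinite_finite_induct)
    (auto intro: regular_on_const[OF assms(1)] regular_on_mult0)

lemma regular_on_scale:
  "A \<subseteq> proj_space n \<Longrightarrow> regular_on n d A f \<Longrightarrow> regular_on n d A (\<lambda>x. c * f x)"
  by (rule regular_on_mult0[OF regular_on_const])

lemma regular_on_diff:
  assumes "A \<subseteq> proj_space n" "regular_on n d A f" "regular_on n d A g"
  shows "regular_on n d A (\<lambda>x. f x - g x)"
  using regular_on_add[OF assms(2) regular_on_scale[OF assms(1,3), of "-1"]] by simp

lemma regular_on_local:
  assumes "\<And>x. x \<in> A \<Longrightarrow> \<exists>V. zariski_open n V \<and> x \<in> V \<and> regular_on n d (V \<inter> A) f"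
  shows "regular_on n d A f"
proof (rule regular_onI)
  fix x assume x: "x \<in> A"
  obtain V where V: "zariski_open n V" "x \<in> V" "regular_on n d (V \<inter> A) f" using assms[OF x] by blast
  obtain U p q a b where 1: "zariski_open n U" "x \<in> U" "form n a p" "form n b q" "int a - int b = d"
    "\<And>y. y \<in> U \<Longrightarrow> y \<in> V \<inter> A \<Longrightarrow> q y \<noteq> 0" "\<And>y. y \<in> U \<Longrightarrow> y \<in> V \<inter> A \<Longrightarrow> f y = p y / q y"
    using regular_onE[OF V(3), of x] x V(2) by (metis IntI)
  then show "quotient_near n d A f x"
    by (intro regular_quotientI[OF zariski_open_Int[OF 1(1) V(1)] _ 1(3,4)]) (use 1 V in auto)
qed

lemma regular_on_nonzero_nbhd:
  assumes "regular_on n d U f" "zariski_open n U" "x \<in> U" "f x \<noteq> 0"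
  obtains V where "zariski_open n V" "x \<in> V" "V \<subseteq> U" "\<And>y. y \<in> V \<Longrightarrow> f y \<noteq> 0"
proof -
  obtain U' p q a b where 1: "zariski_open n U'" "x \<in> U'" "form n a p" "form n b q" "int a - int b = d"
    "\<And>y. y \<in> U' \<Longrightarrow> y \<in> U \<Longrightarrow> q y \<noteq> 0" "\<And>y. y \<in> U' \<Longrightarrow> y \<in> U \<Longrightarrow> f y = p y / q y"
    using regular_onE[OF assms(1,3)] by metis
  have px: "p x \<noteq> 0" using 1(7)[OF 1(2) assms(3)] assms(4) by auto
  have op: "zariski_open n ({y \<in> proj_space n. p y \<noteq> 0} \<inter> (U' \<inter> U))"
    by (intro zariski_open_Int zariski_open_nonzero[OF 1(3)] 1(1) assms(2))
  show thesis
    by (rule that[OF op]) (use 1 px assms zariski_open_sub[OF assms(2)] in auto)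
qed

section \<open>Homogeneity, restriction to lines, global sections\<close>

lemma regular_on_homogeneous:
  assumes "regular_on n d A f" "x \<in> A" "c \<cdot>\<^sub>v x \<in> A" "c \<noteq> 0" "A \<subseteq> proj_space n"
  shows "f (c \<cdot>\<^sub>v x) = c powi d * f x"
proof -
  obtain U p q a b where 1: "zariski_open n U" "x \<in> U" "form n a p" "form n b q" "int a - int b = d"
    "\<And>y. y \<in> U \<Longrightarrow> y \<in> A \<Longrightarrow> q y \<noteq> 0" "\<And>y. y \<in> U \<Longrightarrow> y \<in> A \<Longrightarrow> f y = p y / q y"
    using regular_onE[OF assms(1,2)] by metis
  have x: "x \<in> carrier_vec (n + 1)" using assms by (auto simp: proj_space_iff)
  have "f (c \<cdot>\<^sub>v x) = p (c \<cdot>\<^sub>v x) / q (c \<cdot>\<^sub>v x)" using 1 zariski_open_scale assms by blast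
  also have "\<dots> = (c ^ a * p x) / (c ^ b * q x)" using 1(3,4) x by (simp add: form_def)
  also have "\<dots> = c powi d * (p x / q x)"
    using assms(4) by (simp add: 1(5)[symmetric] power_int_diff)
  finally show ?thesis using 1 assms by simp
qed

lemma poly_fun_line:
  assumes "p \<in> poly_fun n" "x \<in> carrier_vec (n + 1)" "y \<in> carrier_vec (n + 1)"
  shows "\<exists>P. \<forall>t. p (x + t \<cdot>\<^sub>v y) = poly P t"
  using assms(1)
proof (induction rule: poly_fun.induct)
  case (const c)
  show ?case by (rule exI[of _ "[:c:]"]) simp
next
  case (coord i)
  show ?case by (rule exI[of _ "[:x $ i, y $ i:]"]) (use coord assms in \<open>auto simp: algebra_simps\<close>)
next
  case (add p q)
  then obtain P Q where "\<forall>t. p (x + t \<cdot>\<^sub>v y) = poly P t" "\<forall>t. q (x + t \<cdot>\<^sub>v y) = poly Q t" by blast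
  then show ?case by (intro exI[of _ "P + Q"]) simp
next
  case (mult p q)
  then obtain P Q where "\<forall>t. p (x + t \<cdot>\<^sub>v y) = poly P t" "\<forall>t. q (x + t \<cdot>\<^sub>v y) = poly Q t" by blast
  then show ?case by (intro exI[of _ "P * Q"]) simp
qed

text \<open>Density of a non-empty open set. On the line from \<open>x\<close> to a point
  \<open>x1\<close> with \<open>g x1 \<noteq> 0\<close> the local numerator is a polynomial in
  \<open>t\<close> that vanishes wherever \<open>g\<close>, \<open>h\<close> and a coordinate do
  not; these are non-zero polynomials, so it vanishes identically, also at \<open>x\<close>.\<close>

lemma regular_on_zero_extend:
  assumes f: "regular_on n d U f" and U: "zariski_open n U" and g: "form n e g"
    and x1: "x1 \<in> proj_space n" "g x1 \<noteq> 0"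
    and zero: "\<And>x. x \<in> U \<Longrightarrow> g x \<noteq> 0 \<Longrightarrow> f x = 0" and x: "x \<in> U"
  shows "f x = 0"
proof -
  obtain U' p q a b where 1: "zariski_open n U'" "x \<in> U'" "form n a p" "form n b q" "int a - int b = d"
    "\<And>y. y \<in> U' \<Longrightarrow> y \<in> U \<Longrightarrow> q y \<noteq> 0" "\<And>y. y \<in> U' \<Longrightarrow> y \<in> U \<Longrightarrow> f y = p y / q y"
    using regular_onE[OF f x] by metis
  obtain h c where h: "form n c h" "h x \<noteq> 0" "\<And>y. y \<in> proj_space n \<Longrightarrow> h y \<noteq> 0 \<Longrightarrow> y \<in> U' \<inter> U"
    using zariski_open_point[OF zariski_open_Int[OF 1(1) U], of x] 1(2) x by blast
  have xp: "x \<in> proj_space n" using x U zariski_open_sub by blast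
  obtain i where i: "i \<le> n" "x $ i \<noteq> 0" using proj_space_coord[OF xp] .
  define v where "v = x1 - x"
  have v: "v \<in> carrier_vec (n + 1)" "x \<in> carrier_vec (n + 1)" using x1 xp by (auto simp: v_def proj_space_iff)
  have line: "\<exists>P. \<forall>t. r (x + t \<cdot>\<^sub>v v) = poly P t" if "form n j r" for r j
    using poly_fun_line[of r n x v] that v by (simp add: form_def)
  have l0: "x + 0 \<cdot>\<^sub>v v = x" using v by auto
  have l1: "x + 1 \<cdot>\<^sub>v v = x1" using v x1 by (auto simp: v_def proj_space_iff)
  have l1': "x + v = x1" using v x1 by (auto simp: v_def proj_space_iff)
  \<comment> \<open>\<open>C\<close> follows a coordinate that is non-zero at \<open>x\<close>; it
    keeps the points considered away from the zero vector.\<close>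
  obtain P H Q C where P: "\<And>t. p (x + t \<cdot>\<^sub>v v) = poly P t" "\<And>t. h (x + t \<cdot>\<^sub>v v) = poly H t"
    "\<And>t. g (x + t \<cdot>\<^sub>v v) = poly Q t" "\<And>t. (x + t \<cdot>\<^sub>v v) $ i = poly C t"
    using line[OF 1(3)] line[OF h(1)] line[OF g] line[OF form_coord[OF i(1)]] by metis
  have nz: "H \<noteq> 0" "Q \<noteq> 0" "C \<noteq> 0"
    using P(2)[of 0] h(2) P(3)[of 1] x1(2) P(4)[of 0] i(2) by (auto simp: l0 l1 l1')
  have "poly (P * (H * Q * C)) t = 0" for t
  proof (cases "poly (H * Q * C) t = 0")
    case False
    let ?z = "x + t \<cdot>\<^sub>v v"
    have "?z $ i \<noteq> 0" "h ?z \<noteq> 0" "g ?z \<noteq> 0" using False P by auto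
    moreover have "?z \<in> carrier_vec (n + 1)" using v by auto
    moreover have "?z \<noteq> 0\<^sub>v (n + 1)" using \<open>?z $ i \<noteq> 0\<close> i(1) by (metis add.commute index_zero_vec(1) less_Suc_eq_le plus_1_eq_Suc)
    ultimately have z: "?z \<in> U'" "?z \<in> U" "g ?z \<noteq> 0" using h(3)[of ?z] by (auto simp: proj_space_iff)
    then have "p ?z = 0" using zero[of ?z] 1(6,7)[of ?z] by auto
    then show ?thesis by (simp add: P)
  qed simp
  then have "P * (H * Q * C) = 0" using poly_all_0_iff_0 by blast
  then have "P = 0" using nz by simp
  then have "p x = 0" using P(1)[of 0] l0 by simp
  then show ?thesis using 1(2,7) x by simp
qed

text \<open>The local quotients define one rational function. In a fraction \<open>P / Q\<close>
  with a denominator of least degree a zero of \<open>Q\<close> would be a zero of \<open>P\<close>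
  as well and could be cancelled, so \<open>Q\<close> has no zero and is constant.\<close>

lemma regular_on_line:
  assumes f: "regular_on n d A f" and A: "A \<subseteq> proj_space n"
    and xy: "x \<in> carrier_vec (n + 1)" "y \<in> carrier_vec (n + 1)" and line: "\<And>t. x + t \<cdot>\<^sub>v y \<in> A"
  shows "\<exists>P. \<forall>t. f (x + t \<cdot>\<^sub>v y) = poly P t"
proof -
  have loc: "\<exists>P Q H. poly H s \<noteq> 0 \<and> (\<forall>t. poly H t \<noteq> 0 \<longrightarrow> poly Q t \<noteq> 0 \<and> f (x + t \<cdot>\<^sub>v y) * poly Q t = poly P t)" for s
  proof -
    obtain U p q a b where 1: "zariski_open n U" "x + s \<cdot>\<^sub>v y \<in> U" "form n a p" "form n b q" "int a - int b = d"
      "\<And>z. z \<in> U \<Longrightarrow> z \<in> A \<Longrightarrow> q z \<noteq> 0" "\<And>z. z \<in> U \<Longrightarrow> z \<in> A \<Longrightarrow> f z = p z / q z"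
      using regular_onE[OF f line[of s]] by metis
    obtain h c where h: "form n c h" "h (x + s \<cdot>\<^sub>v y) \<noteq> 0" "\<And>y. y \<in> proj_space n \<Longrightarrow> h y \<noteq> 0 \<Longrightarrow> y \<in> U"
      using zariski_open_point[OF 1(1,2)] by blast
    obtain P Q H where P: "\<And>t. p (x + t \<cdot>\<^sub>v y) = poly P t" "\<And>t. q (x + t \<cdot>\<^sub>v y) = poly Q t"
      "\<And>t. h (x + t \<cdot>\<^sub>v y) = poly H t"
      using poly_fun_line[OF _ xy, of p] poly_fun_line[OF _ xy, of q] poly_fun_line[OF _ xy, of h] 1(3,4) h(1)
      unfolding form_def by metis
    have "poly Q t \<noteq> 0 \<and> f (x + t \<cdot>\<^sub>v y) * poly Q t = poly P t" if "poly H t \<noteq> 0" for t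
    proof -
      have "x + t \<cdot>\<^sub>v y \<in> U" using h(3) that P(3) line A by (metis subsetD)
      then show ?thesis using 1(6,7)[OF _ line[of t]] P by auto
    qed
    moreover have "poly H s \<noteq> 0" using h(2) P by simp
    ultimately show ?thesis by blast
  qed
  obtain P0 Q0 H0 where 0: "poly H0 0 \<noteq> 0"
    "\<And>t. poly H0 t \<noteq> 0 \<Longrightarrow> poly Q0 t \<noteq> 0 \<and> f (x + t \<cdot>\<^sub>v y) * poly Q0 t = poly P0 t"
    using loc[of 0] by blast
  have "Q0 \<noteq> 0" using 0 by force
  define S where "S = (\<lambda>(P, Q). Q \<noteq> 0 \<and> P * Q0 = P0 * Q)"
  have "S (P0, Q0)" using \<open>Q0 \<noteq> 0\<close> by (simp add: S_def)
  then obtain PQ where PQ: "S PQ" "\<And>PQ'. S PQ' \<Longrightarrow> degree (snd PQ) \<le> degree (snd PQ')"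
    using arg_min_nat_lemma[of S "(P0, Q0)" "\<lambda>PQ. degree (snd PQ)"] by metis
  obtain P Q where PQeq: "PQ = (P, Q)" by (cases PQ)
  have Q: "Q \<noteq> 0" "P * Q0 = P0 * Q" using PQ(1) by (auto simp: S_def PQeq)
  have key: "poly Q s \<noteq> 0 \<and> f (x + s \<cdot>\<^sub>v y) * poly Q s = poly P s" for s
  proof -
    obtain P1 Q1 H1 where 1: "poly H1 s \<noteq> 0"
      "\<And>t. poly H1 t \<noteq> 0 \<Longrightarrow> poly Q1 t \<noteq> 0 \<and> f (x + t \<cdot>\<^sub>v y) * poly Q1 t = poly P1 t"
      using loc[of s] by blast
    have "poly (H0 * H1 * (P0 * Q1 - P1 * Q0)) t = 0" for t
    proof (cases "poly H0 t = 0 \<or> poly H1 t = 0")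
      case False
      then have "poly P0 t = f (x + t \<cdot>\<^sub>v y) * poly Q0 t" "poly P1 t = f (x + t \<cdot>\<^sub>v y) * poly Q1 t"
        using 0(2)[of t] 1(2)[of t] by auto
      then show ?thesis by simp
    qed auto
    then have "H0 * H1 * (P0 * Q1 - P1 * Q0) = 0" using poly_all_0_iff_0 by blast
    moreover have "H0 \<noteq> 0" "H1 \<noteq> 0" using 0(1) 1(1) by auto
    ultimately have "P0 * Q1 = P1 * Q0" by simp
    then have "Q0 * (P * Q1) = Q0 * (P1 * Q)" using Q(2) by (metis mult.assoc mult.commute)
    then have e: "P * Q1 = P1 * Q" using \<open>Q0 \<noteq> 0\<close> by simp
    have "poly Q s \<noteq> 0"
    proof
      assume Qs: "poly Q s = 0"
      then have "poly P s = 0" using arg_cong[OF e, of "\<lambda>p. poly p s"] 1 by auto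
      then obtain P' Q' where P': "P = [:- s, 1:] * P'" "Q = [:- s, 1:] * Q'"
        using Qs by (auto simp: poly_eq_0_iff_dvd elim!: dvdE)
      have "[:- s, 1:] * (P' * Q0) = [:- s, 1:] * (P0 * Q')" using Q(2) unfolding P' by (simp add: algebra_simps)
      then have "P' * Q0 = P0 * Q'" by (metis mult_cancel_left pCons_eq_0_iff one_neq_zero)
      moreover have "Q' \<noteq> 0" using Q(1) P' by auto
      ultimately have "S (P', Q')" by (simp add: S_def)
      moreover have "degree Q = Suc (degree Q')" using \<open>Q' \<noteq> 0\<close> unfolding P' by (subst degree_mult_eq) auto
      ultimately show False using PQ(2)[of "(P', Q')"] by (simp add: PQeq)
    qed
    moreover have "f (x + s \<cdot>\<^sub>v y) * poly Q s * poly Q1 s = poly P s * poly Q1 s"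
      using arg_cong[OF e, of "\<lambda>p. poly p s"] 1(2)[OF 1(1)] by (simp add: mult.assoc mult.left_commute)
    ultimately show ?thesis using 1(2)[OF 1(1)] by simp
  qed
  have "degree Q = 0"
    using fundamental_theorem_of_algebra[of Q] key constant_degree by blast
  then obtain c where c: "Q = [:c:]" by (metis degree_eq_zeroE)
  have "\<forall>t. f (x + t \<cdot>\<^sub>v y) = poly (smult (1 / c) P) t"
    using key c by (auto simp: field_simps)
  then show ?thesis by blast
qed

text \<open>\<open>P\<close> is \<open>t ^ d\<close> times a polynomial in \<open>1 / t\<close>, so
  it has no terms beyond \<open>t ^ d\<close>.\<close>

lemma degree_le_of_reflection:
  assumes "\<And>t. t \<noteq> 0 \<Longrightarrow> poly P t = t ^ d * poly P' (1 / t)"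
  shows "degree (P :: complex poly) \<le> d"
proof (cases "P = 0")
  case False
  define e where "e = degree P'"
  \<comment> \<open>The factor \<open>[:0, 1:]\<close> makes the identity hold at
    \<open>t = 0\<close> as well, where the assumption is silent.\<close>
  have "poly (P * monom 1 e * [:0, 1:] - monom 1 d * reflect_poly P' * [:0, 1:]) t = 0" for t
  proof (cases "t = 0")
    case False
    then have "poly (reflect_poly P') t = t ^ e * poly P' (1 / t)"
      using poly_reflect_poly_nz[of t P'] by (simp add: e_def inverse_eq_divide)
    then show ?thesis using assms[OF False] by (simp add: poly_monom)
  qed simp
  then have "P * monom 1 e * [:0, 1:] - monom 1 d * reflect_poly P' * [:0, 1:] = 0" using poly_all_0_iff_0 by blast
  then have eq: "P * monom 1 e = monom 1 d * reflect_poly P'" by simp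
  have "degree P + e = degree (P * monom 1 e)" using False by (simp add: degree_mult_eq degree_monom_eq)
  also have "\<dots> = degree (monom 1 d * reflect_poly P')" by (simp only: eq)
  also have "\<dots> \<le> d + e"
    unfolding e_def
    by (rule order_trans[OF degree_mult_le]) (simp add: add_mono degree_monom_le degree_reflect_poly_le)
  finally show ?thesis by simp
qed simp

text \<open>\<open>x + t y\<close> and \<open>y + t x\<close> are the two affine charts of a
  projective line; homogeneity of degree \<open>d\<close> glues them, as for sections of
  \<open>O(d)\<close> on the projective line.\<close>

lemma regular_on_line_degree:
  assumes f: "regular_on n (int d) A f" and A: "A \<subseteq> proj_space n"
    and xy: "x \<in> carrier_vec (n + 1)" "y \<in> carrier_vec (n + 1)"
    and line: "\<And>s t. s \<noteq> 0 \<or> t \<noteq> 0 \<Longrightarrow> s \<cdot>\<^sub>v x + t \<cdot>\<^sub>v y \<in> A"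
  obtains P P' where "\<And>t. f (x + t \<cdot>\<^sub>v y) = poly P t" "\<And>t. f (y + t \<cdot>\<^sub>v x) = poly P' t"
    "degree P \<le> d" "degree P' \<le> d" "\<And>t. t \<noteq> 0 \<Longrightarrow> poly P t = t ^ d * poly P' (1 / t)"
proof -
  have l: "x + t \<cdot>\<^sub>v y \<in> A" "y + t \<cdot>\<^sub>v x \<in> A" for t
    using line[of 1 t] line[of t 1] xy by (auto simp: comm_add_vec[of y "n + 1"])
  obtain P P' where P: "\<And>t. f (x + t \<cdot>\<^sub>v y) = poly P t" "\<And>t. f (y + t \<cdot>\<^sub>v x) = poly P' t"
    using regular_on_line[OF f A xy l(1)] regular_on_line[OF f A xy(2,1) l(2)] by blast
  have *: "f (u + t \<cdot>\<^sub>v v) = t ^ d * f (v + (1 / t) \<cdot>\<^sub>v u)"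
    if t: "t \<noteq> 0" and uv: "u \<in> carrier_vec (n + 1)" "v \<in> carrier_vec (n + 1)"
      and A': "u + t \<cdot>\<^sub>v v \<in> A" "v + (1 / t) \<cdot>\<^sub>v u \<in> A" for t u v
  proof -
    have "u + t \<cdot>\<^sub>v v = t \<cdot>\<^sub>v (v + (1 / t) \<cdot>\<^sub>v u)"
      using t uv by (intro eq_vecI) (auto simp: algebra_simps)
    then show ?thesis using regular_on_homogeneous[OF f A'(2) _ t A] A'(1) by simp
  qed
  have e1: "poly P t = t ^ d * poly P' (1 / t)" if "t \<noteq> 0" for t
    using *[OF that xy l] P by simp
  have e2: "poly P' t = t ^ d * poly P (1 / t)" if "t \<noteq> 0" for t
    using *[OF that xy(2,1) l(2,1)] P by simp
  show thesis by (rule that[OF P degree_le_of_reflection[OF e1] degree_le_of_reflection[OF e2] e1])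
qed

lemma regular_on_line_const:
  assumes "regular_on n 0 A f" "A \<subseteq> proj_space n"
    and xy: "x \<in> carrier_vec (n + 1)" "y \<in> carrier_vec (n + 1)"
    and line: "\<And>s t. s \<noteq> 0 \<or> t \<noteq> 0 \<Longrightarrow> s \<cdot>\<^sub>v x + t \<cdot>\<^sub>v y \<in> A"
  shows "f x = f y"
proof -
  obtain P P' where P: "\<And>t. f (x + t \<cdot>\<^sub>v y) = poly P t" "\<And>t. f (y + t \<cdot>\<^sub>v x) = poly P' t"
    "degree P \<le> 0" "degree P' \<le> 0" "\<And>t. t \<noteq> 0 \<Longrightarrow> poly P t = t ^ 0 * poly P' (1 / t)"
    using regular_on_line_degree[of n 0 A f x y] assms by (metis of_nat_0)
  obtain c c' where c: "P = [:c:]" "P' = [:c':]" using P(3,4) by (metis degree_eq_zeroE le_zero_eq)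
  have "x + 0 \<cdot>\<^sub>v y = x" "y + 0 \<cdot>\<^sub>v x = y" using xy by (auto intro!: eq_vecI)
  then have "f x = c" "f y = c'" using P(1)[of 0] P(2)[of 0] c by auto
  then show ?thesis using P(5)[of 1] c by simp
qed

lemma linear_poly_cases:
  assumes "degree P \<le> 1"
  shows "\<exists>a b. P = [:a, b:]"
proof -
  have "P = [:coeff P 0, coeff P 1:]"
    using assms by (intro poly_eqI) (auto simp: coeff_pCons coeff_eq_0 split: nat.split)
  then show ?thesis by blast
qed

lemma regular_on_line_linear:
  assumes "regular_on n 1 A f" "A \<subseteq> proj_space n"
    and xy: "x \<in> carrier_vec (n + 1)" "y \<in> carrier_vec (n + 1)"
    and line: "\<And>s t. s \<noteq> 0 \<or> t \<noteq> 0 \<Longrightarrow> s \<cdot>\<^sub>v x + t \<cdot>\<^sub>v y \<in> A"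
  shows "f (x + y) = f x + f y"
proof -
  obtain P P' where P: "\<And>t. f (x + t \<cdot>\<^sub>v y) = poly P t" "\<And>t. f (y + t \<cdot>\<^sub>v x) = poly P' t"
    "degree P \<le> 1" "degree P' \<le> 1" "\<And>t. t \<noteq> 0 \<Longrightarrow> poly P t = t ^ 1 * poly P' (1 / t)"
    using regular_on_line_degree[of n 1 A f x y] assms by (metis of_nat_1)
  obtain a b where ab: "P = [:a, b:]" using linear_poly_cases[OF P(3)] by blast
  obtain a' b' where ab': "P' = [:a', b':]" using linear_poly_cases[OF P(4)] by blast
  have "x + 0 \<cdot>\<^sub>v y = x" "y + 0 \<cdot>\<^sub>v x = y" using xy by (auto intro!: eq_vecI)
  then have "f x = a" "f y = a'" using P(1)[of 0] P(2)[of 0] ab ab' by auto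
  moreover have "f (x + y) = a + b" using P(1)[of 1] xy ab by simp
  moreover have "b = a'"
  proof -
    have "a + b = a' + b'" "a - b = b' - a'" using P(5)[of 1] P(5)[of "-1"] by (simp_all add: ab ab')
    then have "(a + b) - (a - b) = (a' + b') - (b' - a')" by simp
    then show ?thesis by simp
  qed
  ultimately show ?thesis by simp
qed

lemma dependent_or_independent:
  assumes "x \<in> carrier_vec m" "y \<in> carrier_vec m" "y \<noteq> 0\<^sub>v m" "\<nexists>c. x = c \<cdot>\<^sub>v y"
    and "s \<noteq> 0 \<or> t \<noteq> (0::complex)"
  shows "s \<cdot>\<^sub>v x + t \<cdot>\<^sub>v y \<noteq> 0\<^sub>v m"
proof
  assume eq: "s \<cdot>\<^sub>v x + t \<cdot>\<^sub>v y = 0\<^sub>v m"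
  have i: "s * x $ i + t * y $ i = 0" if "i < m" for i
    using arg_cong[OF eq, of "\<lambda>v. v $ i"] that assms(1,2) by simp
  show False
  proof (cases "s = 0")
    case True
    then have "t \<noteq> 0" using assms(5) by simp
    then have "y = 0\<^sub>v m" using i True assms(2) by (intro eq_vecI) auto
    then show False using assms by simp
  next
    case False
    have "x = (- t / s) \<cdot>\<^sub>v y"
      using False i assms(1,2) by (intro eq_vecI) (auto simp: field_simps eq_neg_iff_add_eq_0)
    then show False using assms by blast
  qed
qed

text \<open>Two points of a hyperplane span a projective line inside it, where a regular function is
  constant. This makes sections over \<open>H\<close> of a trivial bundle constant vectors.\<close>

lemma regular_on_hyperplane_const:
  assumes f: "regular_on n 0 H f" and H: "hyperplane_eq n a H" and xy: "x \<in> H" "y \<in> H"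
  shows "f x = f y"
proof -
  have H': "H \<subseteq> proj_space n" "H = {x \<in> proj_space n. a \<bullet> x = 0}" "a \<in> carrier_vec (n + 1)"
    using H by (auto simp: hyperplane_eq_def)
  have c: "x \<in> carrier_vec (n + 1)" "y \<in> carrier_vec (n + 1)" "y \<noteq> 0\<^sub>v (n + 1)" "x \<noteq> 0\<^sub>v (n + 1)"
    using xy H' by (auto simp: proj_space_iff)
  show ?thesis
  proof (cases "\<exists>c. x = c \<cdot>\<^sub>v y")
    case True
    then obtain d where d: "x = d \<cdot>\<^sub>v y" by blast
    then have "d \<noteq> 0" using c by auto
    then show ?thesis using regular_on_homogeneous[OF f xy(2) _ _ H'(1), of d] d xy by simp
  next
    case False
    have "s \<cdot>\<^sub>v x + t \<cdot>\<^sub>v y \<in> H" if "s \<noteq> 0 \<or> t \<noteq> 0" for s t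
      using dependent_or_independent[OF c(1,2,3) False that] xy c H'
      by (auto simp: proj_space_iff scalar_prod_add_distrib[of a "n + 1"])
    then show ?thesis using regular_on_line_const[OF f H'(1) c(1,2)] by blast
  qed
qed

text \<open>Restriction to lines gives additivity on independent vectors, homogeneity gives the
  rest; \<open>F\<close> adds the value 0 at the origin so that linearity makes sense on the whole
  space. Applied to the entries of \<open>\<psi>\<close>, this yields the tensor.\<close>

lemma regular_on_proj_space_linear:
  assumes f: "regular_on n 1 (proj_space n) f"
  shows "\<exists>a. \<forall>x\<in>proj_space n. f x = linform n a x"
proof -
  define F where "F x = (if x = 0\<^sub>v (n + 1) then 0 else f x)" for x
  have hom: "F (c \<cdot>\<^sub>v x) = c * F x" if "x \<in> carrier_vec (n + 1)" for c x
  proof (cases "c = 0 \<or> x = 0\<^sub>v (n + 1)")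
    case True
    then show ?thesis using that by (auto simp: F_def)
  next
    case False
    then have x: "x \<in> proj_space n" using that by (simp add: proj_space_iff)
    have cx: "c \<cdot>\<^sub>v x \<in> proj_space n" using proj_space_scale x False by blast
    then show ?thesis using regular_on_homogeneous[OF f x cx] False by (auto simp: F_def proj_space_iff)
  qed
  have add: "F (x + y) = F x + F y" if xy: "x \<in> carrier_vec (n + 1)" "y \<in> carrier_vec (n + 1)" for x y
  proof (cases "y = 0\<^sub>v (n + 1)")
    case True
    then show ?thesis using xy by (simp add: F_def)
  next
    case y: False
    show ?thesis
    proof (cases "\<exists>c. x = c \<cdot>\<^sub>v y")
      case True
      then obtain c where c: "x = c \<cdot>\<^sub>v y" by blast
      then have "x + y = (c + 1) \<cdot>\<^sub>v y" using xy by (simp add: add_smult_distrib_vec)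
      then show ?thesis using hom[OF xy(2), of "c + 1"] hom[OF xy(2), of c] c by (simp add: algebra_simps)
    next
      case False
      have l: "s \<cdot>\<^sub>v x + t \<cdot>\<^sub>v y \<in> proj_space n" if "s \<noteq> 0 \<or> t \<noteq> 0" for s t
        using dependent_or_independent[OF xy y False that] xy by (auto simp: proj_space_iff)
      have "f (x + y) = f x + f y" using regular_on_line_linear[OF f _ xy l] by blast
      moreover have "x + y \<noteq> 0\<^sub>v (n + 1)" "x \<noteq> 0\<^sub>v (n + 1)"
        using l[of 1 1] l[of 1 0] xy by (auto simp: proj_space_iff)
      ultimately show ?thesis using y by (simp add: F_def)
    qed
  qed
  define a where "a t = F (unit_vec (n + 1) t)" for t
  have part: "F (vec (n + 1) (\<lambda>i. if i < m then x $ i else 0)) = (\<Sum>t<m. a t * x $ t)"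
    if "m \<le> n + 1" for m x
    using that
  proof (induction m)
    case 0
    have "vec (n + 1) (\<lambda>i. if i < 0 then x $ i else 0) = 0\<^sub>v (n + 1)" by (intro eq_vecI) auto
    then show ?case by (simp add: F_def)
  next
    case (Suc m)
    have "vec (n + 1) (\<lambda>i. if i < Suc m then x $ i else 0)
        = vec (n + 1) (\<lambda>i. if i < m then x $ i else 0) + x $ m \<cdot>\<^sub>v unit_vec (n + 1) m"
      using Suc.prems by (intro eq_vecI) (auto simp: less_Suc_eq unit_vec_def)
    then show ?case using Suc add hom by (simp add: a_def)
  qed
  have "f x = linform n a x" if x: "x \<in> proj_space n" for x
  proof -
    have "vec (n + 1) (\<lambda>i. if i < n + 1 then x $ i else 0) = x"
      using x by (intro eq_vecI) (auto simp: proj_space_iff)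
    then have "F x = linform n a x" using part[of "n + 1" x] unfolding linform_def by simp
    then show ?thesis using x by (simp add: F_def proj_space_iff)
  qed
  then show ?thesis by blast
qed

section \<open>The tensor of a Steiner bundle\<close>

lemma mat_vec_sum:
  "A \<in> carrier_mat r s \<Longrightarrow> v \<in> carrier_vec s \<Longrightarrow> i < r \<Longrightarrow> (A *\<^sub>v v) $ i = (\<Sum>j<s. A $$ (i, j) * v $ j)"
  by (auto simp: scalar_prod_def atLeast0LessThan intro!: sum.cong)

lemma mat_mult_sum:
  "A \<in> carrier_mat r s \<Longrightarrow> B \<in> carrier_mat s t \<Longrightarrow> i < r \<Longrightarrow> j < t \<Longrightarrow>
    (A * B) $$ (i, j) = (\<Sum>l<s. A $$ (i, l) * B $$ (l, j))"
  by (auto simp: scalar_prod_def atLeast0LessThan intro!: sum.cong)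

lemma regular_on_det:
  assumes A: "A \<subseteq> proj_space n" and M: "\<And>x. x \<in> A \<Longrightarrow> M x \<in> carrier_mat r r"
    and reg: "\<And>i j. i < r \<Longrightarrow> j < r \<Longrightarrow> regular_on n 0 A (\<lambda>x. M x $$ (i, j))"
  shows "regular_on n 0 A (\<lambda>x. det (M x))"
proof -
  have "regular_on n 0 A (\<lambda>x. \<Sum>p\<in>{p. p permutes {0..<r}}. signof p * (\<Prod>i\<in>{0..<r}. M x $$ (i, p i)))"
    by (intro regular_on_sum[OF A] regular_on_scale[OF A] regular_on_prod[OF A] reg)
       (use permutes_in_image in fastforce)+
  then show ?thesis
    by (rule regular_on_cong) (simp add: det_def'[OF M])
qed

locale steiner_bundle =
  fixes n k :: nat and S :: "'j vbundle" and \<phi> :: "unit \<Rightarrow> 'j \<Rightarrow> complex vec \<Rightarrow> complex mat"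
    and \<psi> :: "nat \<Rightarrow> unit \<Rightarrow> complex vec \<Rightarrow> complex mat"
  assumes vector_bundle: "vector_bundle n S"
    and exact: "short_exact n (dual_bundle S) (trivial_bundle n (n + k)) (O1_bundle n k) \<phi> \<psi>"
begin

text \<open>Entries of the inclusion of the dual of \<open>S\<close> into \<open>W\<close> over
  chart \<open>i\<close>; transposed, they describe the quotient map from the dual of
  \<open>W\<close> onto \<open>S\<close>.\<close>

definition F :: "'j \<Rightarrow> complex vec \<Rightarrow> nat \<Rightarrow> nat \<Rightarrow> complex" where
  "F i x l m = \<phi> () i x $$ (l, m)"

lemma chart_open: "i \<in> idx S \<Longrightarrow> zariski_open n (chart S i)"
  using vector_bundle by (simp add: vector_bundle_def)

lemma chart_sub: "i \<in> idx S \<Longrightarrow> chart S i \<subseteq> proj_space n"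
  using chart_open zariski_open_sub by blast

lemma chart_cover:
  assumes "x \<in> proj_space n"
  obtains i where "i \<in> idx S" "x \<in> chart S i"
  using vector_bundle assms unfolding vector_bundle_def by blast

lemma transition_carrier:
  "i \<in> idx S \<Longrightarrow> j \<in> idx S \<Longrightarrow> x \<in> chart S i \<Longrightarrow> x \<in> chart S j \<Longrightarrow>
    transition S i j x \<in> carrier_mat (brank S) (brank S)"
  using vector_bundle by (auto simp: vector_bundle_def regular_mat_def)

lemma bundle_maps:
  "bundle_morphism n (dual_bundle S) (trivial_bundle n (n + k)) \<phi>"
  "bundle_morphism n (trivial_bundle n (n + k)) (O1_bundle n k) \<psi>"
  using exact by (auto simp: short_exact_def)

lemma phi_carrier: "i \<in> idx S \<Longrightarrow> x \<in> chart S i \<Longrightarrow> \<phi> () i x \<in> carrier_mat (n + k) (brank S)"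
  using bundle_maps(1) chart_sub by (auto simp: bundle_morphism_def dual_bundle_def trivial_bundle_def regular_mat_def)

lemma F_regular:
  assumes "i \<in> idx S" "l < n + k" "m < brank S"
  shows "regular_on n 0 (chart S i) (\<lambda>x. F i x l m)"
proof -
  have "chart S i \<inter> proj_space n = chart S i" using chart_sub[OF assms(1)] by blast
  then show ?thesis
    using bundle_maps(1) assms
    by (auto simp: bundle_morphism_def dual_bundle_def trivial_bundle_def regular_mat_def F_def)
qed

lemma F_transition:
  assumes ij: "i \<in> idx S" "j \<in> idx S" "x \<in> chart S i" "x \<in> chart S j" and l: "l < n + k" and m: "m < brank S"
  shows "F j x l m = (\<Sum>m'<brank S. F i x l m' * transition S j i x $$ (m, m'))"
proof -
  have x: "x \<in> proj_space n" using chart_sub ij by blast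
  have "\<phi> () i x * transpose_mat (transition S j i x) = 1\<^sub>m (n + k) * \<phi> () j x"
    using bundle_maps(1) ij x by (auto simp: bundle_morphism_def dual_bundle_def trivial_bundle_def)
  also have "\<dots> = \<phi> () j x" using phi_carrier[OF ij(2,4)] by simp
  finally have "F j x l m = (\<phi> () i x * transpose_mat (transition S j i x)) $$ (l, m)" by (simp add: F_def)
  also have "\<dots> = (\<Sum>m'<brank S. \<phi> () i x $$ (l, m') * transpose_mat (transition S j i x) $$ (m', m))"
    by (rule mat_mult_sum[OF phi_carrier[OF ij(1,3)] _ l m]) (use transition_carrier ij in auto)
  also have "\<dots> = (\<Sum>m'<brank S. F i x l m' * transition S j i x $$ (m, m'))"
    using transition_carrier[OF ij(2,1,4,3)] m by (intro sum.cong) (auto simp: F_def)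
  finally show ?thesis .
qed

lemma psi_carrier: "c \<le> n \<Longrightarrow> x \<in> proj_space n \<Longrightarrow> x $ c \<noteq> 0 \<Longrightarrow> \<psi> c () x \<in> carrier_mat k (n + k)"
  using bundle_maps(2) by (auto simp: bundle_morphism_def O1_bundle_def trivial_bundle_def regular_mat_def)

lemma psi_regular:
  assumes "c \<le> n" "r < k" "l < n + k"
  shows "regular_on n 0 {x \<in> proj_space n. x $ c \<noteq> 0} (\<lambda>x. \<psi> c () x $$ (r, l))"
proof -
  have "proj_space n \<inter> {x \<in> proj_space n. x $ c \<noteq> 0} = {x \<in> proj_space n. x $ c \<noteq> 0}" by blast
  moreover have "regular_on n 0 (proj_space n \<inter> {x \<in> proj_space n. x $ c \<noteq> 0}) (\<lambda>x. \<psi> c () x $$ (r, l))"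
    using bundle_maps(2) assms by (simp add: bundle_morphism_def O1_bundle_def trivial_bundle_def regular_mat_def)
  ultimately show ?thesis by simp
qed

lemma psi_transition:
  assumes c: "c \<le> n" "d \<le> n" and x: "x \<in> proj_space n" "x $ c \<noteq> 0" "x $ d \<noteq> 0" and rl: "r < k" "l < n + k"
  shows "x $ c * \<psi> c () x $$ (r, l) = x $ d * \<psi> d () x $$ (r, l)"
proof -
  have "\<forall>a\<in>{..n}. \<forall>b\<in>{..n}. \<forall>x\<in>proj_space n \<inter> {x \<in> proj_space n. x $ a \<noteq> 0} \<inter> {x \<in> proj_space n. x $ b \<noteq> 0}.
      \<psi> a () x * 1\<^sub>m (n + k) = ((x $ b / x $ a) \<cdot>\<^sub>m 1\<^sub>m k) * \<psi> b () x"
    using bundle_maps(2) by (simp add: bundle_morphism_def O1_bundle_def trivial_bundle_def)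
  then have "\<psi> c () x * 1\<^sub>m (n + k) = ((x $ d / x $ c) \<cdot>\<^sub>m 1\<^sub>m k) * \<psi> d () x"
    using c x by blast
  also have "\<dots> = (x $ d / x $ c) \<cdot>\<^sub>m \<psi> d () x"
    using mult_smult_assoc_mat[OF one_carrier_mat psi_carrier[OF c(2) x(1,3)]]
      left_mult_one_mat[OF psi_carrier[OF c(2) x(1,3)]] by simp
  finally have "\<psi> c () x = (x $ d / x $ c) \<cdot>\<^sub>m \<psi> d () x"
    using psi_carrier[OF c(1) x(1,2)] by simp
  then have "\<psi> c () x $$ (r, l) = (x $ d / x $ c) * \<psi> d () x $$ (r, l)"
    using psi_carrier[OF c(2) x(1,3)] rl by simp
  then show ?thesis using x by simp
qed

text \<open>The transition functions of \<open>O(1)\<close> make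
  \<open>x $ c * \<psi> c () x\<close> independent of the chart, so each entry is a global section
  of \<open>O(1)\<close>.\<close>

lemma psi_linear_exists:
  assumes rl: "r < k" "l < n + k"
  shows "\<exists>a. \<forall>x\<in>proj_space n. \<forall>c\<le>n. x $ c \<noteq> 0 \<longrightarrow> x $ c * \<psi> c () x $$ (r, l) = linform n a x"
proof -
  define f where "f x = (let c = (SOME c. c \<le> n \<and> x $ c \<noteq> 0) in x $ c * \<psi> c () x $$ (r, l))" for x
  have f: "f x = x $ c * \<psi> c () x $$ (r, l)" if "x \<in> proj_space n" "c \<le> n" "x $ c \<noteq> 0" for x c
  proof -
    have "(SOME c. c \<le> n \<and> x $ c \<noteq> 0) \<le> n \<and> x $ (SOME c. c \<le> n \<and> x $ c \<noteq> 0) \<noteq> 0"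
      by (rule someI[of _ c]) (use that in auto)
    then show ?thesis unfolding f_def Let_def using psi_transition that rl by blast
  qed
  have "regular_on n 1 (proj_space n) f"
  proof (rule regular_on_local)
    fix x assume "x \<in> proj_space n"
    then obtain c where c: "c \<le> n" "x $ c \<noteq> 0" using proj_space_coord by blast
    let ?V = "{x \<in> proj_space n. x $ c \<noteq> 0}"
    have "regular_on n (1 + 0) ?V (\<lambda>x. x $ c * \<psi> c () x $$ (r, l))"
      by (rule regular_on_mult[OF regular_on_coord psi_regular]) (use c rl in auto)
    then have r1: "regular_on n 1 ?V (\<lambda>x. x $ c * \<psi> c () x $$ (r, l))" by simp
    have "regular_on n 1 ?V f" by (rule regular_on_cong[OF r1]) (use f c in simp)
    moreover have "?V \<inter> proj_space n = ?V" by blast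
    ultimately show "\<exists>V. zariski_open n V \<and> x \<in> V \<and> regular_on n 1 (V \<inter> proj_space n) f"
      using zariski_open_nonzero[OF form_coord[OF c(1)]] c \<open>x \<in> proj_space n\<close> by (intro exI[of _ ?V]) simp
  qed
  then obtain a where "\<forall>x\<in>proj_space n. f x = linform n a x" using regular_on_proj_space_linear by blast
  then show ?thesis using f by metis
qed

text \<open>The indices belong to \<open>V\<close>, \<open>I\<close> and \<open>W\<close>, in this
  order.\<close>

definition T :: "nat \<Rightarrow> nat \<Rightarrow> nat \<Rightarrow> complex" where
  "T t r l = (SOME a. \<forall>x\<in>proj_space n. \<forall>c\<le>n. x $ c \<noteq> 0 \<longrightarrow> x $ c * \<psi> c () x $$ (r, l) = linform n a x) t"

definition Tx :: "complex vec \<Rightarrow> nat \<Rightarrow> nat \<Rightarrow> complex" where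
  "Tx x r l = (\<Sum>t<n + 1. T t r l * x $ t)"

lemma psi_linear:
  assumes "r < k" "l < n + k" "x \<in> proj_space n" "c \<le> n" "x $ c \<noteq> 0"
  shows "\<psi> c () x $$ (r, l) = Tx x r l / x $ c"
proof -
  have "\<forall>x\<in>proj_space n. \<forall>c\<le>n. x $ c \<noteq> 0 \<longrightarrow> x $ c * \<psi> c () x $$ (r, l) = linform n (\<lambda>t. T t r l) x"
    unfolding T_def using someI_ex[OF psi_linear_exists[OF assms(1,2)]] by simp
  then have "x $ c * \<psi> c () x $$ (r, l) = Tx x r l"
    using assms by (simp add: linform_def Tx_def)
  then show ?thesis using assms(5) by (simp add: field_simps)
qed

lemma psi_apply:
  assumes x: "x \<in> proj_space n" "c \<le> n" "x $ c \<noteq> 0" and v: "v \<in> carrier_vec (n + k)" and r: "r < k"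
  shows "(\<psi> c () x *\<^sub>v v) $ r = (\<Sum>l<n + k. Tx x r l * v $ l) / x $ c"
  using mat_vec_sum[OF psi_carrier[OF x(2,1,3)] v r] psi_linear[OF r _ x]
  by (simp add: sum_divide_distrib)

lemma phi_apply:
  assumes "i \<in> idx S" "x \<in> chart S i" "u \<in> carrier_vec (brank S)" "l < n + k"
  shows "(\<phi> () i x *\<^sub>v u) $ l = (\<Sum>m<brank S. F i x l m * u $ m)"
  using mat_vec_sum[OF phi_carrier[OF assms(1,2)] assms(3,4)] by (simp add: F_def)

lemma fibre_exact:
  assumes "i \<in> idx S" "x \<in> chart S i" "c \<le> n" "x $ c \<noteq> 0"
  shows "inj_on (\<lambda>u. \<phi> () i x *\<^sub>v u) (carrier_vec (brank S))"
    "(\<lambda>u. \<phi> () i x *\<^sub>v u) ` carrier_vec (brank S) = {v \<in> carrier_vec (n + k). \<psi> c () x *\<^sub>v v = 0\<^sub>v k}"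
    "(\<lambda>v. \<psi> c () x *\<^sub>v v) ` carrier_vec (n + k) = carrier_vec k"
proof -
  have "x \<in> proj_space n" using chart_sub assms by blast
  then show "inj_on (\<lambda>u. \<phi> () i x *\<^sub>v u) (carrier_vec (brank S))"
    "(\<lambda>u. \<phi> () i x *\<^sub>v u) ` carrier_vec (brank S) = {v \<in> carrier_vec (n + k). \<psi> c () x *\<^sub>v v = 0\<^sub>v k}"
    "(\<lambda>v. \<psi> c () x *\<^sub>v v) ` carrier_vec (n + k) = carrier_vec k"
    using exact assms by (auto simp: short_exact_def dual_bundle_def trivial_bundle_def O1_bundle_def)
qed

lemma F_injective:
  assumes i: "i \<in> idx S" "x \<in> chart S i" and zero: "\<And>l. l < n + k \<Longrightarrow> (\<Sum>m<brank S. F i x l m * u m) = 0"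
    and m: "m < brank S"
  shows "u m = 0"
proof -
  obtain c where c: "c \<le> n" "x $ c \<noteq> 0" using chart_sub i proj_space_coord by blast
  let ?u = "vec (brank S) u"
  have "\<phi> () i x *\<^sub>v ?u = \<phi> () i x *\<^sub>v 0\<^sub>v (brank S)"
  proof (rule eq_vecI)
    fix l assume "l < dim_vec (\<phi> () i x *\<^sub>v 0\<^sub>v (brank S))"
    then have l: "l < n + k" using phi_carrier[OF i] by auto
    show "(\<phi> () i x *\<^sub>v ?u) $ l = (\<phi> () i x *\<^sub>v 0\<^sub>v (brank S)) $ l"
      using phi_apply[OF i _ l, of ?u] phi_apply[OF i _ l, of "0\<^sub>v (brank S)"] zero[OF l] by simp
  qed (use phi_carrier[OF i] in auto)
  then have "?u = 0\<^sub>v (brank S)" using fibre_exact(1)[OF i c] by (auto dest: inj_onD)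
  then show ?thesis using m by (metis index_vec index_zero_vec(1))
qed

lemma F_kernel:
  assumes i: "i \<in> idx S" "x \<in> chart S i" and v: "\<And>r. r < k \<Longrightarrow> (\<Sum>l<n + k. Tx x r l * v l) = 0"
  shows "\<exists>u. \<forall>l<n + k. v l = (\<Sum>m<brank S. F i x l m * u m)"
proof -
  have x: "x \<in> proj_space n" using chart_sub i by blast
  obtain c where c: "c \<le> n" "x $ c \<noteq> 0" using proj_space_coord[OF x] .
  let ?v = "vec (n + k) v"
  have "\<psi> c () x *\<^sub>v ?v = 0\<^sub>v k"
  proof (rule eq_vecI)
    fix r assume "r < dim_vec (0\<^sub>v k)"
    then have r: "r < k" by simp
    show "(\<psi> c () x *\<^sub>v ?v) $ r = 0\<^sub>v k $ r" using psi_apply[OF x c _ r, of ?v] v[OF r] r by simp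
  qed (use psi_carrier[OF c(1) x c(2)] in auto)
  then have "?v \<in> (\<lambda>u. \<phi> () i x *\<^sub>v u) ` carrier_vec (brank S)" using fibre_exact(2)[OF i c] by simp
  then obtain u where u: "u \<in> carrier_vec (brank S)" "?v = \<phi> () i x *\<^sub>v u" by blast
  then have "v l = (\<Sum>m<brank S. F i x l m * u $ m)" if "l < n + k" for l
    using phi_apply[OF i u(1) that] that by (metis index_vec)
  then show ?thesis by blast
qed

lemma Tx_F_zero:
  assumes i: "i \<in> idx S" "x \<in> chart S i" and r: "r < k" and m: "m < brank S"
  shows "(\<Sum>l<n + k. Tx x r l * F i x l m) = 0"
proof -
  have x: "x \<in> proj_space n" using chart_sub i by blast
  obtain c where c: "c \<le> n" "x $ c \<noteq> 0" using proj_space_coord[OF x] .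
  let ?u = "unit_vec (brank S) m"
  let ?v = "\<phi> () i x *\<^sub>v ?u"
  have "?v \<in> (\<lambda>u. \<phi> () i x *\<^sub>v u) ` carrier_vec (brank S)" by (rule imageI) simp
  then have v: "?v \<in> carrier_vec (n + k)" "\<psi> c () x *\<^sub>v ?v = 0\<^sub>v k" using fibre_exact(2)[OF i c] by auto
  have "?v $ l = F i x l m" if "l < n + k" for l
    using phi_apply[OF i _ that, of ?u] m
    by (simp add: unit_vec_def if_distrib[of "\<lambda>x. _ * x"] cong: if_cong)
  then have "(\<Sum>l<n + k. Tx x r l * F i x l m) / x $ c = (\<psi> c () x *\<^sub>v ?v) $ r"
    using psi_apply[OF x c v(1) r] by simp
  then show ?thesis using v(2) r c by simp
qed

lemma Tx_surjective:
  assumes x: "x \<in> proj_space n"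
  shows "\<exists>v. \<forall>r<k. (\<Sum>l<n + k. Tx x r l * v l) = z r"
proof -
  obtain i where i: "i \<in> idx S" "x \<in> chart S i" using chart_cover[OF x] .
  obtain c where c: "c \<le> n" "x $ c \<noteq> 0" using proj_space_coord[OF x] .
  have "vec k (\<lambda>r. z r / x $ c) \<in> (\<lambda>v. \<psi> c () x *\<^sub>v v) ` carrier_vec (n + k)" using fibre_exact(3)[OF i c] by simp
  then obtain v where v: "v \<in> carrier_vec (n + k)" "vec k (\<lambda>r. z r / x $ c) = \<psi> c () x *\<^sub>v v" by blast
  have "(\<Sum>l<n + k. Tx x r l * v $ l) = z r" if r: "r < k" for r
    using psi_apply[OF x c v(1) r] arg_cong[OF v(2), of "\<lambda>v. v $ r"] r c by simp
  then show ?thesis by (intro exI[of _ "\<lambda>l. v $ l"]) blast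
qed

lemma Tx_right_inverse:
  assumes x: "x \<in> proj_space n"
  obtains R where "\<And>r r'. r < k \<Longrightarrow> (\<Sum>l<n + k. Tx x r l * R r' l) = (if r = r' then 1 else 0)"
proof -
  have "\<forall>r'. \<exists>v. \<forall>r<k. (\<Sum>l<n + k. Tx x r l * v l) = (if r = r' then 1 else 0)"
    by (intro allI Tx_surjective[OF x])
  then have "\<exists>R. \<forall>r'. \<forall>r<k. (\<Sum>l<n + k. Tx x r l * R r' l) = (if r = r' then 1 else 0)" by (simp only: choice_iff)
  then obtain R where "\<forall>r'. \<forall>r<k. (\<Sum>l<n + k. Tx x r l * R r' l) = (if r = r' then 1 else 0)" ..
  then show thesis by (intro that[of R]) simp
qed

text \<open>If \<open>R\<close> is a right inverse of \<open>Tx x\<close>, then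
  \<open>1 - R Tx\<close> projects onto the kernel of \<open>Tx x\<close>, which is the image of
  \<open>F\<close>; \<open>u\<close> holds the coordinates of the projected unit vectors.\<close>

lemma projection_in_image:
  assumes i: "i \<in> idx S" "x \<in> chart S i"
    and R: "\<And>r r'. r < k \<Longrightarrow> (\<Sum>l<n + k. Tx x r l * R r' l) = (if r = r' then 1 else 0)"
  obtains u where "\<And>l l'. l < n + k \<Longrightarrow> l' < n + k \<Longrightarrow>
    (if l = l' then 1 else 0) - (\<Sum>r<k. Tx x r l * R r l') = (\<Sum>m<brank S. F i x l' m * u l m)"
proof -
  have "\<exists>u. \<forall>l'<n + k. (if l = l' then 1 else 0) - (\<Sum>r<k. Tx x r l * R r l') = (\<Sum>m<brank S. F i x l' m * u m)"
    if l: "l < n + k" for l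
  proof (rule F_kernel[OF i])
    fix r assume r: "r < k"
    have "(\<Sum>l'<n + k. Tx x r l' * ((if l = l' then 1 else 0) - (\<Sum>r<k. Tx x r l * R r l')))
        = (\<Sum>l'<n + k. Tx x r l' * (if l = l' then 1 else 0)) - (\<Sum>l'<n + k. \<Sum>r'<k. Tx x r' l * (Tx x r l' * R r' l'))"
      by (simp add: right_diff_distrib sum_subtractf sum_distrib_left mult.left_commute)
    also have "(\<Sum>l'<n + k. \<Sum>r'<k. Tx x r' l * (Tx x r l' * R r' l')) = (\<Sum>r'<k. Tx x r' l * (if r = r' then 1 else 0))"
      by (subst sum.swap) (simp add: sum_distrib_left[symmetric] R[OF r])
    also have "(\<Sum>l'<n + k. Tx x r l' * (if l = l' then 1 else 0)) = Tx x r l"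
      using l by (simp add: if_distrib[of "\<lambda>x. _ * x"] cong: if_cong)
    also have "(\<Sum>r'<k. Tx x r' l * (if r = r' then 1 else 0)) = Tx x r l"
      using r by (simp add: if_distrib[of "\<lambda>x. _ * x"] cong: if_cong)
    finally show "(\<Sum>l'<n + k. Tx x r l' * ((if l = l' then 1 else 0) - (\<Sum>r<k. Tx x r l * R r l'))) = 0" by simp
  qed
  then have "\<forall>l. \<exists>u. l < n + k \<longrightarrow> (\<forall>l'<n + k. (if l = l' then 1 else 0) - (\<Sum>r<k. Tx x r l * R r l') = (\<Sum>m<brank S. F i x l' m * u m))"
    by (simp only: ex_simps all_simps) simp
  then have "\<exists>u. \<forall>l. l < n + k \<longrightarrow> (\<forall>l'<n + k. (if l = l' then 1 else 0) - (\<Sum>r<k. Tx x r l * R r l') = (\<Sum>m<brank S. F i x l' m * u l m))"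
    by (simp only: choice_iff)
  then obtain u where "\<forall>l. l < n + k \<longrightarrow> (\<forall>l'<n + k. (if l = l' then 1 else 0) - (\<Sum>r<k. Tx x r l * R r l') = (\<Sum>m<brank S. F i x l' m * u l m))" ..
  then show thesis by (intro that[of u]) simp
qed

text \<open>Exactness of the dual sequence at the dual of \<open>W\<close>: a functional that kills
  the image of the projection \<open>1 - R Tx\<close> equals its own composition with
  \<open>R Tx\<close>.\<close>

lemma annihilator_of_image:
  assumes i: "i \<in> idx S" "x \<in> chart S i" and \<xi>: "\<And>m. m < brank S \<Longrightarrow> (\<Sum>l<n + k. F i x l m * \<xi> l) = 0"
  shows "\<exists>y. \<forall>l<n + k. \<xi> l = (\<Sum>r<k. y r * Tx x r l)"
proof -
  have x: "x \<in> proj_space n" using chart_sub i by blast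
  obtain R where R: "\<And>r r'. r < k \<Longrightarrow> (\<Sum>l<n + k. Tx x r l * R r' l) = (if r = r' then 1 else 0)"
    by (rule Tx_right_inverse[OF x]) (rule that, assumption+)
  obtain u where u: "\<And>l l'. l < n + k \<Longrightarrow> l' < n + k \<Longrightarrow>
    (if l = l' then 1 else 0) - (\<Sum>r<k. Tx x r l * R r l') = (\<Sum>m<brank S. F i x l' m * u l m)"
    by (rule projection_in_image[OF i R]) (assumption, rule that, assumption+)
  have "\<xi> l = (\<Sum>r<k. (\<Sum>l'<n + k. R r l' * \<xi> l') * Tx x r l)" if l: "l < n + k" for l
  proof -
    have "(\<Sum>l'<n + k. ((if l = l' then 1 else 0) - (\<Sum>r<k. Tx x r l * R r l')) * \<xi> l')
        = (\<Sum>l'<n + k. \<Sum>m<brank S. u l m * (F i x l' m * \<xi> l'))"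
      using u[OF l] by (intro sum.cong refl) (simp add: sum_distrib_right sum_distrib_left ac_simps)
    also have "\<dots> = (\<Sum>m<brank S. u l m * (\<Sum>l'<n + k. F i x l' m * \<xi> l'))"
      by (subst sum.swap) (simp add: sum_distrib_left)
    also have "\<dots> = 0" using \<xi> by simp
    also have "(\<Sum>l'<n + k. ((if l = l' then 1 else 0) - (\<Sum>r<k. Tx x r l * R r l')) * \<xi> l')
        = (\<Sum>l'<n + k. (if l = l' then 1 else 0) * \<xi> l') - (\<Sum>l'<n + k. \<Sum>r<k. Tx x r l * (R r l' * \<xi> l'))"
      by (simp add: left_diff_distrib sum_subtractf sum_distrib_right mult.assoc)
    also have "(\<Sum>l'<n + k. (if l = l' then 1 else 0) * \<xi> l') = \<xi> l"
      using l by (simp add: if_distrib[of "\<lambda>x. x * _"] cong: if_cong)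
    also have "(\<Sum>l'<n + k. \<Sum>r<k. Tx x r l * (R r l' * \<xi> l')) = (\<Sum>r<k. (\<Sum>l'<n + k. R r l' * \<xi> l') * Tx x r l)"
      by (subst sum.swap) (simp add: sum_distrib_left sum_distrib_right mult.commute)
    finally show ?thesis by simp
  qed
  then show ?thesis by (intro exI[of _ "\<lambda>r. \<Sum>l'<n + k. R r l' * \<xi> l'"]) blast
qed

text \<open>With \<open>P = F u\<close> the projection, \<open>P F = F\<close> gives
  \<open>F (u F - 1) = 0\<close>, and \<open>F\<close> is injective.\<close>

lemma F_left_inverse:
  assumes i: "i \<in> idx S" "x \<in> chart S i"
  obtains L where "\<And>m m'. m < brank S \<Longrightarrow> m' < brank S \<Longrightarrow>
    (\<Sum>l<n + k. L m l * F i x l m') = (if m = m' then 1 else 0)"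
proof -
  have x: "x \<in> proj_space n" using chart_sub i by blast
  obtain R where R: "\<And>r r'. r < k \<Longrightarrow> (\<Sum>l<n + k. Tx x r l * R r' l) = (if r = r' then 1 else 0)"
    by (rule Tx_right_inverse[OF x]) (rule that, assumption+)
  obtain u where u: "\<And>l l'. l < n + k \<Longrightarrow> l' < n + k \<Longrightarrow>
    (if l = l' then 1 else 0) - (\<Sum>r<k. Tx x r l * R r l') = (\<Sum>m<brank S. F i x l' m * u l m)"
    by (rule projection_in_image[OF i R]) (assumption, rule that, assumption+)
  have "(\<Sum>l<n + k. u l m * F i x l m') = (if m = m' then 1 else 0)" if m: "m < brank S" "m' < brank S" for m m'
  proof -
    define z where "z m = (\<Sum>l<n + k. u l m * F i x l m') - (if m = m' then 1 else 0)" for m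
    have "(\<Sum>m<brank S. F i x l' m * z m) = 0" if l': "l' < n + k" for l'
    proof -
      have "(\<Sum>m<brank S. F i x l' m * z m) = (\<Sum>m<brank S. \<Sum>l<n + k. F i x l m' * (F i x l' m * u l m)) - F i x l' m'"
        using m(2) by (simp add: z_def right_diff_distrib sum_subtractf sum_distrib_left ac_simps
            if_distrib[of "\<lambda>x. _ * x"] if_distrib[of "\<lambda>x. x * _"] cong: if_cong)
      also have "(\<Sum>m<brank S. \<Sum>l<n + k. F i x l m' * (F i x l' m * u l m))
          = (\<Sum>l<n + k. F i x l m' * ((if l = l' then 1 else 0) - (\<Sum>r<k. Tx x r l * R r l')))"
        by (subst sum.swap) (intro sum.cong refl, simp add: sum_distrib_left[symmetric] u l')
      also have "\<dots> = F i x l' m' - (\<Sum>l<n + k. \<Sum>r<k. R r l' * (Tx x r l * F i x l m'))"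
        using l' by (simp add: right_diff_distrib sum_subtractf sum_distrib_left ac_simps
            if_distrib[of "\<lambda>x. _ * x"] if_distrib[of "\<lambda>x. x * _"] cong: if_cong)
      also have "(\<Sum>l<n + k. \<Sum>r<k. R r l' * (Tx x r l * F i x l m')) = 0"
        by (subst sum.swap) (simp add: sum_distrib_left[symmetric] Tx_F_zero[OF i _ m(2)])
      finally show ?thesis by simp
    qed
    from F_injective[OF i this m(1)] show ?thesis by (simp add: z_def)
  qed
  then show thesis by (rule that)
qed

text \<open>A left inverse \<open>L\<close> at \<open>x0\<close> is corrected nearby:
  \<open>M = L F\<close> is the identity at \<open>x0\<close>, so \<open>det M\<close> is non-zero
  around it and \<open>K = M^(-1) L\<close>, written with the adjugate, is regular.\<close>

lemma local_left_inverse: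
  assumes i: "i \<in> idx S" "x0 \<in> chart S i"
  obtains V K where "zariski_open n V" "x0 \<in> V" "V \<subseteq> chart S i"
    "\<And>l m. l < n + k \<Longrightarrow> m < brank S \<Longrightarrow> regular_on n 0 V (\<lambda>x. K x l m)"
    "\<And>x m m'. x \<in> V \<Longrightarrow> m < brank S \<Longrightarrow> m' < brank S \<Longrightarrow>
      (\<Sum>l<n + k. K x l m * F i x l m') = (if m = m' then 1 else 0)"
proof -
  let ?b = "brank S"
  obtain L where L: "\<And>m m'. m < ?b \<Longrightarrow> m' < ?b \<Longrightarrow>
    (\<Sum>l<n + k. L m l * F i x0 l m') = (if m = m' then 1 else 0)"
    by (rule F_left_inverse[OF i]) (rule that, assumption+)
  define M where "M x = mat ?b ?b (\<lambda>(m, m'). \<Sum>l<n + k. L m l * F i x l m')" for x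
  have Mc: "M x \<in> carrier_mat ?b ?b" for x by (simp add: M_def)
  have Mreg: "regular_on n 0 (chart S i) (\<lambda>x. M x $$ (m, m'))" if "m < ?b" "m' < ?b" for m m'
  proof -
    have "regular_on n 0 (chart S i) (\<lambda>x. \<Sum>l<n + k. L m l * F i x l m')"
      by (intro regular_on_sum regular_on_scale F_regular chart_sub) (use i that in auto)
    then show ?thesis using that by (simp add: M_def)
  qed
  have det: "regular_on n 0 (chart S i) (\<lambda>x. det (M x))"
    by (rule regular_on_det[OF chart_sub[OF i(1)] Mc Mreg])
  have "M x0 = 1\<^sub>m ?b" by (rule eq_matI) (auto simp: M_def L)
  then have "det (M x0) \<noteq> 0" by simp
  then obtain V where V: "zariski_open n V" "x0 \<in> V" "V \<subseteq> chart S i" "\<And>x. x \<in> V \<Longrightarrow> det (M x) \<noteq> 0"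
    using regular_on_nonzero_nbhd[OF det chart_open[OF i(1)] i(2)] by blast
  have Vp: "V \<subseteq> proj_space n" using V zariski_open_sub by blast
  have adj: "regular_on n 0 V (\<lambda>x. adj_mat (M x) $$ (m, m'))" if m: "m < ?b" "m' < ?b" for m m'
  proof -
    have "regular_on n 0 V (\<lambda>x. (- 1) ^ (m' + m) * det (mat_delete (M x) m' m))"
    proof (intro regular_on_scale[OF Vp] regular_on_det[OF Vp, of _ "?b - 1"])
      show "mat_delete (M x) m' m \<in> carrier_mat (?b - 1) (?b - 1)" for x
        using Mc[of x] by (simp add: mat_delete_def)
      fix p q assume pq: "p < ?b - 1" "q < ?b - 1"
      let ?p = "if p < m' then p else Suc p" and ?q = "if q < m then q else Suc q"
      have "mat_delete (M x) m' m $$ (p, q) = M x $$ (?p, ?q)" for x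
        using pq Mc[of x] by (simp add: mat_delete_def)
      moreover have "regular_on n 0 V (\<lambda>x. M x $$ (?p, ?q))"
        by (rule regular_on_subset[OF Mreg V(3)]) (use pq in auto)
      ultimately show "regular_on n 0 V (\<lambda>x. mat_delete (M x) m' m $$ (p, q))" by simp
    qed
    then show ?thesis
      by (rule regular_on_cong) (use m in \<open>simp add: adj_mat_def cofactor_def carrier_matD[OF Mc]\<close>)
  qed
  define K where "K x l m = (\<Sum>m'<?b. L m' l * (adj_mat (M x) $$ (m, m') / det (M x)))" for x l m
  have "regular_on n 0 V (\<lambda>x. K x l m)" if "m < ?b" for l m
  proof -
    have "regular_on n (0 - 0) V (\<lambda>x. adj_mat (M x) $$ (m, m') / det (M x))" if "m' < ?b" for m'
      by (rule regular_on_divide[OF adj[OF \<open>m < ?b\<close> that] regular_on_subset[OF det V(3)]]) (rule V(4))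
    then show ?thesis unfolding K_def by (intro regular_on_sum[OF Vp] regular_on_scale[OF Vp]) simp
  qed
  moreover have "(\<Sum>l<n + k. K x l m * F i x l m') = (if m = m' then 1 else 0)"
    if x: "x \<in> V" and m: "m < ?b" "m' < ?b" for x m m'
  proof -
    have "(\<Sum>l<n + k. K x l m * F i x l m')
        = (\<Sum>l<n + k. \<Sum>m''<?b. adj_mat (M x) $$ (m, m'') / det (M x) * (L m'' l * F i x l m'))"
      by (simp add: K_def sum_distrib_left sum_distrib_right ac_simps)
    also have "\<dots> = (\<Sum>m''<?b. adj_mat (M x) $$ (m, m'') / det (M x) * M x $$ (m'', m'))"
      by (subst sum.swap, intro sum.cong refl, simp only: sum_distrib_left[symmetric]) (use m in \<open>simp add: M_def\<close>)
    also have "\<dots> = (\<Sum>m''<?b. adj_mat (M x) $$ (m, m'') * M x $$ (m'', m')) / det (M x)"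
      by (simp add: sum_divide_distrib)
    also have "(\<Sum>m''<?b. adj_mat (M x) $$ (m, m'') * M x $$ (m'', m')) = (adj_mat (M x) * M x) $$ (m, m')"
      using mat_mult_sum[OF adj_mat(1)[OF Mc] Mc m] by simp
    also have "\<dots> = (det (M x) \<cdot>\<^sub>m 1\<^sub>m ?b) $$ (m, m')" using adj_mat(3)[OF Mc] by simp
    finally show ?thesis using m V(4)[OF x] by simp
  qed
  ultimately show thesis using that[of V K] V(1-3) by blast
qed

text \<open>Surjectivity of \<open>Tx x\<close> is injectivity of its transpose, which is
  \<open>y \<mapsto> B x y\<close>.\<close>

sublocale nonsingular_tensor n k T
proof
  fix x y :: "nat \<Rightarrow> complex" assume x: "\<exists>t<n + 1. x t \<noteq> 0" and y: "\<exists>r<k. y r \<noteq> (0::complex)"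
  show "\<exists>l<n + k. (\<Sum>t<n + 1. \<Sum>r<k. T t r l * x t * y r) \<noteq> 0"
  proof (rule ccontr)
    assume "\<not> ?thesis"
    then have zero: "(\<Sum>t<n + 1. \<Sum>r<k. T t r l * x t * y r) = 0" if "l < n + k" for l using that by blast
    let ?x = "vec (n + 1) x"
    obtain r0 where r0: "r0 < k" "y r0 \<noteq> 0" using y by blast
    obtain t0 where t0: "t0 < n + 1" "x t0 \<noteq> 0" using x by blast
    have "?x \<noteq> 0\<^sub>v (n + 1)" using t0 by (metis index_vec index_zero_vec(1))
    then have "?x \<in> proj_space n" by (simp add: proj_space_iff)
    \<comment> \<open>\<open>v\<close> is mapped to the unit vector at \<open>r0\<close>, so pairing
      its image with \<open>y\<close> isolates \<open>y r0\<close>.\<close>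
    then obtain v where v: "\<forall>r<k. (\<Sum>l<n + k. Tx ?x r l * v l) = (if r = r0 then 1 else 0)"
      using Tx_surjective[of ?x "\<lambda>r. if r = r0 then 1 else 0"] by blast
    have "y r0 = (\<Sum>r<k. y r * (\<Sum>l<n + k. Tx ?x r l * v l))"
      using v r0 by (simp add: if_distrib[of "\<lambda>x. _ * x"] cong: if_cong)
    also have "\<dots> = (\<Sum>l<n + k. v l * (\<Sum>r<k. y r * Tx ?x r l))"
      unfolding sum_distrib_left by (subst sum.swap) (simp add: ac_simps)
    also have "\<dots> = 0"
    proof (intro sum.neutral ballI)
      fix l assume "l \<in> {..<n + k}"
      moreover have "(\<Sum>r<k. y r * Tx ?x r l) = (\<Sum>t<n + 1. \<Sum>r<k. T t r l * x t * y r)"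
        unfolding Tx_def sum_distrib_left by (subst sum.swap) (simp add: ac_simps)
      ultimately show "v l * (\<Sum>r<k. y r * Tx ?x r l) = 0" using zero by simp
    qed
    finally show False using r0 by simp
  qed
qed

end

lemma bundle_sectionsD:
  assumes "s \<in> bundle_sections n E A"
  shows "\<not> (i \<in> idx E \<and> x \<in> A \<inter> chart E i) \<Longrightarrow> s i x = 0\<^sub>v (brank E)"
    and "i \<in> idx E \<Longrightarrow> x \<in> A \<Longrightarrow> x \<in> chart E i \<Longrightarrow> s i x \<in> carrier_vec (brank E)"
    and "i \<in> idx E \<Longrightarrow> m < brank E \<Longrightarrow> regular_on n 0 (A \<inter> chart E i) (\<lambda>x. s i x $ m)"
    and "i \<in> idx E \<Longrightarrow> j \<in> idx E \<Longrightarrow> x \<in> A \<Longrightarrow> x \<in> chart E i \<Longrightarrow> x \<in> chart E j \<Longrightarrow>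
      s i x = transition E i j x *\<^sub>v s j x"
  using assms unfolding bundle_sections_def mem_Collect_eq by (blast, blast, blast, blast)

lemma bundle_sectionsI:
  assumes "\<And>i x. \<not> (i \<in> idx E \<and> x \<in> A \<inter> chart E i) \<Longrightarrow> s i x = 0\<^sub>v (brank E)"
    and "\<And>i x. i \<in> idx E \<Longrightarrow> x \<in> A \<Longrightarrow> x \<in> chart E i \<Longrightarrow> s i x \<in> carrier_vec (brank E)"
    and "\<And>i m. i \<in> idx E \<Longrightarrow> m < brank E \<Longrightarrow> regular_on n 0 (A \<inter> chart E i) (\<lambda>x. s i x $ m)"
    and "\<And>i j x. i \<in> idx E \<Longrightarrow> j \<in> idx E \<Longrightarrow> x \<in> A \<Longrightarrow> x \<in> chart E i \<Longrightarrow> x \<in> chart E j \<Longrightarrow>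
      s i x = transition E i j x *\<^sub>v s j x"
  shows "s \<in> bundle_sections n E A"
  unfolding bundle_sections_def mem_Collect_eq
  by (intro conjI allI impI ballI; (elim IntE)?; (rule assms; assumption))

section \<open>Hyperplanes, their equations, and unstable hyperplanes\<close>

lemma scalar_prod_linform:
  assumes "a \<in> carrier_vec (n + 1)" "x \<in> carrier_vec (n + 1)"
  shows "a \<bullet> x = linform n (\<lambda>t. a $ t) x"
  using assms by (simp add: scalar_prod_def linform_def atLeast0LessThan)

lemma hyperplane_eq_linform:
  assumes "hyperplane_eq n a H"
  shows "x \<in> H \<longleftrightarrow> x \<in> proj_space n \<and> linform n (\<lambda>t. a $ t) x = 0"
  using assms scalar_prod_linform[of a n x] by (auto simp: hyperplane_eq_def proj_space_iff)

lemma hyperplane_eq_coord: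
  assumes "hyperplane_eq n a H"
  obtains t where "t < n + 1" "a $ t \<noteq> 0"
proof -
  have "a \<in> proj_space n" using assms by (simp add: hyperplane_eq_def proj_space_iff)
  then show thesis using proj_space_coord that by (metis less_Suc_eq_le Suc_eq_plus1)
qed

lemma linform_vanishing:
  assumes H: "hyperplane_eq n a H" and zero: "\<And>x. x \<in> H \<Longrightarrow> linform n c x = 0"
  shows "\<exists>d. \<forall>t<n + 1. c t = d * a $ t"
proof -
  obtain s where s: "s < n + 1" "a $ s \<noteq> 0" using hyperplane_eq_coord[OF H] .
  have "c t = c s / a $ s * a $ t" if t: "t < n + 1" for t
  proof (cases "t = s")
    case False
    \<comment> \<open>\<open>e_t + z e_s\<close> lies on the hyperplane and isolates the coefficient
      at \<open>t\<close>.\<close>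
    define z where "z = - (a $ t / a $ s)"
    let ?x = "vec (n + 1) (\<lambda>j. if j = t then 1 else if j = s then z else 0)"
    have lf: "linform n b ?x = b t + b s * z" for b
    proof -
      have "linform n b ?x = (\<Sum>j<n + 1. (if j = t then b j else 0) + (if j = s then b j * z else 0))"
        unfolding linform_def using False by (intro sum.cong) auto
      then show ?thesis using s t by (simp add: sum.distrib)
    qed
    have "?x $ t = 1" using t by simp
    then have "?x \<noteq> 0\<^sub>v (n + 1)" using t by (metis index_zero_vec(1) zero_neq_one)
    then have "?x \<in> H"
      unfolding hyperplane_eq_linform[OF H] lf using s by (simp add: proj_space_iff z_def)
    then have "c t + c s * z = 0" using zero lf by metis
    then show ?thesis using s by (simp add: z_def eq_neg_iff_add_eq_0)
  qed (use s in simp)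
  then show ?thesis by blast
qed

lemma hyperplane_eq_proportional:
  assumes "hyperplane_eq n a H" "hyperplane_eq n b H"
  obtains d where "d \<noteq> 0" "\<And>t. t < n + 1 \<Longrightarrow> b $ t = d * a $ t"
proof -
  obtain d where d: "\<forall>t<n + 1. b $ t = d * a $ t"
    using linform_vanishing[OF assms(1), of "\<lambda>t. b $ t"] hyperplane_eq_linform[OF assms(2)] by blast
  moreover have "d \<noteq> 0" using hyperplane_eq_coord[OF assms(2)] d by (metis mult_zero_left)
  ultimately show thesis using that by blast
qed

lemma distinct_hyperplanes_independent:
  assumes H: "hyperplane_eq n a H" "hyperplane_eq n a' H'" "H \<noteq> H'"
    and rel: "\<And>t. t < n + 1 \<Longrightarrow> c * a $ t + d * a' $ t = 0"
  shows "c = 0 \<and> d = 0"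
proof -
  have lf: "c * linform n (\<lambda>t. a $ t) x + d * linform n (\<lambda>t. a' $ t) x = 0" for x
  proof -
    have "c * linform n (\<lambda>t. a $ t) x + d * linform n (\<lambda>t. a' $ t) x = (\<Sum>t<n + 1. (c * a $ t + d * a' $ t) * x $ t)"
      unfolding linform_def sum_distrib_left by (simp only: sum.distrib[symmetric] distrib_right mult.assoc)
    then show ?thesis using rel by simp
  qed
  obtain t t' where t: "t < n + 1" "a $ t \<noteq> 0" "t' < n + 1" "a' $ t' \<noteq> 0"
    using hyperplane_eq_coord[OF H(1)] hyperplane_eq_coord[OF H(2)] by metis
  have iff: "c = 0 \<longleftrightarrow> d = 0" using rel[OF t(1)] rel[OF t(3)] t by auto
  show ?thesis
  proof (rule ccontr)
    assume "\<not> ?thesis"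
    then have nz: "c \<noteq> 0" "d \<noteq> 0" using iff by auto
    have "linform n (\<lambda>t. a $ t) x = 0 \<longleftrightarrow> linform n (\<lambda>t. a' $ t) x = 0" for x
      using lf[of x] nz by auto
    then have "H = H'" using hyperplane_eq_linform[OF H(1)] hyperplane_eq_linform[OF H(2)] by blast
    then show False using H(3) by simp
  qed
qed

context steiner_bundle
begin

lemma unstable_section:
  assumes "H \<in> unstable_hyperplanes n S"
  obtains s i x m where "s \<in> bundle_sections n (dual_bundle S) H" "i \<in> idx S" "x \<in> H" "x \<in> chart S i"
    "m < brank S" "s i x $ m \<noteq> 0"
proof -
  have "\<exists>s\<in>bundle_sections n (dual_bundle S) H. \<exists>i\<in>idx S. \<exists>x\<in>H \<inter> chart S i. \<exists>m<brank S. s i x $ m \<noteq> 0"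
  proof (rule ccontr)
    assume "\<not> ?thesis"
    then have "\<exists>c. \<forall>i\<in>idx (dual_bundle S). \<forall>x\<in>H \<inter> chart (dual_bundle S) i. \<forall>m<brank (dual_bundle S).
        s i x $ m = (\<Sum>l<0. c l * ((b :: nat \<Rightarrow> 'j \<Rightarrow> complex vec \<Rightarrow> complex vec) l i x $ m))"
      if "s \<in> bundle_sections n (dual_bundle S) H" for s b
      using that by (auto simp: dual_bundle_def)
    \<comment> \<open>If all sections vanish on \<open>H\<close>, the empty family generates and the
      infimum is attained at 0.\<close>
    then have "h0 n (dual_bundle S) H \<le> enat 0"
      unfolding h0_def by (intro Inf_lower CollectI exI[of _ 0] conjI refl exI[of _ "\<lambda>_ _ _. 0\<^sub>v 0"]) auto
    then show False using assms by (simp add: unstable_hyperplanes_def zero_enat_def[symmetric])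
  qed
  then show thesis using that by blast
qed

text \<open>Through \<open>\<phi>\<close> a section over \<open>H\<close> becomes a regular map from
  \<open>H\<close> to \<open>W\<close>, hence a constant vector \<open>w\<close>. Exactness says
  that \<open>Tx x\<close> kills \<open>w\<close> for \<open>x\<close> in \<open>H\<close>; so for
  each \<open>r\<close> the linear form contracted from \<open>w\<close> vanishes on
  \<open>H\<close> and is a multiple \<open>i r\<close> of the equation.\<close>

lemma unstable_contracts:
  assumes H: "H \<in> unstable_hyperplanes n S" "hyperplane_eq n a H"
  shows "\<exists>w i. (\<exists>l<n + k. w l \<noteq> 0) \<and> contracts w (\<lambda>t. a $ t) i"
proof -
  let ?b = "brank S"
  obtain s i0 x0 m0 where s: "s \<in> bundle_sections n (dual_bundle S) H"
    and 0: "i0 \<in> idx S" "x0 \<in> H" "x0 \<in> chart S i0" "m0 < ?b" "s i0 x0 $ m0 \<noteq> 0"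
    by (rule unstable_section[OF H(1)]) (rule that, assumption+)
  have Hp: "H \<subseteq> proj_space n" using hyperplane_eq_linform[OF H(2)] by blast
  have s_carrier: "s i x \<in> carrier_vec ?b" if "i \<in> idx S" "x \<in> H" "x \<in> chart S i" for i x
    using bundle_sectionsD(2)[OF s, of i x] that by (simp add: dual_bundle_def)
  have s_reg: "regular_on n 0 (H \<inter> chart S i) (\<lambda>x. s i x $ m)" if "i \<in> idx S" "m < ?b" for i m
    using bundle_sectionsD(3)[OF s, of i m] that by (simp add: dual_bundle_def)
  have s_trans: "s i x = transpose_mat (transition S j i x) *\<^sub>v s j x"
    if "i \<in> idx S" "j \<in> idx S" "x \<in> H" "x \<in> chart S i" "x \<in> chart S j" for i j x
    using bundle_sectionsD(4)[OF s, of i j x] that by (simp add: dual_bundle_def)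
  define W where "W i x l = (\<Sum>m<?b. F i x l m * s i x $ m)" for i x l
  have W_indep: "W i x l = W j x l"
    if ij: "i \<in> idx S" "j \<in> idx S" "x \<in> H" "x \<in> chart S i" "x \<in> chart S j" and l: "l < n + k" for i j x l
  proof -
    have g: "transition S j i x \<in> carrier_mat ?b ?b" using transition_carrier ij by blast
    have "W i x l = (\<Sum>m<?b. \<Sum>m'<?b. F i x l m * transition S j i x $$ (m', m) * s j x $ m')"
      unfolding W_def
    proof (intro sum.cong refl)
      fix m assume "m \<in> {..<?b}"
      then have "s i x $ m = (\<Sum>m'<?b. transition S j i x $$ (m', m) * s j x $ m')"
        unfolding s_trans[OF ij] using mat_vec_sum[OF transpose_carrier_mat[THEN iffD2, OF g] s_carrier[OF ij(2,3,5)], of m] g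
        by simp
      then show "F i x l m * s i x $ m = (\<Sum>m'<?b. F i x l m * transition S j i x $$ (m', m) * s j x $ m')"
        by (simp add: sum_distrib_left mult.assoc)
    qed
    also have "\<dots> = (\<Sum>m'<?b. (\<Sum>m<?b. F i x l m * transition S j i x $$ (m', m)) * s j x $ m')"
      by (subst sum.swap) (simp add: sum_distrib_right)
    also have "\<dots> = W j x l"
      unfolding W_def using F_transition[OF ij(1,2,4,5) l] by simp
    finally show ?thesis .
  qed
  define V where "V x l = W (SOME i. i \<in> idx S \<and> x \<in> chart S i) x l" for x l
  have V: "V x l = W i x l" if "i \<in> idx S" "x \<in> H" "x \<in> chart S i" "l < n + k" for i x l
  proof -
    have "(SOME i. i \<in> idx S \<and> x \<in> chart S i) \<in> idx S \<and> x \<in> chart S (SOME i. i \<in> idx S \<and> x \<in> chart S i)"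
      by (rule someI[of _ i]) (use that in auto)
    then show ?thesis unfolding V_def using W_indep that by blast
  qed
  have "regular_on n 0 H (\<lambda>x. V x l)" if l: "l < n + k" for l
  proof (rule regular_on_local)
    fix x assume x: "x \<in> H"
    then obtain i where i: "i \<in> idx S" "x \<in> chart S i" using Hp chart_cover by blast
    have sub: "chart S i \<inter> H \<subseteq> proj_space n" using Hp by blast
    have "regular_on n 0 (chart S i \<inter> H) (\<lambda>x. W i x l)"
      unfolding W_def
    proof (rule regular_on_sum[OF sub], rule regular_on_mult0)
      fix m assume "m \<in> {..<?b}"
      then show "regular_on n 0 (chart S i \<inter> H) (\<lambda>x. F i x l m)" "regular_on n 0 (chart S i \<inter> H) (\<lambda>x. s i x $ m)"
        using regular_on_subset[OF F_regular[OF i(1) l]] s_reg[OF i(1)] by (simp_all add: Int_commute)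
    qed
    then have "regular_on n 0 (chart S i \<inter> H) (\<lambda>x. V x l)"
      by (rule regular_on_cong) (use V[OF i(1)] l in simp)
    then show "\<exists>U. zariski_open n U \<and> x \<in> U \<and> regular_on n 0 (U \<inter> H) (\<lambda>x. V x l)"
      using chart_open[OF i(1)] i(2) by blast
  qed
  then have const: "V x l = V x0 l" if "x \<in> H" "l < n + k" for x l
    using regular_on_hyperplane_const[OF _ H(2) that(1) 0(2)] that(2) by blast
  define w where "w l = V x0 l" for l
  have "\<exists>l<n + k. w l \<noteq> 0"
  proof (rule ccontr)
    assume "\<not> ?thesis"
    then have "(\<Sum>m<?b. F i0 x0 l m * s i0 x0 $ m) = 0" if "l < n + k" for l
      using V[OF 0(1-3) that] that by (simp add: w_def W_def)
    then show False using F_injective[OF 0(1,3) _ 0(4)] 0(5) by blast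
  qed
  have Tw: "(\<Sum>l<n + k. Tx x r l * w l) = 0" if x: "x \<in> H" and r: "r < k" for x r
  proof -
    obtain i where i: "i \<in> idx S" "x \<in> chart S i" using x Hp chart_cover by blast
    have "(\<Sum>l<n + k. Tx x r l * w l) = (\<Sum>l<n + k. \<Sum>m<?b. s i x $ m * (Tx x r l * F i x l m))"
    proof (intro sum.cong refl)
      fix l assume "l \<in> {..<n + k}"
      then have "w l = W i x l" using const[OF x] V[OF i(1) x i(2)] by (simp add: w_def)
      then show "Tx x r l * w l = (\<Sum>m<?b. s i x $ m * (Tx x r l * F i x l m))"
        by (simp add: W_def sum_distrib_left ac_simps)
    qed
    also have "\<dots> = (\<Sum>m<?b. s i x $ m * (\<Sum>l<n + k. Tx x r l * F i x l m))"
      by (subst sum.swap) (simp add: sum_distrib_left)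
    also have "\<dots> = 0" using Tx_F_zero[OF i r] by simp
    finally show ?thesis .
  qed
  have lf: "linform n (\<lambda>t. \<Sum>l<n + k. T t r l * w l) x = (\<Sum>l<n + k. Tx x r l * w l)" for r x
    unfolding linform_def Tx_def sum_distrib_right by (subst sum.swap) (simp add: ac_simps)
  have ex: "\<exists>d. \<forall>t<n + 1. (\<Sum>l<n + k. T t r l * w l) = d * a $ t" if "r < k" for r
    by (rule linform_vanishing[OF H(2)]) (simp only: lf Tw[OF _ that])
  have "\<forall>r. \<exists>d. r < k \<longrightarrow> (\<forall>t<n + 1. (\<Sum>l<n + k. T t r l * w l) = d * a $ t)"
  proof
    fix r
    show "\<exists>d. r < k \<longrightarrow> (\<forall>t<n + 1. (\<Sum>l<n + k. T t r l * w l) = d * a $ t)"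
    proof (cases "r < k")
      case True
      from ex[OF this] show ?thesis by (elim exE) (rule exI, rule impI, assumption)
    qed simp
  qed
  then obtain i where "\<forall>r. r < k \<longrightarrow> (\<forall>t<n + 1. (\<Sum>l<n + k. T t r l * w l) = i r * a $ t)"
    unfolding choice_iff by (elim exE)
  then have "contracts w (\<lambda>t. a $ t) i" by (simp add: contracts_def mult.commute)
  with \<open>\<exists>l<n + k. w l \<noteq> 0\<close> show ?thesis by blast
qed

text \<open>A hyperplane in a zero-dimensional projective space is empty and carries no non-zero
  section.\<close>

lemma unstable_dim_pos:
  assumes "H \<in> unstable_hyperplanes n S"
  shows "0 < n"
proof (rule ccontr)
  assume "\<not> 0 < n"
  then have n: "n = 0" by simp
  obtain a where a: "hyperplane_eq n a H"
    using assms by (auto simp: unstable_hyperplanes_def hyperplane_def)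
  obtain x where x: "x \<in> H" using unstable_section[OF assms] by metis
  obtain t where t: "t < n + 1" "a $ t \<noteq> 0" using hyperplane_eq_coord[OF a] .
  have x': "x \<in> proj_space n" "linform n (\<lambda>t. a $ t) x = 0" using x hyperplane_eq_linform[OF a] by auto
  obtain c where "c \<le> n" "x $ c \<noteq> 0" using proj_space_coord[OF x'(1)] .
  then show False using x'(2) t n by (simp add: linform_def)
qed

text \<open>Distinct hyperplanes have pairwise independent equations;
  \<open>normal_crossing_of_pairwise\<close> does the rest.\<close>

lemma unstable_normal_crossing:
  assumes k: "2 \<le> k" and \<H>: "\<H> \<subseteq> unstable_hyperplanes n S" "finite \<H>"
  shows "normal_crossing n \<H>"
  unfolding normal_crossing_def
proof (intro conjI allI impI ballI)
  show "finite \<H>" by fact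
  show "hyperplane n H" if "H \<in> \<H>" for H using that \<H>(1) by (auto simp: unstable_hyperplanes_def)
  fix \<T> a c H
  assume T: "\<T> \<subseteq> \<H>" and a: "card \<T> \<le> n + 1 \<and> (\<forall>H\<in>\<T>. hyperplane_eq n (a H) H)"
    and c: "\<forall>i\<le>n. (\<Sum>H\<in>\<T>. c H * (a H $ i)) = 0" and H: "H \<in> \<T>"
  have "\<forall>H. \<exists>wi. H \<in> \<T> \<longrightarrow> (\<exists>l<n + k. fst wi l \<noteq> 0) \<and> contracts (fst wi) (\<lambda>t. a H $ t) (snd wi)"
  proof
    fix H
    show "\<exists>wi. H \<in> \<T> \<longrightarrow> (\<exists>l<n + k. fst wi l \<noteq> 0) \<and> contracts (fst wi) (\<lambda>t. a H $ t) (snd wi)"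
      using unstable_contracts[of H "a H"] T \<H>(1) a by (cases "H \<in> \<T>") (auto simp: subset_iff)
  qed
  then obtain wi where wi: "\<forall>H. H \<in> \<T> \<longrightarrow> (\<exists>l<n + k. fst (wi H) l \<noteq> 0) \<and> contracts (fst (wi H)) (\<lambda>t. a H $ t) (snd (wi H))"
    unfolding choice_iff by (elim exE)
  have "indep_on (n + 1) \<T> (\<lambda>H t. a H $ t)"
  proof (rule normal_crossing_of_pairwise[OF k, of _ "\<lambda>H. fst (wi H)" _ "\<lambda>H. snd (wi H)"])
    show "finite \<T>" using T \<H>(2) finite_subset by blast
    fix H H' c d
    assume "H \<in> \<T>" "H' \<in> \<T>" "H \<noteq> H'" "\<And>t. t < n + 1 \<Longrightarrow> c * a H $ t + d * a H' $ t = 0"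
    then show "c = 0 \<and> d = 0" using distinct_hyperplanes_independent[of n "a H" H "a H'" H' c d] a by blast
  qed (use a wi in auto)
  then show "c H = 0" using indep_onD[of "n + 1" \<T> _ c H] c H by simp
qed

end

lemma normal_crossing_indep:
  assumes "normal_crossing n \<H>" "\<T> \<subseteq> \<H>" "card \<T> \<le> n + 1" "\<And>H. H \<in> \<T> \<Longrightarrow> hyperplane_eq n (a H) H"
  shows "indep_on (n + 1) \<T> (\<lambda>H t. a H $ t)"
  unfolding indep_on_def
proof (intro allI impI)
  fix c assume c: "\<forall>t<n + 1. (\<Sum>H\<in>\<T>. c H * a H $ t) = 0"
  then have "\<forall>t\<le>n. (\<Sum>H\<in>\<T>. c H * a H $ t) = 0" by simp
  then show "\<forall>H\<in>\<T>. c H = 0" using assms unfolding normal_crossing_def by blast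
qed

context steiner_bundle
begin

text \<open>What the comparison uses for every \<open>k\<close>: the coefficients of the single
  relation are absorbed into \<open>w\<close> and \<open>i\<close>, and the last clause says that
  the \<open>w H\<close> span \<open>W\<close>.\<close>

definition log_data ::
    "complex vec set set \<Rightarrow> (complex vec set \<Rightarrow> complex vec) \<Rightarrow> (complex vec set \<Rightarrow> nat \<Rightarrow> complex) \<Rightarrow>
     (complex vec set \<Rightarrow> nat \<Rightarrow> complex) \<Rightarrow> bool" where
  "log_data \<H> a w i \<longleftrightarrow> (\<forall>H\<in>\<H>. hyperplane_eq n (a H) H \<and> contracts (w H) (\<lambda>t. a H $ t) (i H)) \<and>
    (\<forall>l<n + k. (\<Sum>H\<in>\<H>. w H l) = 0) \<and>
    (\<forall>\<xi>. (\<forall>H\<in>\<H>. dot (n + k) (w H) \<xi> = 0) \<longrightarrow> (\<forall>l<n + k. \<xi> l = 0))"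

text \<open>For \<open>k = 0\<close> contraction is an empty condition and a spanning family with
  sum zero is written down; for \<open>k = 1\<close> the tensor is an invertible square matrix, so
  each equation is contracted from some \<open>w\<close>; for \<open>k \<ge> 2\<close> the
  hyperplanes are unstable. In the last two cases \<open>full_relation\<close> supplies the
  relation.\<close>

lemma log_data_exists:
  assumes n: "0 < n" and nc: "normal_crossing n \<H>" and card: "card \<H> = n + k + 1"
    and unst: "2 \<le> k \<Longrightarrow> \<H> \<subseteq> unstable_hyperplanes n S"
  shows "\<exists>a w i. log_data \<H> a w i"
proof -
  have fin: "finite \<H>" and hyp: "\<And>H. H \<in> \<H> \<Longrightarrow> hyperplane n H"
    using nc by (auto simp: normal_crossing_def)
  have "\<forall>H. \<exists>a. H \<in> \<H> \<longrightarrow> hyperplane_eq n a H" using hyp by (auto simp: hyperplane_def)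
  then obtain a where a: "\<And>H. H \<in> \<H> \<Longrightarrow> hyperplane_eq n (a H) H" by metis
  show ?thesis
  proof (cases "k = 0")
    case True
    obtain h where h: "bij_betw h {..<n + 1} \<H>"
      using ex_bij_betw_nat_finite[OF fin] card True by (auto simp: atLeast0LessThan)
    define g where "g = the_inv_into {..<n + 1} h"
    \<comment> \<open>The standard basis of an \<open>n\<close>-dimensional space and, for the
      hyperplane numbered \<open>n\<close>, minus its sum.\<close>
    define w where "w H l = (if g H = n then - 1 else if g H = l then 1 else 0 :: complex)" for H l
    have gh: "g (h t) = t" if "t < n + 1" for t
      using that h unfolding g_def by (intro the_inv_into_f_f) (auto simp: bij_betw_def)
    have "(\<Sum>H\<in>\<H>. w H l) = 0" if "l < n + k" for l
    proof -
      have "(\<Sum>H\<in>\<H>. w H l) = (\<Sum>t<n + 1. w (h t) l)" by (rule sum.reindex_bij_betw[OF h, symmetric])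
      also have "\<dots> = (\<Sum>t<n + 1. (if t = n then - 1 else if t = l then 1 else 0))"
        by (intro sum.cong refl) (simp add: w_def gh)
      also have "\<dots> = (\<Sum>t<n. (if t = l then 1 else 0)) - 1" by simp
      also have "\<dots> = 0" using that True by simp
      finally show ?thesis .
    qed
    moreover have "\<xi> l = 0" if \<xi>: "\<forall>H\<in>\<H>. dot (n + k) (w H) \<xi> = 0" and l: "l < n + k" for \<xi> l
    proof -
      have hl: "h l \<in> \<H>" using h l True by (auto simp: bij_betw_def)
      have "dot (n + k) (w (h l)) \<xi> = (\<Sum>l'<n + k. if l = l' then \<xi> l' else 0)"
        unfolding dot_def using l True by (intro sum.cong refl) (simp add: w_def gh)
      also have "\<dots> = \<xi> l" using l by simp
      finally show ?thesis using \<xi> hl by simp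
    qed
    ultimately have "log_data \<H> a w (\<lambda>_ _. 0)"
      unfolding log_data_def contracts_def using a True by simp
    then show ?thesis by blast
  next
    case False
    then have k: "0 < k" by simp
    have "\<forall>H. \<exists>wi. H \<in> \<H> \<longrightarrow> (\<exists>l<n + k. fst wi l \<noteq> 0) \<and> contracts (fst wi) (\<lambda>t. a H $ t) (snd wi)"
    proof
      fix H
      have "\<exists>w i. (\<exists>l<n + k. w l \<noteq> 0) \<and> contracts w (\<lambda>t. a H $ t) i" if H: "H \<in> \<H>"
      proof (cases "2 \<le> k")
        case True
        then show ?thesis using unstable_contracts unst H a by blast
      next
        case False
        then have k1: "k = 1" using k by simp
        have "\<exists>w. \<forall>t\<in>{..<n + 1}. (\<Sum>l<n + 1. T t 0 l * w l) = a H $ t"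
        proof (rule square_system_solvable)
          fix u assume u: "\<And>t. t \<in> {..<n + 1} \<Longrightarrow> (\<Sum>l<n + 1. T t 0 l * u l) = 0"
          then have "contracts u (\<lambda>_. 0) (\<lambda>_. 0)" unfolding contracts_def by (simp add: k1)
          then show "\<forall>l\<in>{..<n + 1}. u l = 0"
            using contracts_nonzero(1)[OF k, of u "\<lambda>_. 0" "\<lambda>_. 0"] k1 by auto
        qed auto
        then obtain w where "\<forall>t\<in>{..<n + 1}. (\<Sum>l<n + 1. T t 0 l * w l) = a H $ t" ..
        then have w: "(\<Sum>l<n + 1. T t 0 l * w l) = a H $ t" if "t < n + 1" for t using that by blast
        obtain t where t: "t < n + 1" "a H $ t \<noteq> 0" using hyperplane_eq_coord[OF a[OF H]] .
        have "\<exists>l<n + k. w l \<noteq> 0"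
        proof (rule ccontr)
          assume "\<not> ?thesis"
          then have "(\<Sum>l<n + 1. T t 0 l * w l) = 0" by (intro sum.neutral) (auto simp: k1)
          then show False using w[OF t(1)] t(2) by simp
        qed
        moreover have "contracts w (\<lambda>t. a H $ t) (\<lambda>_. 1)" unfolding contracts_def using w by (simp add: k1)
        ultimately show ?thesis by blast
      qed
      then show "\<exists>wi. H \<in> \<H> \<longrightarrow> (\<exists>l<n + k. fst wi l \<noteq> 0) \<and> contracts (fst wi) (\<lambda>t. a H $ t) (snd wi)"
        by (cases "H \<in> \<H>") auto
    qed
    then obtain wi where wi: "\<forall>H. H \<in> \<H> \<longrightarrow> (\<exists>l<n + k. fst (wi H) l \<noteq> 0) \<and> contracts (fst (wi H)) (\<lambda>t. a H $ t) (snd (wi H))"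
      unfolding choice_iff by (elim exE)
    have ind: "indep_on (n + 1) \<T> (\<lambda>H t. a H $ t)" if "\<T> \<subseteq> \<H>" "card \<T> \<le> n + 1" for \<T>
      using normal_crossing_indep[OF nc that, of a] a that(1) by blast
    obtain c where c: "\<And>H. H \<in> \<H> \<Longrightarrow> c H \<noteq> 0" "\<And>l. l < n + k \<Longrightarrow> (\<Sum>H\<in>\<H>. c H * fst (wi H) l) = 0"
      "\<And>\<xi>. (\<And>H. H \<in> \<H> \<Longrightarrow> dot (n + k) (fst (wi H)) \<xi> = 0) \<Longrightarrow> \<forall>l<n + k. \<xi> l = 0"
      by (rule full_relation[OF n k fin card, of "\<lambda>H. fst (wi H)" "\<lambda>H t. a H $ t" "\<lambda>H. snd (wi H)"])
        (use wi ind in \<open>auto intro: that\<close>)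
    \<comment> \<open>Since no \<open>c H\<close> is zero, scaling by it keeps the span and turns
      the relation into \<open>\<Sum> w H = 0\<close>.\<close>
    define w where "w H l = c H * fst (wi H) l" for H l
    define i where "i H r = c H * snd (wi H) r" for H r
    have "contracts (w H) (\<lambda>t. a H $ t) (i H)" if "H \<in> \<H>" for H
    proof -
      have "(\<Sum>l<n + k. T t r l * w H l) = c H * (\<Sum>l<n + k. T t r l * fst (wi H) l)" for t r
        by (simp add: w_def sum_distrib_left ac_simps)
      then show ?thesis using wi that by (simp add: contracts_def i_def)
    qed
    moreover have "\<forall>l<n + k. \<xi> l = 0" if \<xi>: "\<forall>H\<in>\<H>. dot (n + k) (w H) \<xi> = 0" for \<xi>
    proof (rule c(3))
      fix H assume H: "H \<in> \<H>"
      have "dot (n + k) (w H) \<xi> = c H * dot (n + k) (fst (wi H)) \<xi>"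
        by (simp add: dot_def w_def sum_distrib_left mult.assoc)
      then show "dot (n + k) (fst (wi H)) \<xi> = 0" using \<xi> H c(1)[OF H] by simp
    qed
    ultimately have "log_data \<H> a w i" using a c(2) by (simp add: log_data_def w_def)
    then show ?thesis by blast
  qed
qed

end

section \<open>Comparison with the logarithmic sheaf\<close>

lemma dot_diff_right: "dot m u (\<lambda>l. v l - v' l) = dot m u v - dot m u v'"
  by (simp add: dot_def right_diff_distrib sum_subtractf)

lemma dot_cong_right: "(\<And>l. l < m \<Longrightarrow> v l = v' l) \<Longrightarrow> dot m u v = dot m u v'"
  by (simp add: dot_def)

locale log_bundle = steiner_bundle n k S \<phi> \<psi>
  for n k :: nat and S :: "'j vbundle" and \<phi> \<psi> +
  fixes \<H> :: "complex vec set set" and a :: "complex vec set \<Rightarrow> complex vec"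
    and w \<iota> :: "complex vec set \<Rightarrow> nat \<Rightarrow> complex"
  assumes n_pos: "0 < n" and fin: "finite \<H>" and card_H: "card \<H> = n + k + 1"
    and nc: "normal_crossing n \<H>" and data: "log_data \<H> a w \<iota>"
begin

abbreviation N where "N \<equiv> n + k"
abbreviation b where "b \<equiv> brank S"

definition \<alpha> where "\<alpha> H x = linform n (\<lambda>t. a H $ t) x"

text \<open>Component \<open>t\<close> of the form \<open>\<Sum> \<xi>(w H) d log a H\<close>,
  pulled back to the cone; \<open>dot N (w H) \<xi>\<close> is its residue along
  \<open>H\<close>.\<close>

definition Om :: "(nat \<Rightarrow> complex) \<Rightarrow> complex vec \<Rightarrow> nat \<Rightarrow> complex" where
  "Om \<xi> x t = (\<Sum>H\<in>\<H>. dot N (w H) \<xi> * (a H $ t / \<alpha> H x))"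

text \<open>The image in the fibre of \<open>S\<close> of a vector \<open>\<xi>\<close> from the
  dual of \<open>W\<close>, in the coordinates of chart \<open>i\<close>.\<close>

definition sm :: "(nat \<Rightarrow> complex) \<Rightarrow> 'j \<Rightarrow> complex vec \<Rightarrow> nat \<Rightarrow> complex" where
  "sm \<xi> i x m = (\<Sum>l<N. F i x l m * \<xi> l)"

lemma eq_H: "H \<in> \<H> \<Longrightarrow> hyperplane_eq n (a H) H"
  and contr: "H \<in> \<H> \<Longrightarrow> contracts (w H) (\<lambda>t. a H $ t) (\<iota> H)"
  and sum_w: "l < N \<Longrightarrow> (\<Sum>H\<in>\<H>. w H l) = 0"
  using data by (simp_all add: log_data_def)

lemma spanning:
  assumes "\<And>H. H \<in> \<H> \<Longrightarrow> dot N (w H) \<xi> = 0" "l < N"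
  shows "\<xi> l = 0"
proof -
  have "\<forall>\<xi>. (\<forall>H\<in>\<H>. dot N (w H) \<xi> = 0) \<longrightarrow> (\<forall>l<N. \<xi> l = 0)" using data unfolding log_data_def by (elim conjE)
  then have "(\<forall>H\<in>\<H>. dot N (w H) \<xi> = 0) \<longrightarrow> (\<forall>l<N. \<xi> l = 0)" ..
  then show ?thesis using assms by simp
qed

lemma indep_a: "\<T> \<subseteq> \<H> \<Longrightarrow> card \<T> \<le> n + 1 \<Longrightarrow> indep_on (n + 1) \<T> (\<lambda>H t. a H $ t)"
  using normal_crossing_indep[OF nc, of \<T> a] eq_H by blast

lemma \<alpha>_zero_iff: "H \<in> \<H> \<Longrightarrow> x \<in> proj_space n \<Longrightarrow> \<alpha> H x = 0 \<longleftrightarrow> x \<in> H"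
  using hyperplane_eq_linform[OF eq_H] by (simp add: \<alpha>_def)

lemma \<alpha>_off: "H \<in> \<H> \<Longrightarrow> x \<in> proj_space n \<Longrightarrow> x \<notin> \<Union>\<H> \<Longrightarrow> \<alpha> H x \<noteq> 0"
  using \<alpha>_zero_iff by blast

lemma sum_dot_w: "(\<Sum>H\<in>\<H>. dot N (w H) \<xi>) = 0"
proof -
  have "(\<Sum>H\<in>\<H>. dot N (w H) \<xi>) = (\<Sum>l<N. (\<Sum>H\<in>\<H>. w H l) * \<xi> l)"
    unfolding dot_def sum_distrib_right by (rule sum.swap)
  then show ?thesis using sum_w by simp
qed

lemma B_Tx: "B (\<lambda>t. x $ t) y l = (\<Sum>r<k. y r * Tx x r l)"
  unfolding B_def Tx_def sum_distrib_left by (subst sum.swap) (simp add: ac_simps)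

lemma dot_B: "H \<in> \<H> \<Longrightarrow> dot N (w H) (B (\<lambda>t. x $ t) y) = \<alpha> H x * dot k (\<iota> H) y"
  using contracts_B[OF contr] by (simp add: \<alpha>_def linform_def dot_def)

lemma relation_a:
  assumes "t < n + 1"
  shows "(\<Sum>H\<in>\<H>. dot k (\<iota> H) y * a H $ t) = 0"
proof -
  have rel: "(\<Sum>H\<in>\<H>. a H $ t * \<iota> H r) = 0" if "r < k" for r
    using contracts_relation[of \<H> w "\<lambda>H t. a H $ t" \<iota> "\<lambda>_. 1" t r] contr sum_w assms that
    by (simp add: mult.commute)
  have "(\<Sum>H\<in>\<H>. dot k (\<iota> H) y * a H $ t) = dot k (\<lambda>r. \<Sum>H\<in>\<H>. a H $ t * \<iota> H r) y"
    unfolding dot_sum_left by (simp add: mult.commute)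
  also have "\<dots> = 0" by (rule dot_zero_left) (rule rel)
  finally show ?thesis .
qed

text \<open>For \<open>\<xi> = B x y\<close> the residues are
  \<open>\<alpha> H x * dot k (\<iota> H) y\<close>: the poles cancel and the contracted relation
  remains.\<close>

lemma Om_B:
  assumes "x \<in> proj_space n" "x \<notin> \<Union>\<H>" "t < n + 1"
  shows "Om (B (\<lambda>t. x $ t) y) x t = 0"
proof -
  have "Om (B (\<lambda>t. x $ t) y) x t = (\<Sum>H\<in>\<H>. dot k (\<iota> H) y * a H $ t)"
    unfolding Om_def by (intro sum.cong refl) (simp add: dot_B \<alpha>_off[OF _ assms(1,2)])
  then show ?thesis using relation_a[OF assms(3)] by simp
qed

lemma Om_cong: "(\<And>l. l < N \<Longrightarrow> \<xi> l = \<xi>' l) \<Longrightarrow> Om \<xi> x t = Om \<xi>' x t"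
  unfolding Om_def using dot_cong_right[of N \<xi> \<xi>'] by simp

lemma Om_diff: "Om (\<lambda>l. \<xi> l - \<xi>' l) x t = Om \<xi> x t - Om \<xi>' x t"
  by (simp only: Om_def dot_diff_right left_diff_distrib sum_subtractf)

lemma sm_diff: "sm (\<lambda>l. \<xi> l - \<xi>' l) i x m = sm \<xi> i x m - sm \<xi>' i x m"
  by (simp add: sm_def right_diff_distrib sum_subtractf)

text \<open>The \<open>\<mu> H\<close> are the coefficients of a relation between the
  \<open>n + k + 1\<close> equations. By normal crossing such a relation is determined by its values
  off \<open>n + 1\<close> of them. Matching these \<open>k\<close> values by
  \<open>dot k (\<iota> H) y\<close> is a square system for \<open>y\<close>, injective because the
  tensor is nonsingular.\<close>

lemma Om_kernel:
  assumes x: "x \<in> proj_space n" "x \<notin> \<Union>\<H>" and zero: "\<And>t. t < n + 1 \<Longrightarrow> Om \<xi> x t = 0"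
  shows "\<exists>y. \<forall>l<N. \<xi> l = B (\<lambda>t. x $ t) y l"
proof -
  define \<mu> where "\<mu> H = dot N (w H) \<xi> / \<alpha> H x" for H
  have rel: "(\<Sum>H\<in>\<H>. \<mu> H * a H $ t) = 0" if "t < n + 1" for t
    using zero[OF that] by (simp add: Om_def \<mu>_def)
  obtain J where J: "J \<subseteq> \<H>" "card J = n + 1"
    using card_H by (metis add.commute le_add2 obtain_subset_with_card_n add.assoc)
  have indJ: "indep_on (n + 1) J (\<lambda>H t. a H $ t)" using indep_a[OF J(1)] J(2) by simp
  have fJ: "finite J" using J(1) fin finite_subset by blast
  have restrict: "c H = 0" if c: "\<And>t. t < n + 1 \<Longrightarrow> (\<Sum>H\<in>\<H>. c H * a H $ t) = 0"
    and off: "\<And>H. H \<in> \<H> - J \<Longrightarrow> c H = 0" and H: "H \<in> \<H>" for c :: "complex vec set \<Rightarrow> complex" and H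
  proof (cases "H \<in> J")
    case True
    have "(\<Sum>H\<in>J. c H * a H $ t) = 0" if "t < n + 1" for t
    proof -
      have "(\<Sum>H\<in>\<H>. c H * a H $ t) = (\<Sum>H\<in>J. c H * a H $ t)"
        using J(1) fin off by (intro sum.mono_neutral_right) auto
      then show ?thesis using c[OF that] by simp
    qed
    then show ?thesis using indep_onD[OF indJ _ True] by blast
  qed (use off H in blast)
  have "\<exists>y. \<forall>H\<in>\<H> - J. (\<Sum>r<k. \<iota> H r * y r) = \<mu> H"
  proof (rule square_system_solvable)
    show "card (\<H> - J) \<le> card {..<k}" using J fJ card_H by (simp add: card_Diff_subset)
    fix y assume y: "\<And>H. H \<in> \<H> - J \<Longrightarrow> (\<Sum>r<k. \<iota> H r * y r) = 0"
    have d: "dot k (\<iota> H) y = 0" if "H \<in> \<H>" for H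
      by (rule restrict[OF relation_a _ that]) (use y in \<open>auto simp: dot_def\<close>)
    have Bz: "B (\<lambda>t. x $ t) y l = 0" if "l < N" for l
      by (rule spanning[OF _ that]) (simp add: dot_B d)
    show "\<forall>r\<in>{..<k}. y r = 0"
    proof (rule ccontr)
      assume "\<not> ?thesis"
      then have "\<exists>r<k. y r \<noteq> 0" by auto
      moreover have "\<exists>t<n + 1. x $ t \<noteq> 0" using proj_space_coord[OF x(1)] by (metis less_Suc_eq_le Suc_eq_plus1)
      ultimately have "\<exists>l<N. B (\<lambda>t. x $ t) y l \<noteq> 0" unfolding B_def by (intro nonsingular)
      then show False using Bz by blast
    qed
  qed (use fin in auto)
  then obtain y where "\<forall>H\<in>\<H> - J. (\<Sum>r<k. \<iota> H r * y r) = \<mu> H" ..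
  then have y: "dot k (\<iota> H) y = \<mu> H" if "H \<in> \<H> - J" for H using that by (simp add: dot_def)
  have \<mu>: "\<mu> H - dot k (\<iota> H) y = 0" if "H \<in> \<H>" for H
  proof (rule restrict[OF _ _ that])
    show "(\<Sum>H\<in>\<H>. (\<mu> H - dot k (\<iota> H) y) * a H $ t) = 0" if "t < n + 1" for t
      using rel[OF that] relation_a[OF that, of y] by (simp add: left_diff_distrib sum_subtractf)
  qed (simp add: y)
  have "\<xi> l - B (\<lambda>t. x $ t) y l = 0" if l: "l < N" for l
  proof (rule spanning[OF _ l])
    fix H assume H: "H \<in> \<H>"
    have "dot N (w H) \<xi> = \<mu> H * \<alpha> H x" using \<alpha>_off[OF H x] by (simp add: \<mu>_def)
    then show "dot N (w H) (\<lambda>l. \<xi> l - B (\<lambda>t. x $ t) y l) = 0"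
      using \<mu>[OF H] by (simp add: dot_diff_right dot_B[OF H])
  qed
  then show ?thesis by (intro exI[of _ y]) simp
qed

lemma sm_zero_iff_Om_zero:
  assumes x: "x \<notin> \<Union>\<H>" and i: "i \<in> idx S" "x \<in> chart S i"
  shows "(\<forall>m<b. sm \<xi> i x m = 0) \<longleftrightarrow> (\<forall>t<n + 1. Om \<xi> x t = 0)"
proof
  have xp: "x \<in> proj_space n" using chart_sub i by blast
  assume "\<forall>m<b. sm \<xi> i x m = 0"
  then obtain y where "\<forall>l<N. \<xi> l = (\<Sum>r<k. y r * Tx x r l)"
    using annihilator_of_image[OF i, of \<xi>] unfolding sm_def by auto
  then have "Om \<xi> x t = Om (B (\<lambda>t. x $ t) y) x t" for t by (intro Om_cong) (simp add: B_Tx)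
  then show "\<forall>t<n + 1. Om \<xi> x t = 0" using Om_B[OF xp x] by simp
next
  have xp: "x \<in> proj_space n" using chart_sub i by blast
  assume "\<forall>t<n + 1. Om \<xi> x t = 0"
  then obtain y where y: "\<forall>l<N. \<xi> l = B (\<lambda>t. x $ t) y l" using Om_kernel[OF xp x, of \<xi>] by auto
  show "\<forall>m<b. sm \<xi> i x m = 0"
  proof (intro allI impI)
    fix m assume m: "m < b"
    have "sm \<xi> i x m = (\<Sum>l<N. \<Sum>r<k. y r * (Tx x r l * F i x l m))"
      unfolding sm_def by (intro sum.cong refl) (simp add: y B_Tx sum_distrib_left ac_simps)
    also have "\<dots> = (\<Sum>r<k. y r * (\<Sum>l<N. Tx x r l * F i x l m))"
      by (subst sum.swap) (simp add: sum_distrib_left)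
    also have "\<dots> = 0" using Tx_F_zero[OF i _ m] by simp
    finally show "sm \<xi> i x m = 0" .
  qed
qed

lemma sm_eq_iff_Om_eq:
  assumes "x \<notin> \<Union>\<H>" "i \<in> idx S" "x \<in> chart S i"
  shows "(\<forall>m<b. sm \<xi> i x m = sm \<xi>' i x m) \<longleftrightarrow> (\<forall>t<n + 1. Om \<xi> x t = Om \<xi>' x t)"
  using sm_zero_iff_Om_zero[OF assms, of "\<lambda>l. \<xi> l - \<xi>' l"] by (simp add: sm_diff Om_diff)

lemma sm_transition:
  assumes "i \<in> idx S" "j \<in> idx S" "x \<in> chart S i" "x \<in> chart S j" "m < b"
  shows "sm \<xi> j x m = (\<Sum>m'<b. transition S j i x $$ (m, m') * sm \<xi> i x m')"
proof -
  have "sm \<xi> j x m = (\<Sum>l<N. \<Sum>m'<b. transition S j i x $$ (m, m') * (F i x l m' * \<xi> l))"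
    unfolding sm_def by (intro sum.cong refl) (simp add: F_transition[OF assms(1-4) _ assms(5)] sum_distrib_left sum_distrib_right ac_simps)
  also have "\<dots> = (\<Sum>m'<b. transition S j i x $$ (m, m') * sm \<xi> i x m')"
    unfolding sm_def sum_distrib_left by (rule sum.swap)
  finally show ?thesis .
qed

text \<open>The Euler field turns each summand into its residue, and the residues sum to
  zero.\<close>

lemma Om_euler:
  assumes "x \<in> proj_space n" "x \<notin> \<Union>\<H>"
  shows "(\<Sum>t<n + 1. Om \<xi> x t * x $ t) = 0"
proof -
  have "(\<Sum>t<n + 1. Om \<xi> x t * x $ t) = (\<Sum>t<n + 1. \<Sum>H\<in>\<H>. dot N (w H) \<xi> / \<alpha> H x * (a H $ t * x $ t))"
    unfolding Om_def sum_distrib_right by (intro sum.cong refl) (simp add: ac_simps)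
  also have "\<dots> = (\<Sum>H\<in>\<H>. dot N (w H) \<xi> / \<alpha> H x * \<alpha> H x)"
    by (subst sum.swap) (simp only: \<alpha>_def linform_def sum_distrib_left)
  also have "\<dots> = (\<Sum>H\<in>\<H>. dot N (w H) \<xi>)"
    by (intro sum.cong refl) (simp add: \<alpha>_off[OF _ assms])
  finally show ?thesis by (simp add: sum_dot_w)
qed

text \<open>Residues with sum zero can be prescribed at will. Leaving out \<open>H0\<close> gives
  \<open>n + k\<close> vectors that still span and a square system for a dual basis; the residue at
  \<open>H0\<close> is then forced.\<close>

lemma dual_vectors:
  obtains D where "\<And>c H. (\<Sum>H\<in>\<H>. c H) = 0 \<Longrightarrow> H \<in> \<H> \<Longrightarrow>
    dot N (w H) (\<lambda>l. \<Sum>H'\<in>\<H>. c H' * D H' l) = c H"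
proof -
  obtain H0 where H0: "H0 \<in> \<H>" using card_H by fastforce
  have ex: "\<exists>u. \<forall>H\<in>\<H> - {H0}. (\<Sum>l<N. w H l * u l) = (if H = H1 then 1 else 0)" for H1
  proof (rule square_system_solvable)
    show "card (\<H> - {H0}) \<le> card {..<N}" using H0 fin card_H by simp
    fix u assume u: "\<And>H. H \<in> \<H> - {H0} \<Longrightarrow> (\<Sum>l<N. w H l * u l) = 0"
    have "dot N (w H) u = 0" if "H \<in> \<H>" for H
    proof (cases "H = H0")
      case True
      have "0 = dot N (w H0) u + (\<Sum>H\<in>\<H> - {H0}. dot N (w H) u)"
        using sum_dot_w[of u] sum.remove[OF fin H0, of "\<lambda>H. dot N (w H) u"] by simp
      also have "(\<Sum>H\<in>\<H> - {H0}. dot N (w H) u) = 0" using u by (intro sum.neutral) (simp add: dot_def)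
      finally show ?thesis using True by simp
    qed (use u that in \<open>simp add: dot_def\<close>)
    then show "\<forall>l\<in>{..<N}. u l = 0" using spanning[of u] by blast
  qed (use fin in auto)
  have "\<exists>D. \<forall>H1. \<forall>H\<in>\<H> - {H0}. (\<Sum>l<N. w H l * D H1 l) = (if H = H1 then 1 else 0)"
    by (intro choice allI ex)
  then obtain D where "\<forall>H1. \<forall>H\<in>\<H> - {H0}. (\<Sum>l<N. w H l * D H1 l) = (if H = H1 then 1 else 0)" ..
  then have D: "dot N (w H) (D H1) = (if H = H1 then 1 else 0)" if "H \<in> \<H> - {H0}" for H H1
    using that by (simp add: dot_def)
  have lin: "dot N u (\<lambda>l. \<Sum>H'\<in>\<H>. c H' * D H' l) = (\<Sum>H'\<in>\<H>. c H' * dot N u (D H'))" for u c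
    unfolding dot_def sum_distrib_left by (subst sum.swap) (simp add: ac_simps)
  have "dot N (w H) (\<lambda>l. \<Sum>H'\<in>\<H>. c H' * D H' l) = c H" if c: "(\<Sum>H\<in>\<H>. c H) = 0" and H: "H \<in> \<H>" for c H
  proof -
    let ?\<xi> = "\<lambda>l. \<Sum>H'\<in>\<H>. c H' * D H' l"
    have other: "dot N (w H) ?\<xi> = c H" if "H \<in> \<H> - {H0}" for H
      unfolding lin using D[OF that] that fin by (simp add: if_distrib[of "\<lambda>x. _ * x"] cong: if_cong)
    show ?thesis
    proof (cases "H = H0")
      case True
      have "dot N (w H0) ?\<xi> = - (\<Sum>H\<in>\<H> - {H0}. dot N (w H) ?\<xi>)"
        using sum_dot_w[of ?\<xi>] sum.remove[OF fin H0, of "\<lambda>H. dot N (w H) ?\<xi>"] by (simp add: eq_neg_iff_add_eq_0)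
      also have "\<dots> = - (\<Sum>H\<in>\<H> - {H0}. c H)" using other by simp
      also have "\<dots> = c H0" using c sum.remove[OF fin H0, of c] by (simp add: neg_eq_iff_add_eq_0 add.commute)
      finally show ?thesis using True by simp
    qed (use other H in blast)
  qed
  then show thesis by (rule that)
qed

lemma point_off_hyperplanes:
  obtains x where "x \<in> proj_space n" "(\<Prod>H\<in>\<H>. \<alpha> H x) \<noteq> 0"
proof -
  \<comment> \<open>The point is sought on the moment curve \<open>(1, s, ..., s ^ n)\<close>, where
    each equation is a non-zero polynomial in \<open>s\<close>.\<close>
  define P where "P H = (\<Sum>t<n + 1. monom (a H $ t) t)" for H
  have "P H \<noteq> 0" if H: "H \<in> \<H>" for H
  proof -
    obtain t where t: "t < n + 1" "a H $ t \<noteq> 0" using hyperplane_eq_coord[OF eq_H[OF H]] .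
    have "coeff (P H) t = a H $ t" unfolding P_def coeff_sum using t by simp
    then show ?thesis using t by auto
  qed
  then have "(\<Prod>H\<in>\<H>. P H) \<noteq> 0" using fin by simp
  then obtain s where s: "poly (\<Prod>H\<in>\<H>. P H) s \<noteq> 0" using poly_all_0_iff_0 by blast
  let ?x = "vec (n + 1) (\<lambda>t. s ^ t)"
  have "?x $ 0 \<noteq> 0\<^sub>v (n + 1) $ 0" by simp
  then have "?x \<in> proj_space n" by (metis proj_space_iff vec_carrier)
  moreover have "\<alpha> H ?x = poly (P H) s" for H
    by (simp add: \<alpha>_def linform_def P_def poly_sum poly_monom del: sum.lessThan_Suc)
  ultimately show thesis using that[of ?x] s by (simp add: poly_prod)
qed

lemma regular_on_zero_off:
  assumes "regular_on n d U f" "zariski_open n U" "\<And>x. x \<in> U \<Longrightarrow> x \<notin> \<Union>\<H> \<Longrightarrow> f x = 0" "x \<in> U"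
  shows "f x = 0"
proof -
  obtain x1 where x1: "x1 \<in> proj_space n" "(\<Prod>H\<in>\<H>. \<alpha> H x1) \<noteq> 0" using point_off_hyperplanes .
  have "form n (card \<H>) (\<lambda>x. \<Prod>H\<in>\<H>. \<alpha> H x)" unfolding \<alpha>_def by (intro form_prod form_linform)
  then show ?thesis
  proof (rule regular_on_zero_extend[where g = "\<lambda>x. \<Prod>H\<in>\<H>. \<alpha> H x", OF assms(1,2) _ x1 _ assms(4)])
    fix y assume y: "y \<in> U" "(\<Prod>H\<in>\<H>. \<alpha> H y) \<noteq> 0"
    then have "y \<notin> \<Union>\<H>" using \<alpha>_zero_iff zariski_open_sub[OF assms(2)] fin by (fastforce simp: prod_zero_iff)
    then show "f y = 0" using assms(3) y by blast
  qed
qed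

text \<open>\<open>C\<close> inverts the matrix of \<open>n + 1\<close> equations, which normal
  crossing makes a basis of the linear forms.\<close>

lemma coordinates:
  assumes J: "J \<subseteq> \<H>" "card J = n + 1"
  obtains C where "\<And>v t. t < n + 1 \<Longrightarrow> (\<Sum>H\<in>J. (\<Sum>t'<n + 1. C H t' * v t') * a H $ t) = v t"
proof -
  have fJ: "finite J" using J(1) fin finite_subset by blast
  have ind: "indep_on (n + 1) J (\<lambda>H t. a H $ t)" using indep_a[OF J(1)] J(2) by simp
  have ex: "\<exists>u. \<forall>t\<in>{..<n + 1}. (\<Sum>H\<in>J. a H $ t * u H) = (if t = t' then 1 else 0)" for t'
  proof (rule square_system_solvable)
    fix u assume "\<And>t. t \<in> {..<n + 1} \<Longrightarrow> (\<Sum>H\<in>J. a H $ t * u H) = 0"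
    then have "(\<Sum>H\<in>J. u H * a H $ t) = 0" if "t < n + 1" for t using that by (simp only: mult.commute lessThan_iff)
    then show "\<forall>H\<in>J. u H = 0" using indep_onD[OF ind, of u] by blast
  qed (use fJ J in auto)
  have "\<exists>C. \<forall>t'. \<forall>t\<in>{..<n + 1}. (\<Sum>H\<in>J. a H $ t * C t' H) = (if t = t' then 1 else 0)"
    by (intro choice allI ex)
  then obtain C where C: "\<forall>t'. \<forall>t\<in>{..<n + 1}. (\<Sum>H\<in>J. a H $ t * C t' H) = (if t = t' then 1 else 0)" ..
  have "(\<Sum>H\<in>J. (\<Sum>t'<n + 1. C t' H * v t') * a H $ t) = v t" if t: "t < n + 1" for v t
  proof -
    have "(\<Sum>H\<in>J. (\<Sum>t'<n + 1. C t' H * v t') * a H $ t) = (\<Sum>t'<n + 1. v t' * (\<Sum>H\<in>J. a H $ t * C t' H))"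
      unfolding sum_distrib_left sum_distrib_right by (subst sum.swap) (simp only: ac_simps)
    also have "\<dots> = (\<Sum>t'<n + 1. v t' * (if t = t' then 1 else 0))"
      using C t by (intro sum.cong refl arg_cong2[of _ _ _ _ "(*)"]) blast
    also have "\<dots> = v t" using t by (simp add: if_distrib[of "\<lambda>x. _ * x"] cong: if_cong del: sum.lessThan_Suc)
    finally show ?thesis .
  qed
  then show thesis by (rule that)
qed

section \<open>Local lifts of sections and of logarithmic forms\<close>

lemma regular_on_Om:
  assumes V: "V \<subseteq> proj_space n" "V \<inter> \<Union>\<H> = {}" and \<xi>: "\<And>l. l < N \<Longrightarrow> regular_on n 0 V (\<lambda>x. \<xi> x l)"
  shows "regular_on n (- 1) V (\<lambda>x. Om (\<xi> x) x t)"
  unfolding Om_def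
proof (rule regular_on_sum[OF V(1)], rule regular_on_mult0)
  fix H assume H: "H \<in> \<H>"
  show "regular_on n 0 V (\<lambda>x. dot N (w H) (\<xi> x))"
    unfolding dot_def by (intro regular_on_sum[OF V(1)] regular_on_scale[OF V(1)] \<xi>) simp
  have "regular_on n (0 - 1) V (\<lambda>x. a H $ t / \<alpha> H x)"
    unfolding \<alpha>_def using \<alpha>_off[OF H] V
    by (intro regular_on_divide regular_on_const regular_on_linform) (auto simp: \<alpha>_def)
  then show "regular_on n (- 1) V (\<lambda>x. a H $ t / \<alpha> H x)" by simp
qed

lemma regular_on_sm:
  assumes i: "i \<in> idx S" and V: "V \<subseteq> chart S i" and m: "m < b" and \<xi>: "\<And>l. l < N \<Longrightarrow> regular_on n 0 V (\<lambda>x. \<xi> x l)"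
  shows "regular_on n 0 V (\<lambda>x. sm (\<xi> x) i x m)"
  unfolding sm_def
proof (rule regular_on_sum)
  show "V \<subseteq> proj_space n" using V chart_sub[OF i] by blast
  fix l assume "l \<in> {..<N}"
  then show "regular_on n 0 V (\<lambda>x. F i x l m * \<xi> x l)"
    by (intro regular_on_mult0 regular_on_subset[OF F_regular[OF i _ m] V] \<xi>) auto
qed

text \<open>The local left inverse of \<open>F\<close>, transposed, splits the quotient map onto
  \<open>S\<close>. One chart is enough, since sections and images of \<open>\<xi>\<close> have the
  same transition rule.\<close>

lemma section_lift:
  assumes s: "s \<in> bundle_sections n S U" and U: "zariski_open n U" and p: "p \<in> U"
  obtains V \<xi> where "zariski_open n V" "p \<in> V" "V \<subseteq> U" "\<And>l. l < N \<Longrightarrow> regular_on n 0 V (\<lambda>x. \<xi> x l)"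
    "\<And>x j m. x \<in> V \<Longrightarrow> j \<in> idx S \<Longrightarrow> x \<in> chart S j \<Longrightarrow> m < b \<Longrightarrow> s j x $ m = sm (\<xi> x) j x m"
proof -
  have pp: "p \<in> proj_space n" using p zariski_open_sub[OF U] by blast
  obtain i where i: "i \<in> idx S" "p \<in> chart S i" using chart_cover[OF pp] .
  obtain W K where W: "zariski_open n W" "p \<in> W" "W \<subseteq> chart S i"
    and K: "\<And>l m. l < N \<Longrightarrow> m < b \<Longrightarrow> regular_on n 0 W (\<lambda>x. K x l m)"
      "\<And>x m m'. x \<in> W \<Longrightarrow> m < b \<Longrightarrow> m' < b \<Longrightarrow> (\<Sum>l<N. K x l m * F i x l m') = (if m = m' then 1 else 0)"
    by (rule local_left_inverse[OF i]) (rule that, assumption+)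
  define \<xi> where "\<xi> x l = (\<Sum>m<b. K x l m * s i x $ m)" for x l
  have WU: "zariski_open n (W \<inter> U)" using zariski_open_Int W(1) U by blast
  have sub: "W \<inter> U \<subseteq> proj_space n" using zariski_open_sub[OF U] by blast
  have reg: "regular_on n 0 (W \<inter> U) (\<lambda>x. \<xi> x l)" if l: "l < N" for l
    unfolding \<xi>_def
  proof (rule regular_on_sum[OF sub], rule regular_on_mult0)
    fix m assume "m \<in> {..<b}"
    then have m: "m < b" by simp
    show "regular_on n 0 (W \<inter> U) (\<lambda>x. K x l m)" by (rule regular_on_subset[OF K(1)[OF l m]]) simp
    show "regular_on n 0 (W \<inter> U) (\<lambda>x. s i x $ m)"
      by (rule regular_on_subset[OF bundle_sectionsD(3)[OF s i(1) m]]) (use W in blast)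
  qed
  have si: "s i x $ m' = sm (\<xi> x) i x m'" if x: "x \<in> W \<inter> U" and m': "m' < b" for x m'
  proof -
    have "sm (\<xi> x) i x m' = (\<Sum>l<N. \<Sum>m<b. s i x $ m * (K x l m * F i x l m'))"
      by (simp add: sm_def \<xi>_def sum_distrib_left ac_simps)
    also have "\<dots> = (\<Sum>m<b. s i x $ m * (\<Sum>l<N. K x l m * F i x l m'))"
      by (subst sum.swap) (simp add: sum_distrib_left)
    also have "\<dots> = (\<Sum>m<b. s i x $ m * (if m = m' then 1 else 0))"
      using K(2) x m' by (intro sum.cong refl arg_cong2[of _ _ _ _ "(*)"]) auto
    also have "\<dots> = s i x $ m'" using m' by (simp add: if_distrib[of "\<lambda>x. _ * x"] cong: if_cong)
    finally show ?thesis by simp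
  qed
  have "s j x $ m = sm (\<xi> x) j x m" if x: "x \<in> W \<inter> U" and j: "j \<in> idx S" "x \<in> chart S j" and m: "m < b" for x j m
  proof -
    have xi: "x \<in> chart S i" using x W by blast
    have "s j x $ m = (\<Sum>m'<b. transition S j i x $$ (m, m') * s i x $ m')"
      using bundle_sectionsD(4)[OF s j(1) i(1) _ j(2) xi] x m
        mat_vec_sum[OF transition_carrier[OF j(1) i(1) j(2) xi] bundle_sectionsD(2)[OF s i(1) _ xi]] by simp
    also have "\<dots> = sm (\<xi> x) j x m"
      unfolding sm_transition[OF i(1) j(1) xi j(2) m] using si[OF x] by simp
    finally show ?thesis .
  qed
  then show thesis using that[of "W \<inter> U" \<xi>, OF WU _ _ reg] p W(2) by blast
qed

text \<open>
  At a point \<open>x\<close> off the hyperplanes, the fibres of both sheaves are the quotient of \<open>\<complex>\<^sup>N\<close> by the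
  image of \<open>B x\<close>; sections correspond to each other if locally they lift to the same \<open>\<xi>\<close>.
\<close>

definition corresponds ::
    "complex vec set \<Rightarrow> ('j \<Rightarrow> complex vec \<Rightarrow> complex vec) \<Rightarrow> (complex vec \<Rightarrow> complex vec) \<Rightarrow> bool" where
  "corresponds U s \<omega> \<longleftrightarrow> (\<forall>x\<in>U - \<Union>\<H>. \<exists>\<xi>.
     (\<forall>i\<in>idx S. x \<in> chart S i \<longrightarrow> (\<forall>m<b. s i x $ m = sm \<xi> i x m)) \<and> (\<forall>t<n + 1. \<omega> x $ t = Om \<xi> x t))"

lemma coordinates_linform:
  assumes "\<And>t. t < n + 1 \<Longrightarrow> (\<Sum>H\<in>J. c H * a H $ t) = v t"
  shows "(\<Sum>H\<in>J. c H * \<alpha> H x) = linform n v x"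
proof -
  have "(\<Sum>H\<in>J. c H * \<alpha> H x) = (\<Sum>t<n + 1. (\<Sum>H\<in>J. c H * a H $ t) * x $ t)"
    unfolding \<alpha>_def linform_def sum_distrib_left sum_distrib_right by (subst sum.swap) (simp only: mult.assoc)
  then show ?thesis using assms by (simp add: linform_def)
qed

text \<open>\<open>n + 1\<close> of the equations form a basis of the linear forms, so they have no
  common zero in projective space.\<close>

lemma card_hyperplanes_through:
  assumes p: "p \<in> proj_space n"
  shows "card {H \<in> \<H>. p \<in> H} \<le> n"
proof (rule ccontr)
  assume "\<not> ?thesis"
  then have "n + 1 \<le> card {H \<in> \<H>. p \<in> H}" by simp
  then obtain J where J: "J \<subseteq> {H \<in> \<H>. p \<in> H}" "card J = n + 1" by (rule obtain_subset_with_card_n)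
  have J\<H>: "J \<subseteq> \<H>" using J(1) by blast
  obtain C where C: "\<And>v t. t < n + 1 \<Longrightarrow> (\<Sum>H\<in>J. (\<Sum>t'<n + 1. C H t' * v t') * a H $ t) = v t"
    by (rule coordinates[OF J\<H> J(2)]) (rule that, assumption+)
  obtain c where c: "c \<le> n" "p $ c \<noteq> 0" using proj_space_coord[OF p] .
  let ?v = "\<lambda>t. if t = c then 1 else 0"
  have "linform n ?v p = (\<Sum>H\<in>J. (\<Sum>t'<n + 1. C H t' * ?v t') * \<alpha> H p)"
    by (rule coordinates_linform[OF C, symmetric])
  also have "\<dots> = 0"
  proof (intro sum.neutral ballI)
    fix H assume "H \<in> J"
    then have "\<alpha> H p = 0" using J(1) \<alpha>_zero_iff[OF _ p] by blast
    then show "(\<Sum>t'<n + 1. C H t' * ?v t') * \<alpha> H p = 0" by simp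
  qed
  also have "linform n ?v p = p $ c"
    unfolding linform_def using c(1) by (simp add: if_distrib[of "\<lambda>x. x * _"] cong: if_cong del: sum.lessThan_Suc)
  finally show False using c(2) by simp
qed

lemma dlog_index:
  assumes "u \<in> carrier_vec (n + 1)" "v \<in> carrier_vec (n + 1)" "x \<in> carrier_vec (n + 1)" "t < n + 1"
  shows "dlog u v x $ t = u $ t / linform n (\<lambda>t. u $ t) x - v $ t / linform n (\<lambda>t. v $ t) x"
  using assms by (simp add: dlog_def scalar_prod_linform[symmetric])

lemma dlog_proportional:
  assumes "hyperplane_eq n u H" "H \<in> \<H>" "t < n + 1"
  shows "u $ t / linform n (\<lambda>t. u $ t) x = a H $ t / \<alpha> H x"
proof -
  obtain d where d: "d \<noteq> 0" "\<And>t. t < n + 1 \<Longrightarrow> u $ t = d * a H $ t"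
    using hyperplane_eq_proportional[OF eq_H[OF assms(2)] assms(1)] by blast
  have "linform n (\<lambda>t. u $ t) x = d * \<alpha> H x"
    unfolding linform_def \<alpha>_def sum_distrib_left by (intro sum.cong refl) (simp add: d(2) mult.assoc)
  then show ?thesis using d assms(3) by simp
qed

text \<open>The aim is to find regular residues \<open>cf H\<close> with sum zero such that
  \<open>\<omega>\<close> is the sum of the \<open>cf H * a H / \<alpha> H\<close>;
  \<open>dual_vectors\<close> then converts them into \<open>\<xi>\<close>. The equations through
  \<open>p\<close> are completed to a basis \<open>J\<close>, in which all remaining covectors are
  expanded.\<close>

lemma log_form_lift:
  assumes \<omega>: "\<omega> \<in> log_forms n \<H> U" and U: "zariski_open n U" and p: "p \<in> U"
  shows "\<exists>V \<xi>. zariski_open n V \<and> p \<in> V \<and> V \<subseteq> U \<and> (\<forall>l<N. regular_on n 0 V (\<lambda>x. \<xi> x l)) \<and>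
    (\<forall>x\<in>V - \<Union>\<H>. \<forall>t<n + 1. Om (\<xi> x) x t = \<omega> x $ t)"
proof -
  have pp: "p \<in> proj_space n" using p zariski_open_sub[OF U] by blast
  obtain V \<b> u f \<eta> where V: "zariski_open n V" "p \<in> V" "V \<subseteq> U" "\<b> \<in> carrier_vec (n + 1)"
      "\<forall>x\<in>V. \<b> \<bullet> x \<noteq> 0" "\<forall>H\<in>\<H>. p \<in> H \<longrightarrow> hyperplane_eq n (u H) H \<and> regular_on n 0 V (f H)"
      "\<eta> \<in> one_forms n V"
      "\<forall>x\<in>V - \<Union>\<H>. \<forall>i\<le>n. \<omega> x $ i = \<eta> x $ i + (\<Sum>H\<in>{H \<in> \<H>. p \<in> H}. f H x * (dlog (u H) \<b> x $ i))"
    using \<omega> p unfolding log_forms_def mem_Collect_eq by (elim conjE ballE) (elim exE conjE, rule that, assumption+, blast)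
  have Vp: "V \<subseteq> proj_space n" by (rule zariski_open_sub[OF V(1)])
  define \<beta> where "\<beta> x = linform n (\<lambda>t. \<b> $ t) x" for x
  have \<beta>: "\<beta> x \<noteq> 0" if "x \<in> V" for x
    using V(5) that Vp scalar_prod_linform[OF V(4), of x] by (auto simp: \<beta>_def proj_space_iff)
  have \<eta>: "(\<Sum>t<n + 1. \<eta> x $ t * x $ t) = 0" if "x \<in> V" for x
  proof -
    have "\<eta> x \<in> carrier_vec (n + 1)" "\<eta> x \<bullet> x = 0" using V(7) that by (auto simp: one_forms_def)
    moreover have "x \<in> carrier_vec (n + 1)" using that Vp by (auto simp: proj_space_iff)
    ultimately show ?thesis using scalar_prod_linform[of "\<eta> x" n x] by (simp add: linform_def)
  qed
  have \<eta>_reg: "regular_on n (- 1) V (\<lambda>x. \<eta> x $ t)" if "t < n + 1" for t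
    using V(7) that by (auto simp: one_forms_def)
  define Jp where "Jp = {H \<in> \<H>. p \<in> H}"
  have "card Jp \<le> n + 1" using card_hyperplanes_through[OF pp] by (simp add: Jp_def)
  then obtain J where J: "Jp \<subseteq> J" "J \<subseteq> \<H>" "card J = n + 1"
    using exists_subset_between[of Jp "n + 1" \<H>] card_H fin by (auto simp: Jp_def)
  have fJ: "finite J" "finite Jp" using J fin finite_subset by (blast, simp add: Jp_def)
  obtain C where C: "\<And>v t. t < n + 1 \<Longrightarrow> (\<Sum>H\<in>J. (\<Sum>t'<n + 1. C H t' * v t') * a H $ t) = v t"
    by (rule coordinates[OF J(2,3)]) (rule that, assumption+)
  define co where "co v H = (\<Sum>t'<n + 1. C H t' * v t')" for v H
  have co: "(\<Sum>H\<in>J. co v H * a H $ t) = v t" if "t < n + 1" for v t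
    unfolding co_def by (rule C[OF that])
  have co_lin: "(\<Sum>H\<in>J. co v H * \<alpha> H x) = linform n v x" for v x
    by (rule coordinates_linform) (rule co)
  obtain D where D: "\<And>c H. (\<Sum>H\<in>\<H>. c H) = 0 \<Longrightarrow> H \<in> \<H> \<Longrightarrow>
    dot N (w H) (\<lambda>l. \<Sum>H'\<in>\<H>. c H' * D H' l) = c H"
    by (rule dual_vectors) (rule that, assumption+)
  define \<sigma> where "\<sigma> x = (\<Sum>H\<in>Jp. f H x)" for x
  \<comment> \<open>A covector \<open>\<Sum> co v H * a H\<close> has the residues
    \<open>\<alpha> H * co v H\<close>, which vanish on \<open>H\<close>. This is applied to
    \<open>\<eta>\<close> and to \<open>\<b> / \<beta>\<close>, which the \<open>dlog\<close> terms
    bring in with total coefficient \<open>- \<sigma>\<close>.\<close>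
  define cf where "cf H x = (if H \<in> J then \<alpha> H x * co (\<lambda>t. \<eta> x $ t) H + (if H \<in> Jp then f H x else 0)
      - \<sigma> x * (co (\<lambda>t. \<b> $ t) H * (\<alpha> H x / \<beta> x)) else 0)" for H x
  have sumJ: "(\<Sum>H\<in>J. if H \<in> Jp then g H else 0) = (\<Sum>H\<in>Jp. g H)" for g :: "complex vec set \<Rightarrow> complex"
    using fJ J(1) by (simp add: sum.inter_restrict[symmetric] Int_absorb1)
  have cf_sum: "(\<Sum>H\<in>\<H>. cf H x) = 0" if x: "x \<in> V" for x
  proof -
    have "(\<Sum>H\<in>\<H>. cf H x) = (\<Sum>H\<in>J. cf H x)"
      using J(2) fin by (intro sum.mono_neutral_right) (auto simp: cf_def)
    also have "\<dots> = (\<Sum>H\<in>J. co (\<lambda>t. \<eta> x $ t) H * \<alpha> H x) + (\<Sum>H\<in>J. if H \<in> Jp then f H x else 0)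
        - \<sigma> x / \<beta> x * (\<Sum>H\<in>J. co (\<lambda>t. \<b> $ t) H * \<alpha> H x)"
      unfolding sum_distrib_left sum_subtractf[symmetric] sum.distrib[symmetric]
      by (intro sum.cong refl) (simp add: cf_def ac_simps)
    \<comment> \<open>Contraction with the Euler field: \<open>\<eta>\<close> contributes 0 and
      \<open>\<b> / \<beta>\<close> contributes 1, so that \<open>- \<sigma>\<close> cancels the sum
      of the \<open>f H\<close>.\<close>
    also have "\<dots> = 0"
      unfolding co_lin sumJ using \<eta>[OF x] \<beta>[OF x]
      by (simp only: linform_def[symmetric] \<beta>_def[symmetric] \<sigma>_def[symmetric]) simp
    finally show ?thesis .
  qed
  have cf_reg: "regular_on n 0 V (\<lambda>x. cf H x)" for H
  proof (cases "H \<in> J")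
    case True
    have f_reg: "regular_on n 0 V (f H)" if "H \<in> Jp" for H using V(6) that by (simp add: Jp_def)
    have "regular_on n (1 + - 1) V (\<lambda>x. \<alpha> H x * co (\<lambda>t. \<eta> x $ t) H)"
      unfolding \<alpha>_def co_def
      by (intro regular_on_mult regular_on_linform[OF Vp] regular_on_sum[OF Vp] regular_on_scale[OF Vp] \<eta>_reg) simp
    then have 1: "regular_on n 0 V (\<lambda>x. \<alpha> H x * co (\<lambda>t. \<eta> x $ t) H)" by simp
    have 2: "regular_on n 0 V (\<lambda>x. if H \<in> Jp then f H x else 0)"
      using f_reg regular_on_zero[OF Vp] by (cases "H \<in> Jp") auto
    have "regular_on n (1 - 1) V (\<lambda>x. \<alpha> H x / \<beta> x)"
      unfolding \<alpha>_def \<beta>_def by (intro regular_on_divide regular_on_linform[OF Vp]) (use \<beta> in \<open>simp add: \<beta>_def\<close>)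
    then have 3: "regular_on n 0 V (\<lambda>x. \<alpha> H x / \<beta> x)" by simp
    have 4: "regular_on n 0 V \<sigma>" unfolding \<sigma>_def by (intro regular_on_sum[OF Vp] f_reg)
    have "regular_on n 0 V (\<lambda>x. \<alpha> H x * co (\<lambda>t. \<eta> x $ t) H + (if H \<in> Jp then f H x else 0)
      - \<sigma> x * (co (\<lambda>t. \<b> $ t) H * (\<alpha> H x / \<beta> x)))"
      by (rule regular_on_diff[OF Vp regular_on_add[OF 1 2] regular_on_mult0[OF 4 regular_on_scale[OF Vp 3]]])
    then show ?thesis using True by (simp add: cf_def)
  next
    case False
    then show ?thesis using regular_on_zero[OF Vp] by (simp add: cf_def)
  qed
  define \<xi> where "\<xi> x l = (\<Sum>H\<in>\<H>. cf H x * D H l)" for x l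
  have \<xi>_reg: "regular_on n 0 V (\<lambda>x. \<xi> x l)" for l
    unfolding \<xi>_def by (intro regular_on_sum[OF Vp] regular_on_mult0 cf_reg regular_on_const[OF Vp])
  have "Om (\<xi> x) x t = \<omega> x $ t" if x: "x \<in> V - \<Union>\<H>" and t: "t < n + 1" for x t
  proof -
    have xV: "x \<in> V" "x \<in> proj_space n" "x \<notin> \<Union>\<H>" using x Vp by auto
    have dot: "dot N (w H) (\<xi> x) = cf H x" if "H \<in> \<H>" for H
      unfolding \<xi>_def by (rule D[OF cf_sum[OF xV(1)] that])
    have "Om (\<xi> x) x t = (\<Sum>H\<in>\<H>. cf H x * (a H $ t / \<alpha> H x))"
      unfolding Om_def by (intro sum.cong refl) (simp add: dot)
    also have "\<dots> = (\<Sum>H\<in>J. cf H x * (a H $ t / \<alpha> H x))"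
      using J(2) fin by (intro sum.mono_neutral_right) (auto simp: cf_def)
    also have "\<dots> = (\<Sum>H\<in>J. co (\<lambda>t. \<eta> x $ t) H * a H $ t) + (\<Sum>H\<in>J. if H \<in> Jp then f H x * (a H $ t / \<alpha> H x) else 0)
        - \<sigma> x / \<beta> x * (\<Sum>H\<in>J. co (\<lambda>t. \<b> $ t) H * a H $ t)"
      unfolding sum_distrib_left sum_subtractf[symmetric] sum.distrib[symmetric]
    proof (intro sum.cong refl)
      fix H assume H: "H \<in> J"
      then have "\<alpha> H x \<noteq> 0" using J(2) \<alpha>_off[OF _ xV(2,3)] by blast
      then show "cf H x * (a H $ t / \<alpha> H x) = co (\<lambda>t. \<eta> x $ t) H * a H $ t
          + (if H \<in> Jp then f H x * (a H $ t / \<alpha> H x) else 0) - \<sigma> x / \<beta> x * (co (\<lambda>t. \<b> $ t) H * a H $ t)"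
        using H \<beta>[OF xV(1)] by (simp add: cf_def field_simps)
    qed
    also have "\<dots> = \<eta> x $ t + (\<Sum>H\<in>Jp. f H x * (a H $ t / \<alpha> H x)) - \<sigma> x / \<beta> x * \<b> $ t"
      unfolding co[OF t] sumJ ..
    also have "\<dots> = \<eta> x $ t + (\<Sum>H\<in>Jp. f H x * (a H $ t / \<alpha> H x - \<b> $ t / \<beta> x))"
      by (simp add: right_diff_distrib sum_subtractf \<sigma>_def sum_distrib_right sum_divide_distrib)
    also have "(\<Sum>H\<in>Jp. f H x * (a H $ t / \<alpha> H x - \<b> $ t / \<beta> x)) = (\<Sum>H\<in>Jp. f H x * (dlog (u H) \<b> x $ t))"
    proof (intro sum.cong refl)
      fix H assume "H \<in> Jp"
      then have H: "H \<in> \<H>" "hyperplane_eq n (u H) H" using V(6) by (auto simp: Jp_def)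
      have "u H \<in> carrier_vec (n + 1)" using H(2) by (simp add: hyperplane_eq_def)
      then have "dlog (u H) \<b> x $ t = a H $ t / \<alpha> H x - \<b> $ t / \<beta> x"
        using dlog_index[OF _ V(4) _ t, of "u H" x] dlog_proportional[OF H(2,1) t] xV(2)
        by (simp add: \<beta>_def proj_space_iff)
      then show "f H x * (a H $ t / \<alpha> H x - \<b> $ t / \<beta> x) = f H x * (dlog (u H) \<b> x $ t)" by simp
    qed
    also have "\<eta> x $ t + (\<Sum>H\<in>Jp. f H x * (dlog (u H) \<b> x $ t)) = \<omega> x $ t"
      using V(8) x t by (simp add: Jp_def)
    finally show ?thesis .
  qed
  then show ?thesis using V(1-3) \<xi>_reg by blast
qed

text \<open>\<open>X\<close> picks any lift at each point. Off the hyperplanes the form depends only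
  on the section, so it can be computed with a local regular lift, which gives both regularity and
  the logarithmic shape.\<close>

lemma section_log_form:
  assumes s: "s \<in> bundle_sections n S U" and U: "zariski_open n U"
  shows "\<exists>\<omega>\<in>log_forms n \<H> U. corresponds U s \<omega>"
proof -
  have Up: "U \<subseteq> proj_space n" by (rule zariski_open_sub[OF U])
  define lifts where "lifts x \<xi> \<longleftrightarrow> (\<forall>i\<in>idx S. x \<in> chart S i \<longrightarrow> (\<forall>m<b. s i x $ m = sm \<xi> i x m))" for x \<xi>
  have loc: "\<exists>V \<xi>. zariski_open n V \<and> p \<in> V \<and> V \<subseteq> U \<and> (\<forall>l<N. regular_on n 0 V (\<lambda>x. \<xi> x l)) \<and>
      (\<forall>x\<in>V. lifts x (\<xi> x))" if p: "p \<in> U" for p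
  proof -
    obtain V \<xi> where V: "zariski_open n V" "p \<in> V" "V \<subseteq> U" "\<And>l. l < N \<Longrightarrow> regular_on n 0 V (\<lambda>x. \<xi> x l)"
      "\<And>x j m. x \<in> V \<Longrightarrow> j \<in> idx S \<Longrightarrow> x \<in> chart S j \<Longrightarrow> m < b \<Longrightarrow> s j x $ m = sm (\<xi> x) j x m"
      by (rule section_lift[OF s U p]) (rule that, assumption+)
    then have "\<forall>x\<in>V. lifts x (\<xi> x)" by (simp add: lifts_def)
    then show ?thesis using V(1-4) by blast
  qed
  define X where "X x = (SOME \<xi>. lifts x \<xi>)" for x
  have X: "lifts x (X x)" if "x \<in> U" for x
    unfolding X_def using loc[OF that] by (metis someI_ex)
  have Om_X: "Om \<xi> x t = Om (X x) x t" if x: "x \<in> U" "x \<notin> \<Union>\<H>" "lifts x \<xi>" "t < n + 1" for x \<xi> t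
  proof -
    obtain i where i: "i \<in> idx S" "x \<in> chart S i" using chart_cover[of x] x(1) Up by blast
    have "\<forall>m<b. sm \<xi> i x m = sm (X x) i x m" using x(3) X[OF x(1)] i unfolding lifts_def by metis
    then show ?thesis using sm_eq_iff_Om_eq[OF x(2) i] x(4) by blast
  qed
  define \<omega> where "\<omega> x = (if x \<in> U - \<Union>\<H> then vec (n + 1) (Om (X x) x) else 0\<^sub>v (n + 1))" for x
  have "corresponds U s \<omega>"
    unfolding corresponds_def
  proof
    fix x assume "x \<in> U - \<Union>\<H>"
    then show "\<exists>\<xi>. (\<forall>i\<in>idx S. x \<in> chart S i \<longrightarrow> (\<forall>m<b. s i x $ m = sm \<xi> i x m)) \<and> (\<forall>t<n + 1. \<omega> x $ t = Om \<xi> x t)"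
      using X[of x] by (intro exI[of _ "X x"]) (simp add: \<omega>_def lifts_def)
  qed
  moreover have "\<omega> \<in> one_forms n (U - \<Union>\<H>)"
    unfolding one_forms_def mem_Collect_eq
  proof (intro conjI allI impI ballI)
    show "\<omega> x = 0\<^sub>v (n + 1)" if "x \<notin> U - \<Union>\<H>" for x using that by (auto simp: \<omega>_def)
    fix x assume x: "x \<in> U - \<Union>\<H>"
    then have xp: "x \<in> proj_space n" "x \<notin> \<Union>\<H>" using Up by auto
    show "\<omega> x \<in> carrier_vec (n + 1)" using x by (simp add: \<omega>_def)
    then show "\<omega> x \<bullet> x = 0"
      using Om_euler[OF xp, of "X x"] scalar_prod_linform[of "\<omega> x" n x] xp(1) x
      by (simp add: proj_space_iff linform_def \<omega>_def)
  next
    fix t assume t: "t \<le> n"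
    show "regular_on n (- 1) (U - \<Union>\<H>) (\<lambda>x. \<omega> x $ t)"
    proof (rule regular_on_local)
      fix p assume p: "p \<in> U - \<Union>\<H>"
      then obtain V \<xi> where V: "zariski_open n V" "p \<in> V" "V \<subseteq> U" "\<forall>l<N. regular_on n 0 V (\<lambda>x. \<xi> x l)"
        "\<forall>x\<in>V. lifts x (\<xi> x)" using loc[of p] by blast
      have sub: "V \<inter> (U - \<Union>\<H>) \<subseteq> V" by blast
      have "regular_on n (- 1) (V \<inter> (U - \<Union>\<H>)) (\<lambda>x. Om (\<xi> x) x t)"
        by (rule regular_on_Om) (use Up V(4) regular_on_subset[OF _ sub] in auto)
      then have "regular_on n (- 1) (V \<inter> (U - \<Union>\<H>)) (\<lambda>x. \<omega> x $ t)"
        by (rule regular_on_cong) (use Om_X V(5) t in \<open>auto simp: \<omega>_def\<close>)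
      then show "\<exists>V. zariski_open n V \<and> p \<in> V \<and> regular_on n (- 1) (V \<inter> (U - \<Union>\<H>)) (\<lambda>x. \<omega> x $ t)"
        using V(1,2) by blast
    qed
  qed
  moreover have "\<exists>U' b a f \<eta>. zariski_open n U' \<and> p \<in> U' \<and> U' \<subseteq> U \<and>
          b \<in> carrier_vec (n + 1) \<and> (\<forall>x\<in>U'. b \<bullet> x \<noteq> 0) \<and>
          (\<forall>H\<in>\<H>. p \<in> H \<longrightarrow> hyperplane_eq n (a H) H \<and> regular_on n 0 U' (f H)) \<and>
          \<eta> \<in> one_forms n U' \<and>
          (\<forall>x\<in>U' - \<Union>\<H>. \<forall>i\<le>n.
             \<omega> x $ i = \<eta> x $ i + (\<Sum>H\<in>{H \<in> \<H>. p \<in> H}. f H x * (dlog (a H) b x $ i)))" if p: "p \<in> U" for p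
  proof -
    obtain V \<xi> where V: "zariski_open n V" "p \<in> V" "V \<subseteq> U" "\<forall>l<N. regular_on n 0 V (\<lambda>x. \<xi> x l)"
      "\<forall>x\<in>V. lifts x (\<xi> x)" using loc[OF p] by blast
    have pp: "p \<in> proj_space n" using p Up by blast
    obtain c where c: "c \<le> n" "p $ c \<noteq> 0" using proj_space_coord[OF pp] .
    \<comment> \<open>The coordinate \<open>x $ c\<close> is the common denominator of the local
      equations near \<open>p\<close>.\<close>
    define \<b> where "\<b> = (unit_vec (n + 1) c :: complex vec)"
    define J where "J = {H \<in> \<H>. p \<in> H}"
    \<comment> \<open>The hyperplanes that miss \<open>p\<close> are removed, so that their terms
      are regular and can go into \<open>\<eta>\<close>.\<close>
    define W where "W = (V \<inter> {x \<in> proj_space n. x $ c \<noteq> 0}) \<inter> (proj_space n \<inter> (\<Inter>H\<in>\<H> - J. {x \<in> proj_space n. \<alpha> H x \<noteq> 0}))"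
    have W: "zariski_open n W"
      unfolding W_def \<alpha>_def
      by (intro zariski_open_Int zariski_open_INT V(1) zariski_open_nonzero[OF form_coord[OF c(1)]]
          zariski_open_nonzero[OF form_linform]) (use fin in simp)
    have pW: "p \<in> W" using V(2) pp c \<alpha>_zero_iff[OF _ pp] by (auto simp: W_def J_def)
    have WV: "W \<subseteq> V" "W \<subseteq> proj_space n" "W \<subseteq> U" using V(3) by (auto simp: W_def)
    have W\<alpha>: "\<alpha> H x \<noteq> 0" if "x \<in> W" "H \<in> \<H> - J" for x H using that by (auto simp: W_def)
    have b_car: "\<b> \<in> carrier_vec (n + 1)" by (simp add: \<b>_def)
    have bx: "\<b> \<bullet> x = x $ c" if "x \<in> W" for x
      using that WV(2) c(1) by (auto simp: \<b>_def proj_space_iff)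
    have xc: "x $ c \<noteq> 0" if "x \<in> W" for x using that by (auto simp: W_def)
    define f where "f H x = dot N (w H) (\<xi> x)" for H x
    have f_reg: "regular_on n 0 W (f H)" for H
      unfolding f_def dot_def
      by (intro regular_on_sum[OF WV(2)] regular_on_scale[OF WV(2)] regular_on_subset[OF _ WV(1)]) (use V(4) in simp)
    define \<eta> where "\<eta> x = (if x \<in> W then vec (n + 1) (\<lambda>t. \<Sum>H\<in>\<H> - J. f H x * (a H $ t / \<alpha> H x - \<b> $ t / x $ c))
        - vec (n + 1) (\<lambda>t. 0) else 0\<^sub>v (n + 1))" for x
    have \<eta>_ix: "\<eta> x $ t = (\<Sum>H\<in>\<H> - J. f H x * (a H $ t / \<alpha> H x - \<b> $ t / x $ c))" if "x \<in> W" "t < n + 1" for x t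
      using that by (simp add: \<eta>_def)
    have "\<eta> \<in> one_forms n W"
      unfolding one_forms_def mem_Collect_eq
    proof (intro conjI allI impI ballI)
      show "\<eta> x = 0\<^sub>v (n + 1)" if "x \<notin> W" for x using that by (simp add: \<eta>_def)
      fix x assume x: "x \<in> W"
      show car: "\<eta> x \<in> carrier_vec (n + 1)" using x by (simp add: \<eta>_def)
      have lb: "linform n (\<lambda>t. \<b> $ t) x = x $ c"
        using scalar_prod_linform[OF b_car, of x] bx[OF x] x WV(2) by (auto simp: proj_space_iff)
      have "\<eta> x \<bullet> x = (\<Sum>t<n + 1. \<eta> x $ t * x $ t)"
        using scalar_prod_linform[OF car, of x] x WV(2) by (auto simp: proj_space_iff linform_def)
      also have "\<dots> = (\<Sum>t<n + 1. \<Sum>H\<in>\<H> - J. f H x * (a H $ t * x $ t / \<alpha> H x - \<b> $ t * x $ t / x $ c))"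
        by (intro sum.cong refl) (simp add: \<eta>_ix[OF x] sum_distrib_right left_diff_distrib right_diff_distrib mult.assoc)
      also have "\<dots> = (\<Sum>H\<in>\<H> - J. f H x * (\<alpha> H x / \<alpha> H x - linform n (\<lambda>t. \<b> $ t) x / x $ c))"
        by (subst sum.swap)
          (simp only: \<alpha>_def linform_def sum_distrib_left[symmetric] sum_subtractf sum_divide_distrib)
      also have "\<dots> = 0" using W\<alpha>[OF x] xc[OF x] by (simp add: lb)
      finally show "\<eta> x \<bullet> x = 0" .
    next
      fix t assume t: "t \<le> n"
      have "regular_on n (- 1) W (\<lambda>x. \<Sum>H\<in>\<H> - J. f H x * (a H $ t / \<alpha> H x - \<b> $ t / x $ c))"
      proof (rule regular_on_sum[OF WV(2)], rule regular_on_mult0[OF f_reg])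
        fix H assume H: "H \<in> \<H> - J"
        have "regular_on n (0 - 1) W (\<lambda>x. a H $ t / \<alpha> H x)"
          by (rule regular_on_divide[OF regular_on_const[OF WV(2)]])
            (use regular_on_linform[OF WV(2)] W\<alpha>[OF _ H] in \<open>auto simp: \<alpha>_def\<close>)
        moreover have "regular_on n (0 - 1) W (\<lambda>x. \<b> $ t / x $ c)"
          by (rule regular_on_divide[OF regular_on_const[OF WV(2)] regular_on_coord[OF WV(2) c(1)] xc])
        ultimately show "regular_on n (- 1) W (\<lambda>x. a H $ t / \<alpha> H x - \<b> $ t / x $ c)"
          using regular_on_diff[OF WV(2)] by simp
      qed
      then show "regular_on n (- 1) W (\<lambda>x. \<eta> x $ t)"
        by (rule regular_on_cong) (use t in \<open>simp add: \<eta>_ix\<close>)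
    qed
    moreover have "\<omega> x $ t = \<eta> x $ t + (\<Sum>H\<in>J. f H x * (dlog (a H) \<b> x $ t))"
      if x: "x \<in> W - \<Union>\<H>" and t: "t \<le> n" for x t
    proof -
      have xW: "x \<in> W" "x \<in> U" "x \<in> V" "x \<notin> \<Union>\<H>" "x \<in> proj_space n" using x WV by auto
      have lb: "linform n (\<lambda>t. \<b> $ t) x = x $ c"
        using scalar_prod_linform[OF b_car, of x] bx[OF xW(1)] xW(5) by (auto simp: proj_space_iff)
      have "\<omega> x $ t = Om (\<xi> x) x t"
        using Om_X[OF xW(2,4)] V(5) xW t by (simp add: \<omega>_def)
      \<comment> \<open>Since the residues sum to zero, \<open>\<b> / x $ c\<close> can be
        subtracted from every term; this turns \<open>a H / \<alpha> H\<close> into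
        \<open>d log\<close>.\<close>
      also have "\<dots> = (\<Sum>H\<in>\<H>. f H x * (a H $ t / \<alpha> H x)) - (\<Sum>H\<in>\<H>. f H x) * (\<b> $ t / x $ c)"
        using sum_dot_w[of "\<xi> x"] by (simp add: Om_def f_def)
      also have "\<dots> = (\<Sum>H\<in>\<H>. f H x * (a H $ t / \<alpha> H x - \<b> $ t / x $ c))"
        by (simp only: right_diff_distrib sum_subtractf sum_distrib_right)
      also have "\<dots> = (\<Sum>H\<in>\<H> - J. f H x * (a H $ t / \<alpha> H x - \<b> $ t / x $ c))
          + (\<Sum>H\<in>J. f H x * (a H $ t / \<alpha> H x - \<b> $ t / x $ c))"
        by (rule sum.subset_diff) (use fin in \<open>auto simp: J_def\<close>)
      also have "(\<Sum>H\<in>J. f H x * (a H $ t / \<alpha> H x - \<b> $ t / x $ c)) = (\<Sum>H\<in>J. f H x * (dlog (a H) \<b> x $ t))"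
      proof (intro sum.cong refl)
        fix H assume "H \<in> J"
        then have "a H \<in> carrier_vec (n + 1)" using eq_H by (auto simp: J_def hyperplane_eq_def)
        then show "f H x * (a H $ t / \<alpha> H x - \<b> $ t / x $ c) = f H x * (dlog (a H) \<b> x $ t)"
          using dlog_index[OF _ b_car, of "a H" x t] xW(5) t lb by (simp add: proj_space_iff \<alpha>_def)
      qed
      also have "(\<Sum>H\<in>\<H> - J. f H x * (a H $ t / \<alpha> H x - \<b> $ t / x $ c)) = \<eta> x $ t"
        using \<eta>_ix[OF xW(1)] t by simp
      finally show ?thesis .
    qed
    ultimately show ?thesis
      using W pW WV(3) b_car bx xc eq_H f_reg unfolding J_def
      by (intro exI[of _ W] exI[of _ \<b>] exI[of _ a] exI[of _ f] exI[of _ \<eta>]) auto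
  qed
  ultimately have "\<omega> \<in> log_forms n \<H> U" unfolding log_forms_def mem_Collect_eq by blast
  with \<open>corresponds U s \<omega>\<close> show ?thesis by blast
qed

end

lemma smult_zero: "c \<cdot>\<^sub>v 0\<^sub>v m = (0\<^sub>v m :: complex vec)"
  by (rule eq_vecI) auto

lemma one_forms_log_forms: "\<omega> \<in> log_forms n \<H> U \<Longrightarrow> \<omega> \<in> one_forms n (U - \<Union>\<H>)"
  by (simp add: log_forms_def)

lemma log_forms_carrier: "\<omega> \<in> log_forms n \<H> U \<Longrightarrow> \<omega> x \<in> carrier_vec (n + 1)"
  using one_forms_log_forms[of \<omega> n \<H> U]
  by (cases "x \<in> U - \<Union>\<H>") (auto simp: one_forms_def simp del: DiffI)

lemma log_forms_zero: "\<omega> \<in> log_forms n \<H> U \<Longrightarrow> x \<notin> U - \<Union>\<H> \<Longrightarrow> \<omega> x = 0\<^sub>v (n + 1)"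
  using one_forms_log_forms[of \<omega> n \<H> U] unfolding one_forms_def by blast

context log_bundle
begin

text \<open>Lifts of \<open>\<omega>\<close> at different points have the same image in
  \<open>S\<close> off the hyperplanes, where the kernels agree, and by density on the whole
  overlap. So the images glue to a section.\<close>

lemma log_form_section:
  assumes \<omega>: "\<omega> \<in> log_forms n \<H> U" and U: "zariski_open n U"
  shows "\<exists>s\<in>bundle_sections n S U. corresponds U s \<omega>"
proof -
  have Up: "U \<subseteq> proj_space n" by (rule zariski_open_sub[OF U])
  have "\<forall>p. \<exists>V\<xi>. p \<in> U \<longrightarrow> zariski_open n (fst V\<xi>) \<and> p \<in> fst V\<xi> \<and> fst V\<xi> \<subseteq> U \<and>
    (\<forall>l<N. regular_on n 0 (fst V\<xi>) (\<lambda>x. snd V\<xi> x l)) \<and> (\<forall>x\<in>fst V\<xi> - \<Union>\<H>. \<forall>t<n + 1. Om (snd V\<xi> x) x t = \<omega> x $ t)"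
  proof
    fix p
    show "\<exists>V\<xi>. p \<in> U \<longrightarrow> zariski_open n (fst V\<xi>) \<and> p \<in> fst V\<xi> \<and> fst V\<xi> \<subseteq> U \<and>
      (\<forall>l<N. regular_on n 0 (fst V\<xi>) (\<lambda>x. snd V\<xi> x l)) \<and> (\<forall>x\<in>fst V\<xi> - \<Union>\<H>. \<forall>t<n + 1. Om (snd V\<xi> x) x t = \<omega> x $ t)"
    proof (cases "p \<in> U")
      case True
      from log_form_lift[OF \<omega> U this] show ?thesis
        by (elim exE) (rule exI[of _ "(_, _)"], rule impI, simp only: fst_conv snd_conv)
    qed simp
  qed
  then obtain V\<xi> where V\<xi>: "\<forall>p. p \<in> U \<longrightarrow> zariski_open n (fst (V\<xi> p)) \<and> p \<in> fst (V\<xi> p) \<and> fst (V\<xi> p) \<subseteq> U \<and>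
    (\<forall>l<N. regular_on n 0 (fst (V\<xi> p)) (\<lambda>x. snd (V\<xi> p) x l)) \<and>
    (\<forall>x\<in>fst (V\<xi> p) - \<Union>\<H>. \<forall>t<n + 1. Om (snd (V\<xi> p) x) x t = \<omega> x $ t)"
    unfolding choice_iff by (elim exE)
  define V where "V p = fst (V\<xi> p)" for p
  define \<xi> where "\<xi> p = snd (V\<xi> p)" for p
  have V: "zariski_open n (V p)" "p \<in> V p" "V p \<subseteq> U" if "p \<in> U" for p
    using V\<xi> that by (auto simp: V_def)
  have reg: "regular_on n 0 (V p) (\<lambda>x. \<xi> p x l)" if "p \<in> U" "l < N" for p l
    using V\<xi> that by (simp add: V_def \<xi>_def)
  have Om: "Om (\<xi> p x) x t = \<omega> x $ t" if "p \<in> U" "x \<in> V p" "x \<notin> \<Union>\<H>" "t < n + 1" for p x t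
    using V\<xi> that by (simp add: V_def \<xi>_def)
  have agree: "sm (\<xi> p x) i x m = sm (\<xi> q x) i x m"
    if pq: "p \<in> U" "q \<in> U" and x: "x \<in> V p" "x \<in> V q" and i: "i \<in> idx S" "x \<in> chart S i" and m: "m < b" for p q x i m
  proof -
    let ?W = "V p \<inter> V q \<inter> chart S i"
    have W: "zariski_open n ?W" using V(1) pq chart_open[OF i(1)] zariski_open_Int by blast
    have Wp: "?W \<subseteq> proj_space n" by (rule zariski_open_sub[OF W])
    have "regular_on n 0 ?W (\<lambda>x. sm (\<xi> p x) i x m)"
      by (rule regular_on_sm[OF i(1) _ m], blast, rule regular_on_subset[OF reg[OF pq(1)]], assumption, blast)
    moreover have "regular_on n 0 ?W (\<lambda>x. sm (\<xi> q x) i x m)"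
      by (rule regular_on_sm[OF i(1) _ m], blast, rule regular_on_subset[OF reg[OF pq(2)]], assumption, blast)
    ultimately have r: "regular_on n 0 ?W (\<lambda>x. sm (\<xi> p x) i x m - sm (\<xi> q x) i x m)"
      by (rule regular_on_diff[OF Wp])
    have "sm (\<xi> p x) i x m - sm (\<xi> q x) i x m = 0"
    proof (rule regular_on_zero_off[OF r W])
      show "x \<in> ?W" using x i by blast
      fix y assume y: "y \<in> ?W" "y \<notin> \<Union>\<H>"
      then have "\<forall>t<n + 1. Om (\<xi> p y) y t = Om (\<xi> q y) y t" using Om pq by simp
      then have "\<forall>m<b. sm (\<xi> p y) i y m = sm (\<xi> q y) i y m" using sm_eq_iff_Om_eq[OF y(2) i(1)] y(1) by blast
      then show "sm (\<xi> p y) i y m - sm (\<xi> q y) i y m = 0" using m by simp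
    qed
    then show ?thesis by simp
  qed
  \<comment> \<open>At \<open>x\<close> the lift chosen for \<open>x\<close> itself is used; near
    \<open>p\<close> it may be replaced by the single regular lift \<open>\<xi> p\<close>.\<close>
  define s where "s i x = (if i \<in> idx S \<and> x \<in> U \<inter> chart S i then vec b (sm (\<xi> x x) i x) else 0\<^sub>v b)" for i x
  have "s \<in> bundle_sections n S U"
  proof (rule bundle_sectionsI)
    show "s i x = 0\<^sub>v b" if "\<not> (i \<in> idx S \<and> x \<in> U \<inter> chart S i)" for i x
      by (simp only: s_def that if_False)
    show "s i x \<in> carrier_vec b" for i x by (simp add: s_def)
    fix i assume i: "i \<in> idx S"
    show "regular_on n 0 (U \<inter> chart S i) (\<lambda>x. s i x $ m)" if m: "m < b" for m
    proof (rule regular_on_local)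
      fix p assume p: "p \<in> U \<inter> chart S i"
      have pU: "p \<in> U" using p by blast
      let ?W = "V p \<inter> (U \<inter> chart S i)"
      have "regular_on n 0 ?W (\<lambda>x. sm (\<xi> p x) i x m)"
        by (rule regular_on_sm[OF i _ m]) (use regular_on_subset[OF reg[OF pU]] in auto)
      then have "regular_on n 0 ?W (\<lambda>x. s i x $ m)"
      proof (rule regular_on_cong)
        fix x assume x: "x \<in> ?W"
        then have "sm (\<xi> p x) i x m = sm (\<xi> x x) i x m"
          using agree[OF pU, of x x i m] V(2)[of x] i m by blast
        then show "sm (\<xi> p x) i x m = s i x $ m" using x i m by (simp add: s_def)
      qed
      then show "\<exists>W. zariski_open n W \<and> p \<in> W \<and> regular_on n 0 (W \<inter> (U \<inter> chart S i)) (\<lambda>x. s i x $ m)"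
        using V(1,2)[OF pU] by blast
    qed
    fix j x assume j: "j \<in> idx S" and x: "x \<in> U" "x \<in> chart S i" "x \<in> chart S j"
    have g: "transition S i j x \<in> carrier_mat b b" using transition_carrier i j x by blast
    show "s i x = transition S i j x *\<^sub>v s j x"
    proof (rule eq_vecI)
      show "dim_vec (s i x) = dim_vec (transition S i j x *\<^sub>v s j x)" using g by (simp add: s_def)
      fix m assume "m < dim_vec (transition S i j x *\<^sub>v s j x)"
      then have m: "m < b" using g by simp
      have "s i x $ m = (\<Sum>m'<b. transition S i j x $$ (m, m') * sm (\<xi> x x) j x m')"
        using sm_transition[OF j i x(3,2) m] m i x by (simp add: s_def)
      also have "\<dots> = (transition S i j x *\<^sub>v s j x) $ m"
        using mat_vec_sum[OF g _ m, of "s j x"] j x by (simp add: s_def)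
      finally show "s i x $ m = (transition S i j x *\<^sub>v s j x) $ m" .
    qed
  qed
  moreover have "corresponds U s \<omega>"
    unfolding corresponds_def
  proof
    fix x assume x: "x \<in> U - \<Union>\<H>"
    then have "\<forall>t<n + 1. \<omega> x $ t = Om (\<xi> x x) x t" using Om[of x x] V(2)[of x] by simp
    moreover have "\<forall>i\<in>idx S. x \<in> chart S i \<longrightarrow> (\<forall>m<b. s i x $ m = sm (\<xi> x x) i x m)"
      using x by (simp add: s_def)
    ultimately show "\<exists>\<xi>. (\<forall>i\<in>idx S. x \<in> chart S i \<longrightarrow> (\<forall>m<b. s i x $ m = sm \<xi> i x m)) \<and> (\<forall>t<n + 1. \<omega> x $ t = Om \<xi> x t)"
      by blast
  qed
  ultimately show ?thesis by blast
qed

text \<open>The form is determined pointwise off the hyperplanes; elsewhere both forms have the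
  normalising value zero.\<close>

lemma corresponds_unique_form:
  assumes "corresponds U s \<omega>" "corresponds U s \<omega>'" and U: "zariski_open n U"
    and car: "\<And>x. \<omega> x \<in> carrier_vec (n + 1)" "\<And>x. \<omega>' x \<in> carrier_vec (n + 1)"
    and zero: "\<And>x. x \<notin> U - \<Union>\<H> \<Longrightarrow> \<omega> x = 0\<^sub>v (n + 1)" "\<And>x. x \<notin> U - \<Union>\<H> \<Longrightarrow> \<omega>' x = 0\<^sub>v (n + 1)"
  shows "\<omega> = \<omega>'"
proof
  fix x
  show "\<omega> x = \<omega>' x"
  proof (cases "x \<in> U - \<Union>\<H>")
    case True
    then obtain \<xi> where \<xi>: "\<forall>i\<in>idx S. x \<in> chart S i \<longrightarrow> (\<forall>m<b. s i x $ m = sm \<xi> i x m)" "\<forall>t<n + 1. \<omega> x $ t = Om \<xi> x t"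
      using assms(1) unfolding corresponds_def by blast
    obtain \<xi>' where \<xi>': "\<forall>i\<in>idx S. x \<in> chart S i \<longrightarrow> (\<forall>m<b. s i x $ m = sm \<xi>' i x m)" "\<forall>t<n + 1. \<omega>' x $ t = Om \<xi>' x t"
      using assms(2) True unfolding corresponds_def by blast
    obtain i where i: "i \<in> idx S" "x \<in> chart S i" using chart_cover[of x] True zariski_open_sub[OF U] by blast
    have "\<forall>m<b. sm \<xi> i x m = sm \<xi>' i x m" using \<xi>(1) \<xi>'(1) i by metis
    then have "\<forall>t<n + 1. Om \<xi> x t = Om \<xi>' x t" using sm_eq_iff_Om_eq[of x i \<xi> \<xi>'] True i by blast
    then show ?thesis using \<xi>(2) \<xi>'(2) car[of x] by (intro eq_vecI) auto
  qed (use zero in simp)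
qed

text \<open>\<open>corresponds\<close> sees only points off the hyperplanes; at the remaining points
  the two sections agree by density.\<close>

lemma corresponds_unique_section:
  assumes "corresponds U s \<omega>" "corresponds U s' \<omega>" and U: "zariski_open n U"
    and s: "s \<in> bundle_sections n S U" "s' \<in> bundle_sections n S U"
  shows "s = s'"
proof (intro ext)
  fix i x
  show "s i x = s' i x"
  proof (cases "i \<in> idx S \<and> x \<in> U \<inter> chart S i")
    case True
    then have i: "i \<in> idx S" "x \<in> U" "x \<in> chart S i" by auto
    let ?W = "U \<inter> chart S i"
    have W: "zariski_open n ?W" using U chart_open[OF i(1)] zariski_open_Int by blast
    have "s i x $ m = s' i x $ m" if m: "m < b" for m
    proof -
      have r: "regular_on n 0 ?W (\<lambda>x. s i x $ m - s' i x $ m)"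
        by (intro regular_on_diff[OF zariski_open_sub[OF W]] bundle_sectionsD(3)[OF s(1) i(1) m] bundle_sectionsD(3)[OF s(2) i(1) m])
      have "s i x $ m - s' i x $ m = 0"
      proof (rule regular_on_zero_off[OF r W])
        show "x \<in> ?W" using i by blast
        fix y assume y: "y \<in> ?W" "y \<notin> \<Union>\<H>"
        then have yU: "y \<in> U - \<Union>\<H>" and yi: "y \<in> chart S i" by auto
        obtain \<xi> where \<xi>: "\<forall>i\<in>idx S. y \<in> chart S i \<longrightarrow> (\<forall>m<b. s i y $ m = sm \<xi> i y m)" "\<forall>t<n + 1. \<omega> y $ t = Om \<xi> y t"
          using assms(1) yU unfolding corresponds_def by blast
        obtain \<xi>' where \<xi>': "\<forall>i\<in>idx S. y \<in> chart S i \<longrightarrow> (\<forall>m<b. s' i y $ m = sm \<xi>' i y m)" "\<forall>t<n + 1. \<omega> y $ t = Om \<xi>' y t"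
          using assms(2) yU unfolding corresponds_def by blast
        have "\<forall>t<n + 1. Om \<xi> y t = Om \<xi>' y t" using \<xi>(2) \<xi>'(2) by metis
        then have "\<forall>m<b. sm \<xi> i y m = sm \<xi>' i y m" using sm_eq_iff_Om_eq[OF y(2) i(1) yi] by blast
        then show "s i y $ m - s' i y $ m = 0" using \<xi>(1) \<xi>'(1) i(1) yi m by simp
      qed
      then show ?thesis by simp
    qed
    then show ?thesis
      using bundle_sectionsD(2)[OF s(1) i] bundle_sectionsD(2)[OF s(2) i] by (intro eq_vecI) auto
  next
    case False
    then show ?thesis using bundle_sectionsD(1)[OF s(1) False] bundle_sectionsD(1)[OF s(2) False] by simp
  qed
qed

section \<open>Compatibility with the module structure\<close>

lemma sections_add:
  assumes s: "s \<in> bundle_sections n S U" "t \<in> bundle_sections n S U" and U: "zariski_open n U"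
  shows "(\<lambda>i x. s i x + t i x) \<in> bundle_sections n S U"
proof (rule bundle_sectionsI)
  show "s i x + t i x = 0\<^sub>v b" if "\<not> (i \<in> idx S \<and> x \<in> U \<inter> chart S i)" for i x
    using bundle_sectionsD(1)[OF s(1) that] bundle_sectionsD(1)[OF s(2) that] by simp
  show "s i x + t i x \<in> carrier_vec b" if "i \<in> idx S" "x \<in> U" "x \<in> chart S i" for i x
    using bundle_sectionsD(2)[OF s(1) that] bundle_sectionsD(2)[OF s(2) that] by simp
  fix i assume i: "i \<in> idx S"
  show "regular_on n 0 (U \<inter> chart S i) (\<lambda>x. (s i x + t i x) $ m)" if m: "m < b" for m
    by (rule regular_on_cong[OF regular_on_add[OF bundle_sectionsD(3)[OF s(1) i m] bundle_sectionsD(3)[OF s(2) i m]]])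
      (use carrier_vecD[OF bundle_sectionsD(2)[OF s(2) i]] m in auto)
  fix j x assume j: "j \<in> idx S" and x: "x \<in> U" "x \<in> chart S i" "x \<in> chart S j"
  show "s i x + t i x = transition S i j x *\<^sub>v (s j x + t j x)"
    using bundle_sectionsD(4)[OF s(1) i j x] bundle_sectionsD(4)[OF s(2) i j x]
      mult_add_distrib_mat_vec[OF transition_carrier[OF i j x(2,3)] bundle_sectionsD(2)[OF s(1) j x(1,3)] bundle_sectionsD(2)[OF s(2) j x(1,3)]]
    by simp
qed

lemma sections_mult:
  assumes s: "s \<in> bundle_sections n S U" and f: "regular_on n 0 U f" and U: "zariski_open n U"
  shows "(\<lambda>i x. f x \<cdot>\<^sub>v s i x) \<in> bundle_sections n S U"
proof (rule bundle_sectionsI)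
  show "f x \<cdot>\<^sub>v s i x = 0\<^sub>v b" if "\<not> (i \<in> idx S \<and> x \<in> U \<inter> chart S i)" for i x
    using bundle_sectionsD(1)[OF s(1) that] by (simp add: smult_zero)
  show "f x \<cdot>\<^sub>v s i x \<in> carrier_vec b" if "i \<in> idx S" "x \<in> U" "x \<in> chart S i" for i x
    using bundle_sectionsD(2)[OF s(1) that] by simp
  fix i assume i: "i \<in> idx S"
  show "regular_on n 0 (U \<inter> chart S i) (\<lambda>x. (f x \<cdot>\<^sub>v s i x) $ m)" if m: "m < b" for m
    by (rule regular_on_cong[OF regular_on_mult0[OF regular_on_subset[OF f] bundle_sectionsD(3)[OF s(1) i m]]])
      (use carrier_vecD[OF bundle_sectionsD(2)[OF s i]] m in auto)
  fix j x assume j: "j \<in> idx S" and x: "x \<in> U" "x \<in> chart S i" "x \<in> chart S j"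
  show "f x \<cdot>\<^sub>v s i x = transition S i j x *\<^sub>v (f x \<cdot>\<^sub>v s j x)"
    using bundle_sectionsD(4)[OF s(1) i j x]
      mult_mat_vec[OF transition_carrier[OF i j x(2,3)] bundle_sectionsD(2)[OF s(1) j x(1,3)]]
    by simp
qed

lemma sections_restrict:
  assumes s: "s \<in> bundle_sections n S U" and U': "U' \<subseteq> U"
  shows "(\<lambda>i x. if x \<in> U' then s i x else 0\<^sub>v b) \<in> bundle_sections n S U'"
proof (rule bundle_sectionsI)
  show "(if x \<in> U' then s i x else 0\<^sub>v b) = 0\<^sub>v b" if "\<not> (i \<in> idx S \<and> x \<in> U' \<inter> chart S i)" for i x
    using bundle_sectionsD(1)[OF s, of i x] that by auto
  show "(if x \<in> U' then s i x else 0\<^sub>v b) \<in> carrier_vec b" if "i \<in> idx S" "x \<in> U'" "x \<in> chart S i" for i x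
    using bundle_sectionsD(2)[OF s, of i x] that U' by auto
  fix i assume i: "i \<in> idx S"
  show "regular_on n 0 (U' \<inter> chart S i) (\<lambda>x. (if x \<in> U' then s i x else 0\<^sub>v b) $ m)" if m: "m < b" for m
    by (rule regular_on_cong[OF regular_on_subset[OF bundle_sectionsD(3)[OF s i m]]]) (use U' in auto)
  fix j x assume "j \<in> idx S" "x \<in> U'" "x \<in> chart S i" "x \<in> chart S j"
  then show "(if x \<in> U' then s i x else 0\<^sub>v b) = transition S i j x *\<^sub>v (if x \<in> U' then s j x else 0\<^sub>v b)"
    using bundle_sectionsD(4)[OF s i, of j x] U' by auto
qed

lemma sm_add: "sm (\<lambda>l. \<xi> l + \<xi>' l) i x m = sm \<xi> i x m + sm \<xi>' i x m"
  by (simp add: sm_def distrib_left sum.distrib)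

lemma sm_scale: "sm (\<lambda>l. c * \<xi> l) i x m = c * sm \<xi> i x m"
  by (simp add: sm_def sum_distrib_left ac_simps)

lemma Om_add: "Om (\<lambda>l. \<xi> l + \<xi>' l) x t = Om \<xi> x t + Om \<xi>' x t"
  by (simp only: Om_def dot_def distrib_left distrib_right sum.distrib)

lemma Om_scale: "Om (\<lambda>l. c * \<xi> l) x t = c * Om \<xi> x t"
proof -
  have "dot N u (\<lambda>l. c * \<xi> l) = c * dot N u \<xi>" for u by (simp add: dot_def sum_distrib_left ac_simps)
  then show ?thesis by (simp only: Om_def sum_distrib_left mult.assoc)
qed

lemma corresponds_add:
  assumes "corresponds U s \<omega>" "corresponds U s' \<omega>'"
    and s: "s \<in> bundle_sections n S U" "s' \<in> bundle_sections n S U"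
    and car: "\<And>x. \<omega> x \<in> carrier_vec (n + 1)" "\<And>x. \<omega>' x \<in> carrier_vec (n + 1)"
  shows "corresponds U (\<lambda>i x. s i x + s' i x) (\<lambda>x. \<omega> x + \<omega>' x)"
  unfolding corresponds_def
proof
  fix x assume x: "x \<in> U - \<Union>\<H>"
  obtain \<xi> where \<xi>: "\<forall>i\<in>idx S. x \<in> chart S i \<longrightarrow> (\<forall>m<b. s i x $ m = sm \<xi> i x m)" "\<forall>t<n + 1. \<omega> x $ t = Om \<xi> x t"
    using assms(1) x unfolding corresponds_def by blast
  obtain \<xi>' where \<xi>': "\<forall>i\<in>idx S. x \<in> chart S i \<longrightarrow> (\<forall>m<b. s' i x $ m = sm \<xi>' i x m)" "\<forall>t<n + 1. \<omega>' x $ t = Om \<xi>' x t"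
    using assms(2) x unfolding corresponds_def by blast
  have "dim_vec (s' i x) = b" if "i \<in> idx S" "x \<in> chart S i" for i
    using carrier_vecD[OF bundle_sectionsD(2)[OF s(2) that(1) _ that(2)]] x by blast
  then show "\<exists>\<xi>. (\<forall>i\<in>idx S. x \<in> chart S i \<longrightarrow> (\<forall>m<b. (s i x + s' i x) $ m = sm \<xi> i x m)) \<and>
      (\<forall>t<n + 1. (\<omega> x + \<omega>' x) $ t = Om \<xi> x t)"
    using \<xi> \<xi>' car(2)[of x] by (intro exI[of _ "\<lambda>l. \<xi> l + \<xi>' l"]) (simp add: sm_add Om_add)
qed

lemma corresponds_mult:
  assumes "corresponds U s \<omega>" and s: "s \<in> bundle_sections n S U" and car: "\<And>x. \<omega> x \<in> carrier_vec (n + 1)"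
  shows "corresponds U (\<lambda>i x. f x \<cdot>\<^sub>v s i x) (\<lambda>x. f x \<cdot>\<^sub>v \<omega> x)"
  unfolding corresponds_def
proof
  fix x assume x: "x \<in> U - \<Union>\<H>"
  obtain \<xi> where \<xi>: "\<forall>i\<in>idx S. x \<in> chart S i \<longrightarrow> (\<forall>m<b. s i x $ m = sm \<xi> i x m)" "\<forall>t<n + 1. \<omega> x $ t = Om \<xi> x t"
    using assms(1) x unfolding corresponds_def by blast
  have "dim_vec (s i x) = b" if "i \<in> idx S" "x \<in> chart S i" for i
    using carrier_vecD[OF bundle_sectionsD(2)[OF s that(1) _ that(2)]] x by blast
  then show "\<exists>\<xi>. (\<forall>i\<in>idx S. x \<in> chart S i \<longrightarrow> (\<forall>m<b. (f x \<cdot>\<^sub>v s i x) $ m = sm \<xi> i x m)) \<and>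
      (\<forall>t<n + 1. (f x \<cdot>\<^sub>v \<omega> x) $ t = Om \<xi> x t)"
    using \<xi> car[of x] by (intro exI[of _ "\<lambda>l. f x * \<xi> l"]) (simp add: sm_scale Om_scale)
qed

lemma corresponds_restrict:
  assumes "corresponds U s \<omega>" "U' \<subseteq> U"
  shows "corresponds U' (\<lambda>i x. if x \<in> U' then s i x else z i x) (\<lambda>x. if x \<in> U' then \<omega> x else z' x)"
  using assms unfolding corresponds_def by (simp add: subset_iff)

text \<open>\<open>\<Phi>\<close> picks the unique form corresponding to a section, so every
  compatibility reduces to the fact that the proposed value corresponds, and bijectivity to
  existence and uniqueness in both directions.\<close>

theorem bundle_sheaf_iso_Omega_log: "omodule_iso n (bundle_sheaf n S) (Omega_log n \<H>)"
proof -
  define \<Phi> where "\<Phi> U s = (SOME \<omega>. \<omega> \<in> log_forms n \<H> U \<and> corresponds U s \<omega>)" for U s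
  have \<Phi>: "\<Phi> U s \<in> log_forms n \<H> U" "corresponds U s (\<Phi> U s)"
    if "s \<in> bundle_sections n S U" "zariski_open n U" for U s
    using someI_ex[of "\<lambda>\<omega>. \<omega> \<in> log_forms n \<H> U \<and> corresponds U s \<omega>"] section_log_form[OF that]
    unfolding \<Phi>_def by blast+
  have eq: "\<Phi> U s = \<omega>"
    if s: "s \<in> bundle_sections n S U" and U: "zariski_open n U" and \<omega>: "corresponds U s \<omega>"
      "\<And>x. \<omega> x \<in> carrier_vec (n + 1)" "\<And>x. x \<notin> U - \<Union>\<H> \<Longrightarrow> \<omega> x = 0\<^sub>v (n + 1)" for U s \<omega>
    by (rule corresponds_unique_form[OF \<Phi>(2)[OF s U] \<omega>(1) U log_forms_carrier[OF \<Phi>(1)[OF s U]] \<omega>(2)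
          log_forms_zero[OF \<Phi>(1)[OF s U]] \<omega>(3)])
  have bij: "bij_betw (\<Phi> U) (bundle_sections n S U) (log_forms n \<H> U)" if U: "zariski_open n U" for U
    unfolding bij_betw_def
  proof
    show "inj_on (\<Phi> U) (bundle_sections n S U)"
      using corresponds_unique_section[OF _ _ U] \<Phi>(2)[OF _ U] by (intro inj_onI) metis
    show "\<Phi> U ` bundle_sections n S U = log_forms n \<H> U"
    proof
      show "\<Phi> U ` bundle_sections n S U \<subseteq> log_forms n \<H> U" using \<Phi>(1)[OF _ U] by blast
      show "log_forms n \<H> U \<subseteq> \<Phi> U ` bundle_sections n S U"
      proof
        fix \<omega> assume \<omega>: "\<omega> \<in> log_forms n \<H> U"
        obtain s where s: "s \<in> bundle_sections n S U" "corresponds U s \<omega>" using log_form_section[OF \<omega> U] by blast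
        have "\<Phi> U s = \<omega>" by (rule eq[OF s(1) U s(2) log_forms_carrier[OF \<omega>] log_forms_zero[OF \<omega>]])
        then show "\<omega> \<in> \<Phi> U ` bundle_sections n S U" using s(1) by blast
      qed
    qed
  qed
  have add: "\<Phi> U (\<lambda>i x. s i x + t i x) = (\<lambda>x. \<Phi> U s x + \<Phi> U t x)"
    if U: "zariski_open n U" and s: "s \<in> bundle_sections n S U" "t \<in> bundle_sections n S U" for U s t
  proof (rule eq[OF sections_add[OF s U] U])
    note car = log_forms_carrier[OF \<Phi>(1)[OF s(1) U]] log_forms_carrier[OF \<Phi>(1)[OF s(2) U]]
    show "corresponds U (\<lambda>i x. s i x + t i x) (\<lambda>x. \<Phi> U s x + \<Phi> U t x)"
      by (rule corresponds_add[OF \<Phi>(2)[OF s(1) U] \<Phi>(2)[OF s(2) U] s car])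
    show "\<Phi> U s x + \<Phi> U t x \<in> carrier_vec (n + 1)" for x by (rule add_carrier_vec[OF car])
    show "\<Phi> U s x + \<Phi> U t x = 0\<^sub>v (n + 1)" if "x \<notin> U - \<Union>\<H>" for x
      using log_forms_zero[OF \<Phi>(1)[OF s(1) U] that] log_forms_zero[OF \<Phi>(1)[OF s(2) U] that] by simp
  qed
  have mult: "\<Phi> U (\<lambda>i x. f x \<cdot>\<^sub>v s i x) = (\<lambda>x. f x \<cdot>\<^sub>v \<Phi> U s x)"
    if U: "zariski_open n U" and s: "s \<in> bundle_sections n S U" and f: "regular_on n 0 U f" for U s f
  proof (rule eq[OF sections_mult[OF s f U] U])
    note car = log_forms_carrier[OF \<Phi>(1)[OF s U]]
    show "corresponds U (\<lambda>i x. f x \<cdot>\<^sub>v s i x) (\<lambda>x. f x \<cdot>\<^sub>v \<Phi> U s x)"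
      by (rule corresponds_mult[OF \<Phi>(2)[OF s U] s car])
    show "f x \<cdot>\<^sub>v \<Phi> U s x \<in> carrier_vec (n + 1)" for x using car by simp
    show "f x \<cdot>\<^sub>v \<Phi> U s x = 0\<^sub>v (n + 1)" if "x \<notin> U - \<Union>\<H>" for x
      using log_forms_zero[OF \<Phi>(1)[OF s U] that] by (simp add: smult_zero)
  qed
  have res: "\<Phi> U' (\<lambda>i x. if x \<in> U' then s i x else 0\<^sub>v b) = (\<lambda>x. if x \<in> U' then \<Phi> U s x else 0\<^sub>v (n + 1))"
    if U: "zariski_open n U" and U': "zariski_open n U'" "U' \<subseteq> U" and s: "s \<in> bundle_sections n S U" for U U' s
  proof (rule eq[OF sections_restrict[OF s U'(2)] U'(1)])
    show "corresponds U' (\<lambda>i x. if x \<in> U' then s i x else 0\<^sub>v b) (\<lambda>x. if x \<in> U' then \<Phi> U s x else 0\<^sub>v (n + 1))"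
      by (rule corresponds_restrict[OF \<Phi>(2)[OF s U] U'(2)])
    show "(if x \<in> U' then \<Phi> U s x else 0\<^sub>v (n + 1)) \<in> carrier_vec (n + 1)" for x
      using log_forms_carrier[OF \<Phi>(1)[OF s U], of x] by simp
    show "(if x \<in> U' then \<Phi> U s x else 0\<^sub>v (n + 1)) = 0\<^sub>v (n + 1)" if "x \<notin> U' - \<Union>\<H>" for x
      using log_forms_zero[OF \<Phi>(1)[OF s U], of x] that U'(2) by auto
  qed
  show ?thesis
    unfolding omodule_iso_def bundle_sheaf_def Omega_log_def omodule.simps
    by (rule exI[of _ \<Phi>]) (use bij add mult res in blast)
qed

end

text \<open>The equations lie on the moment curve \<open>(1, j, ..., j ^ n)\<close>. They serve for
  \<open>k \<le> 1\<close>, where an arbitrary set of unstable hyperplanes may fail to have normal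
  crossing.\<close>

lemma exists_normal_crossing:
  assumes n: "0 < n"
  shows "\<exists>\<H>. normal_crossing n \<H> \<and> card \<H> = m"
proof -
  define a where "a j = vec (n + 1) (\<lambda>i. of_nat j ^ i :: complex)" for j :: nat
  define h where "h j = {x \<in> proj_space n. a j \<bullet> x = 0}" for j
  have a_ix: "a j $ i = of_nat j ^ i" if "i < n + 1" for i j using that by (simp add: a_def)
  have eq: "hyperplane_eq n (a j) (h j)" for j
  proof -
    have "a j $ 0 \<noteq> 0\<^sub>v (n + 1) $ 0" by (simp add: a_ix)
    then have "a j \<noteq> 0\<^sub>v (n + 1)" by metis
    then show ?thesis by (simp add: hyperplane_eq_def h_def a_def)
  qed
  text \<open>A Vandermonde system: test the relation against a Lagrange polynomial.\<close>
  have indep: "c j = 0"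
    if J: "finite J" "card J \<le> n + 1" and rel: "\<And>i. i \<le> n \<Longrightarrow> (\<Sum>j\<in>J. c j * of_nat j ^ i) = 0" and j: "j \<in> J"
    for J and c :: "nat \<Rightarrow> complex" and j
  proof -
    define P where "P = (\<Prod>j'\<in>J - {j}. [:- of_nat j', 1:] :: complex poly)"
    have "degree P = card (J - {j})"
      unfolding P_def by (subst degree_prod_eq_sum_degree) auto
    then have deg: "degree P \<le> n" using J j by (simp add: card_Diff_singleton)
    have "(\<Sum>j\<in>J. c j * poly P (of_nat j)) = (\<Sum>i\<le>degree P. coeff P i * (\<Sum>j\<in>J. c j * of_nat j ^ i))"
      unfolding poly_altdef sum_distrib_left by (subst sum.swap) (simp add: ac_simps)
    also have "\<dots> = 0" using rel deg by simp
    also have "(\<Sum>j\<in>J. c j * poly P (of_nat j)) = c j * poly P (of_nat j) + (\<Sum>j'\<in>J - {j}. c j' * poly P (of_nat j'))"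
      by (rule sum.remove[OF J(1) j])
    also have "(\<Sum>j'\<in>J - {j}. c j' * poly P (of_nat j')) = 0"
    proof (intro sum.neutral ballI)
      fix j' assume j': "j' \<in> J - {j}"
      have "poly P (of_nat j') = 0"
        unfolding P_def poly_prod by (rule prod_zero) (use J(1) j' in \<open>auto intro!: bexI[of _ j']\<close>)
      then show "c j' * poly P (of_nat j') = 0" by simp
    qed
    finally have "c j * poly P (of_nat j) = 0" by simp
    moreover have "poly P (of_nat j) \<noteq> 0" unfolding P_def poly_prod using J(1) by (simp add: prod_zero_iff)
    ultimately show ?thesis by simp
  qed
  have inj: "inj h"
  proof (rule injI, rule ccontr)
    fix i j assume ij: "h i = h j" "i \<noteq> j"
    obtain d where d: "\<And>t. t < n + 1 \<Longrightarrow> a j $ t = d * a i $ t"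
      using hyperplane_eq_proportional[OF eq[of i]] eq[of j] ij(1) by metis
    \<comment> \<open>Coordinate 0 fixes the scalar, and coordinate 1, which exists as
      \<open>0 < n\<close>, recovers the index.\<close>
    have "d = 1" using d[of 0] by (simp add: a_ix)
    then have "of_nat j = (of_nat i :: complex)" using d[of 1] n by (simp add: a_ix)
    then show False using ij(2) by simp
  qed
  have "normal_crossing n (h ` {..<m})"
    unfolding normal_crossing_def
  proof (intro conjI allI impI ballI)
    show "finite (h ` {..<m})" by simp
    show "hyperplane n H" if "H \<in> h ` {..<m}" for H using that eq by (auto simp: hyperplane_def)
    fix \<T> u c H
    assume T: "\<T> \<subseteq> h ` {..<m}" and u: "card \<T> \<le> n + 1 \<and> (\<forall>H\<in>\<T>. hyperplane_eq n (u H) H)"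
      and c: "\<forall>i\<le>n. (\<Sum>H\<in>\<T>. c H * u H $ i) = 0" and H: "H \<in> \<T>"
    obtain J where J: "J \<subseteq> {..<m}" "\<T> = h ` J" using T by (auto simp: subset_image_iff)
    have fJ: "finite J" using J(1) finite_subset by blast
    have injJ: "inj_on h J" using inj by (simp add: inj_on_def)
    \<comment> \<open>Normal crossing is tested on arbitrary equations \<open>u\<close>, which are
      non-zero multiples of the chosen ones.\<close>
    have "\<forall>j. \<exists>d. j \<in> J \<longrightarrow> d \<noteq> 0 \<and> (\<forall>t<n + 1. u (h j) $ t = d * a j $ t)"
      using hyperplane_eq_proportional[OF eq] u J(2) by (metis imageI)
    then obtain d where d: "\<And>j. j \<in> J \<Longrightarrow> d j \<noteq> 0" "\<And>j t. j \<in> J \<Longrightarrow> t < n + 1 \<Longrightarrow> u (h j) $ t = d j * a j $ t"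
      by metis
    have rel: "(\<Sum>j\<in>J. (c (h j) * d j) * of_nat j ^ i) = 0" if i: "i \<le> n" for i
    proof -
      have "(\<Sum>j\<in>J. (c (h j) * d j) * of_nat j ^ i) = (\<Sum>j\<in>J. c (h j) * u (h j) $ i)"
        using i by (intro sum.cong refl) (simp add: d(2) a_ix)
      also have "\<dots> = (\<Sum>H\<in>\<T>. c H * u H $ i)" unfolding J(2) by (simp add: sum.reindex[OF injJ])
      finally show ?thesis using c i by simp
    qed
    obtain j where j: "j \<in> J" "H = h j" using H J(2) by blast
    have "c (h j) * d j = 0"
      using indep[OF fJ _ rel j(1)] u card_image[OF injJ] J(2) by simp
    then show "c H = 0" using d(1) j by simp
  qed
  moreover have "card (h ` {..<m}) = m" using card_image[of h "{..<m}"] inj by (simp add: inj_on_def)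
  ultimately show ?thesis by blast
qed

theorem corollary5p11:
  fixes n k :: nat and S :: "'j vbundle"
  assumes "steiner n k S"
    and "infinite (unstable_hyperplanes n S) \<or> n + k + 1 \<le> card (unstable_hyperplanes n S)"
  shows "(\<forall>\<H>\<subseteq>unstable_hyperplanes n S.
            card \<H> = n + k + 1 \<and> (k \<le> 1 \<longrightarrow> normal_crossing n \<H>) \<longrightarrow>
              normal_crossing n \<H> \<and> omodule_iso n (bundle_sheaf n S) (Omega_log n \<H>)) \<and>
         logarithmic n S"
proof -
  obtain \<phi> \<psi> where "vector_bundle n S"
    "short_exact n (dual_bundle S) (trivial_bundle n (n + k)) (O1_bundle n k) \<phi> \<psi>"
    using assms(1) unfolding steiner_def by blast
  then interpret steiner_bundle n k S \<phi> \<psi> by unfold_locales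
  obtain \<U> where \<U>: "\<U> \<subseteq> unstable_hyperplanes n S" "card \<U> = n + k + 1"
    using assms(2) infinite_arbitrarily_large obtain_subset_with_card_n by metis
  then have "\<U> \<noteq> {}" by auto
  then have n: "0 < n" using \<U>(1) unstable_dim_pos by blast
  \<comment> \<open>Instability is demanded only for \<open>k \<ge> 2\<close>; for
    \<open>k \<le> 1\<close> this covers the moment curve arrangement that makes \<open>S\<close>
    logarithmic.\<close>
  have iso: "omodule_iso n (bundle_sheaf n S) (Omega_log n \<H>)"
    if nc: "normal_crossing n \<H>" and card: "card \<H> = n + k + 1"
      and unst: "2 \<le> k \<Longrightarrow> \<H> \<subseteq> unstable_hyperplanes n S" for \<H>
  proof -
    obtain a w i where data: "log_data \<H> a w i" using log_data_exists[OF n nc card unst] by blast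
    interpret log_bundle n k S \<phi> \<psi> \<H> a w i
      by unfold_locales (use n nc card data in \<open>auto simp: normal_crossing_def\<close>)
    show ?thesis by (rule bundle_sheaf_iso_Omega_log)
  qed
  have nc: "normal_crossing n \<H>"
    if "\<H> \<subseteq> unstable_hyperplanes n S" "card \<H> = n + k + 1" "k \<le> 1 \<longrightarrow> normal_crossing n \<H>" for \<H>
  proof (cases "k \<le> 1")
    case False
    have "finite \<H>" using that(2) by (metis card.infinite add_is_0 one_neq_zero)
    then show ?thesis using unstable_normal_crossing[OF _ that(1)] False by simp
  qed (use that in blast)
  have "\<exists>\<H>. normal_crossing n \<H> \<and> card \<H> = n + k + 1 \<and> (2 \<le> k \<longrightarrow> \<H> \<subseteq> unstable_hyperplanes n S)"
  proof (cases "2 \<le> k")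
    case True
    then show ?thesis using nc[OF \<U>] \<U> by auto
  next
    case False
    then show ?thesis using exists_normal_crossing[OF n] by blast
  qed
  then have "logarithmic n S" using iso unfolding logarithmic_def by blast
  then show ?thesis using nc iso by blast
qed

end
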